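(* Let $T$ be a rooted tree on leaves $0,1,\dots,n$, rooted at the leaf $0$, with all edges directed away from the root and with no vertices of degree two. Let $\mathcal{M}_T$ be the Brownian motion tree model on $T$. Then the reciprocal maximum likelihood degree of $\mathcal{M}_T$ is $$\mathrm{rmld}(\mathcal{M}_T)=\prod_{v\in \mathrm{Int}(T)}\left(2^{\mathrm{outdeg}(v)}-\mathrm{outdeg}(v)-1\right).$$
   Context: The leaves of $T$ are its degree-one vertices $0,1,\dots,n$ (the root $0$ is itself a leaf). $\mathrm{Int}(T)$ is the set of internal (non-leaf) vertices of $T$, and $\mathrm{outdeg}(v)$ is the number of edges directed out of $v$. For leaves $i,j$, $\mathrm{lca}(i,j)$ is their most recent common ancestor, with $\mathrm{lca}(i,i)=i$. Let $\mathbb{S}^n$ be the space of symmetric $n\times n$ matrices, with rows and columns indexed by the non-root leaves $1,\dots,n$. Let $$\mathcal{L}_T=\{\Sigma\in\mathbb{S}^n \mid \sigma_{ij}=\sigma_{kl}\text{ whenever }\mathrm{lca}(i,j)=\mathrm{lca}(k,l)\}.$$ The Brownian motion tree model on $T$ is $\mathcal{M}_T=\mathcal{L}_T\cap\mathbb{S}^n_{>0}$, where $\mathbb{S}^n_{>0}$ is the set of positive-definite matrices. The reciprocal log-likelihood function is $\ell_S^{\vee}(\Sigma)=\log\det(\Sigma)-\mathrm{trace}(S^{-1}\Sigma)$. The reciprocal maximum likelihood degree $\mathrm{rmld}(\mathcal{M}_T)$ is the number, counted with multiplicity, of non-singular complex critical points of $\ell_S^{\vee}$ in parameters from the model, for generic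 symmetric $S$. That is, it is the number of invertible complex matrices $\Sigma$ in the complexification of $\mathcal{L}_T$ satisfying the critical equations $\mathrm{trace}(\Sigma^{-1}E)=\mathrm{trace}(S^{-1}E)$ for all $E\in\mathcal{L}_T$, counted with multiplicity as solutions of these equations. *)

theory Defs
  imports
    "HOL-Analysis.Analysis"
    "HOL-Computational_Algebra.Polynomial"
    "Graph_Theory.Arc_Walk"
begin

section \<open>Rooted trees\<close>

text \<open>
  Uniqueness of the walk from the root to every vertex says that the underlying graph is a tree
  and that all arcs point away from the root.  (The predicate \<open>tree\<close> of the entry Graph_Theory is not
  suitable here: it only excludes directed cycles.)
\<close>

locale rooted_tree = digraph T for T :: "('v, 'e) pre_digraph" (structure) +
  fixes root :: 'v
  assumes root_in_verts: "root \<in> verts T"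
    and unique_awalk: "v \<in> verts T \<Longrightarrow> \<exists>!p. awalk root p v"

definition vdegree :: "('v, 'e) pre_digraph \<Rightarrow> 'v \<Rightarrow> nat" where
  "vdegree T v = in_degree T v + out_degree T v"

definition leaves :: "('v, 'e) pre_digraph \<Rightarrow> 'v set" where
  "leaves T = {v \<in> verts T. vdegree T v = 1}"

definition internal :: "('v, 'e) pre_digraph \<Rightarrow> 'v set" where
  "internal T = verts T - leaves T"

definition common_ancestor :: "('v, 'e) pre_digraph \<Rightarrow> 'v \<Rightarrow> 'v \<Rightarrow> 'v \<Rightarrow> bool" where
  "common_ancestor T u v a \<longleftrightarrow> a \<rightarrow>\<^sup>*\<^bsub>T\<^esub> u \<and> a \<rightarrow>\<^sup>*\<^bsub>T\<^esub> v"

definition lca :: "('v, 'e) pre_digraph \<Rightarrow> 'v \<Rightarrow> 'v \<Rightarrow> 'v" where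
  "lca T u v = (THE a. common_ancestor T u v a \<and> (\<forall>b. common_ancestor T u v b \<longrightarrow> b \<rightarrow>\<^sup>*\<^bsub>T\<^esub> a))"

section \<open>Brownian motion tree models\<close>

text \<open>
  The finite type \<open>'n\<close> plays the role of the index set $\{1,\dots,n\}$ and \<open>lf\<close> sends an index to the
  corresponding non-root leaf.  The linear space below is $\mathcal{L}_T$; the Brownian motion tree
  model is its intersection with the positive definite cone, and its reciprocal maximum likelihood
  degree depends on the model through $\mathcal{L}_T$ only.
\<close>

definition bmt_space :: "('v, 'e) pre_digraph \<Rightarrow> ('n::finite \<Rightarrow> 'v) \<Rightarrow> (real^'n^'n) set" where
  "bmt_space T lf = {\<Sigma>. transpose \<Sigma> = \<Sigma> \<and>
     (\<forall>i j k l. lca T (lf i) (lf j) = lca T (lf k) (lf l) \<longrightarrow> \<Sigma> $ i $ j = \<Sigma> $ k $ l)}"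

definition complexification :: "(real^'n^'n) set \<Rightarrow> (complex^'n^'n) set" where
  "complexification L = {\<Sigma>. map_matrix Re \<Sigma> \<in> L \<and> map_matrix Im \<Sigma> \<in> L}"

section \<open>Multiplicities of solutions\<close>

inductive polyfun :: "(complex^'n^'n \<Rightarrow> complex) \<Rightarrow> bool" where
  const: "polyfun (\<lambda>\<Sigma>. c)"
| entry: "polyfun (\<lambda>\<Sigma>. \<Sigma> $ i $ j)"
| add: "polyfun f \<Longrightarrow> polyfun g \<Longrightarrow> polyfun (\<lambda>\<Sigma>. f \<Sigma> + g \<Sigma>)"
| mult: "polyfun f \<Longrightarrow> polyfun g \<Longrightarrow> polyfun (\<lambda>\<Sigma>. f \<Sigma> * g \<Sigma>)"

text \<open>
  The following three definitions describe the local ring of the linear space \<open>X\<close> at \<open>P\<close>, i.e. the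
  localization of its coordinate ring at the maximal ideal of \<open>P\<close>.  A germ is represented by any
  total function that agrees with it on a Zariski neighbourhood of \<open>P\<close> in \<open>X\<close>, so elements of the
  ring are to be read modulo \<open>germ_eq X P\<close>.  The ideal contains every function whose germ is zero,
  hence the quotient of \<open>local_ring X P\<close> by \<open>local_ideal X F P\<close> is
  $\mathcal{O}_{X,P}/\langle F\rangle$.
\<close>

definition germ_eq ::
    "(complex^'n^'n) set \<Rightarrow> complex^'n^'n \<Rightarrow> (complex^'n^'n \<Rightarrow> complex) \<Rightarrow> (complex^'n^'n \<Rightarrow> complex) \<Rightarrow> bool" where
  "germ_eq X P \<phi> \<psi> \<longleftrightarrow> (\<exists>g. polyfun g \<and> g P \<noteq> 0 \<and> (\<forall>\<Sigma>\<in>X. g \<Sigma> \<noteq> 0 \<longrightarrow> \<phi> \<Sigma> = \<psi> \<Sigma>))"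

definition local_ring :: "(complex^'n^'n) set \<Rightarrow> complex^'n^'n \<Rightarrow> (complex^'n^'n \<Rightarrow> complex) set" where
  "local_ring X P =
     {\<phi>. \<exists>f g. polyfun f \<and> polyfun g \<and> g P \<noteq> 0 \<and> germ_eq X P \<phi> (\<lambda>\<Sigma>. f \<Sigma> / g \<Sigma>)}"

definition local_ideal ::
    "(complex^'n^'n) set \<Rightarrow> (complex^'n^'n \<Rightarrow> complex) set \<Rightarrow> complex^'n^'n \<Rightarrow> (complex^'n^'n \<Rightarrow> complex) set" where
  "local_ideal X F P = {\<phi> \<in> local_ring X P. \<exists>A a. finite A \<and> A \<subseteq> F \<and> (\<forall>f\<in>A. a f \<in> local_ring X P) \<and>
     germ_eq X P \<phi> (\<lambda>\<Sigma>. \<Sum>f\<in>A. a f \<Sigma> * f \<Sigma>)}"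

text \<open>
  The multiplicity of \<open>P\<close> as a solution in \<open>X\<close> of the equations \<open>F\<close> is
  $\dim_{\mathbb{C}} \mathcal{O}_{X,P}/\langle F\rangle$: there is a basis of length \<open>m\<close> modulo the ideal.
\<close>

definition has_multiplicity ::
    "(complex^'n^'n) set \<Rightarrow> (complex^'n^'n \<Rightarrow> complex) set \<Rightarrow> complex^'n^'n \<Rightarrow> nat \<Rightarrow> bool" where
  "has_multiplicity X F P m \<longleftrightarrow>
     (\<exists>b :: nat \<Rightarrow> complex^'n^'n \<Rightarrow> complex. (\<forall>k<m. b k \<in> local_ring X P) \<and>
       (\<forall>\<phi>\<in>local_ring X P. \<exists>!c :: nat \<Rightarrow> complex. (\<forall>k\<ge>m. c k = 0) \<and>
          (\<lambda>\<Sigma>. \<phi> \<Sigma> - (\<Sum>k<m. c k * b k \<Sigma>)) \<in> local_ideal X F P))"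

section \<open>Reciprocal maximum likelihood degree\<close>

definition critical_equations ::
    "(real^'n::finite^'n) set \<Rightarrow> complex^'n^'n \<Rightarrow> (complex^'n^'n \<Rightarrow> complex) set" where
  "critical_equations L S = (\<lambda>E \<Sigma>. trace (matrix_inv \<Sigma> ** map_matrix complex_of_real E)
                                 - trace (matrix_inv S ** map_matrix complex_of_real E)) ` L"

definition critical_points :: "(real^'n::finite^'n) set \<Rightarrow> complex^'n^'n \<Rightarrow> (complex^'n^'n) set" where
  "critical_points L S =
     {\<Sigma> \<in> complexification L. invertible \<Sigma> \<and> (\<forall>F \<in> critical_equations L S. F \<Sigma> = 0)}"

text \<open>
  Generic means: for all invertible complex symmetric \<open>S\<close> outside the zero set of a polynomial \<open>h\<close>
  that does not vanish identically on the symmetric matrices.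
\<close>

definition has_rmld :: "(real^'n::finite^'n) set \<Rightarrow> nat \<Rightarrow> bool" where
  "has_rmld L d \<longleftrightarrow>
     (\<exists>h. polyfun h \<and> (\<exists>S. transpose S = S \<and> h S \<noteq> 0) \<and>
       (\<forall>S. transpose S = S \<and> invertible S \<and> h S \<noteq> 0 \<longrightarrow>
          finite (critical_points L S) \<and>
          (\<exists>\<mu>. (\<forall>P \<in> critical_points L S.
                  has_multiplicity (complexification L) (critical_equations L S) P (\<mu> P)) \<and>
               (\<Sum>P \<in> critical_points L S. \<mu> P) = d)))"

section \<open>The degree is uniquely determined\<close>

lemma homogeneous_system:
  fixes M :: "'i \<Rightarrow> 'j \<Rightarrow> complex"
  assumes "finite J" "finite K" "card J < card K"
  shows "\<exists>x. (\<exists>k\<in>K. x k \<noteq> 0) \<and> (\<forall>j\<in>J. (\<Sum>k\<in>K. x k * M k j) = 0)"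
  using assms
proof (induction J arbitrary: K M rule: finite_induct)
  case empty
  then obtain k where "k \<in> K" by fastforce
  then show ?case by (intro exI[of _ "\<lambda>_. 1"]) auto
next
  case (insert j J)
  show ?case
  proof (cases "\<forall>k\<in>K. M k j = 0")
    case True
    have "card J < card K" using insert.prems insert.hyps by simp
    from insert.IH[OF insert.prems(1) this, of M] obtain x where
      x: "\<exists>k\<in>K. x k \<noteq> 0" "\<forall>i\<in>J. (\<Sum>k\<in>K. x k * M k i) = 0" by (elim exE conjE) (rule that)
    have "(\<Sum>k\<in>K. x k * M k j) = 0" using True by (intro sum.neutral) simp
    with x show ?thesis by (intro exI[of _ x]) simp
  next
    case False
    then obtain p where p: "p \<in> K" "M p j \<noteq> 0" by blast
    let ?K = "K - {p}"
    have "card J < card ?K" using insert.prems insert.hyps p by simp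
    have "finite ?K" using insert.prems(1) by simp
    from insert.IH[OF this \<open>card J < card ?K\<close>, of "\<lambda>k i. M k i - M k j / M p j * M p i"]
    obtain y where y: "\<exists>k\<in>?K. y k \<noteq> 0"
      "\<forall>i\<in>J. (\<Sum>k\<in>?K. y k * (M k i - M k j / M p j * M p i)) = 0"
      by (elim exE conjE) (rule that)
    define s where "s = (\<Sum>k\<in>?K. y k * M k j)"
    define x where "x = y(p := - s / M p j)"
    have sp: "(\<Sum>k\<in>K. x k * M k i) = - s / M p j * M p i + (\<Sum>k\<in>?K. y k * M k i)" for i
    proof -
      have "(\<Sum>k\<in>?K. x k * M k i) = (\<Sum>k\<in>?K. y k * M k i)"
        by (rule sum.cong) (simp_all add: x_def)
      then show ?thesis using sum.remove[OF insert.prems(1) p(1), of "\<lambda>k. x k * M k i"]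
        by (simp add: x_def)
    qed
    have "(\<Sum>k\<in>K. x k * M k j) = 0" unfolding sp using p by (simp add: s_def)
    moreover have "(\<Sum>k\<in>K. x k * M k i) = 0" if "i \<in> J" for i
    proof -
      have "0 = (\<Sum>k\<in>?K. y k * (M k i - M k j / M p j * M p i))" using y that by simp
      also have "\<dots> = (\<Sum>k\<in>?K. y k * M k i) - s / M p j * M p i"
        unfolding s_def sum_divide_distrib sum_distrib_right sum_subtractf[symmetric]
        by (rule sum.cong) (simp_all add: algebra_simps)
      finally show ?thesis unfolding sp by simp
    qed
    moreover have "\<exists>k\<in>K. x k \<noteq> 0" using y(1) by (auto simp: x_def)
    ultimately show ?thesis by (intro exI[of _ x]) auto
  qed
qed

lemma germ_eqI:
  "polyfun g \<Longrightarrow> g P \<noteq> 0 \<Longrightarrow> (\<And>\<Sigma>. \<Sigma> \<in> X \<Longrightarrow> g \<Sigma> \<noteq> 0 \<Longrightarrow> \<phi> \<Sigma> = \<psi> \<Sigma>) \<Longrightarrow> germ_eq X P \<phi> \<psi>"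
  unfolding germ_eq_def by blast

lemma germ_eqE:
  assumes "germ_eq X P \<phi> \<psi>"
  obtains g where "polyfun g" "g P \<noteq> 0" "\<forall>\<Sigma>\<in>X. g \<Sigma> \<noteq> 0 \<longrightarrow> \<phi> \<Sigma> = \<psi> \<Sigma>"
  using assms unfolding germ_eq_def by (elim exE conjE) (rule that)

lemma germ_eq_refl: "germ_eq X P \<phi> \<phi>"
  by (rule germ_eqI[OF polyfun.const[of 1]]) simp_all

lemma germ_eq_trans:
  assumes "germ_eq X P \<phi> \<psi>" "germ_eq X P \<psi> \<theta>"
  shows "germ_eq X P \<phi> \<theta>"
proof -
  obtain g where g: "polyfun g" "g P \<noteq> 0" "\<forall>\<Sigma>\<in>X. g \<Sigma> \<noteq> 0 \<longrightarrow> \<phi> \<Sigma> = \<psi> \<Sigma>"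
    by (rule germ_eqE[OF assms(1)])
  obtain h where h: "polyfun h" "h P \<noteq> 0" "\<forall>\<Sigma>\<in>X. h \<Sigma> \<noteq> 0 \<longrightarrow> \<psi> \<Sigma> = \<theta> \<Sigma>"
    by (rule germ_eqE[OF assms(2)])
  show ?thesis by (rule germ_eqI[OF polyfun.mult[OF g(1) h(1)]]) (simp_all add: g h)
qed

lemma germ_eq_add:
  assumes "germ_eq X P \<phi> \<phi>'" "germ_eq X P \<psi> \<psi>'"
  shows "germ_eq X P (\<lambda>\<Sigma>. \<phi> \<Sigma> + \<psi> \<Sigma>) (\<lambda>\<Sigma>. \<phi>' \<Sigma> + \<psi>' \<Sigma>)"
proof -
  obtain g where g: "polyfun g" "g P \<noteq> 0" "\<forall>\<Sigma>\<in>X. g \<Sigma> \<noteq> 0 \<longrightarrow> \<phi> \<Sigma> = \<phi>' \<Sigma>"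
    by (rule germ_eqE[OF assms(1)])
  obtain h where h: "polyfun h" "h P \<noteq> 0" "\<forall>\<Sigma>\<in>X. h \<Sigma> \<noteq> 0 \<longrightarrow> \<psi> \<Sigma> = \<psi>' \<Sigma>"
    by (rule germ_eqE[OF assms(2)])
  show ?thesis by (rule germ_eqI[OF polyfun.mult[OF g(1) h(1)]]) (simp_all add: g h)
qed

lemma germ_eq_scale:
  assumes "germ_eq X P \<phi> \<psi>" shows "germ_eq X P (\<lambda>\<Sigma>. c * \<phi> \<Sigma>) (\<lambda>\<Sigma>. c * \<psi> \<Sigma>)"
proof -
  obtain g where g: "polyfun g" "g P \<noteq> 0" "\<forall>\<Sigma>\<in>X. g \<Sigma> \<noteq> 0 \<longrightarrow> \<phi> \<Sigma> = \<psi> \<Sigma>"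
    by (rule germ_eqE[OF assms])
  show ?thesis by (rule germ_eqI[OF g(1)]) (simp_all add: g)
qed

lemma local_ring_polyfun: "polyfun f \<Longrightarrow> f \<in> local_ring X P"
  unfolding local_ring_def mem_Collect_eq
  by (rule exI[of _ f], rule exI[of _ "\<lambda>_. 1"]) (simp add: germ_eq_refl polyfun.const)

lemma local_ring_scale:
  assumes "\<phi> \<in> local_ring X P" shows "(\<lambda>\<Sigma>. c * \<phi> \<Sigma>) \<in> local_ring X P"
proof -
  obtain f g where fg: "polyfun f" "polyfun g" "g P \<noteq> 0" "germ_eq X P \<phi> (\<lambda>\<Sigma>. f \<Sigma> / g \<Sigma>)"
    using assms unfolding local_ring_def by blast
  then show ?thesis
    using germ_eq_scale[OF fg(4), of c] unfolding local_ring_def mem_Collect_eq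
    by (intro exI[of _ "\<lambda>\<Sigma>. c * f \<Sigma>"] exI[of _ g]) (simp add: polyfun.intros)
qed

lemma local_ring_add:
  assumes "\<phi> \<in> local_ring X P" "\<psi> \<in> local_ring X P"
  shows "(\<lambda>\<Sigma>. \<phi> \<Sigma> + \<psi> \<Sigma>) \<in> local_ring X P"
proof -
  obtain f g where fg: "polyfun f" "polyfun g" "g P \<noteq> 0" "germ_eq X P \<phi> (\<lambda>\<Sigma>. f \<Sigma> / g \<Sigma>)"
    using assms(1) unfolding local_ring_def by blast
  obtain f' g' where fg': "polyfun f'" "polyfun g'" "g' P \<noteq> 0" "germ_eq X P \<psi> (\<lambda>\<Sigma>. f' \<Sigma> / g' \<Sigma>)"
    using assms(2) unfolding local_ring_def by blast
  have pg: "polyfun (\<lambda>\<Sigma>. g \<Sigma> * g' \<Sigma>)" by (intro polyfun.mult fg fg')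
  have "germ_eq X P (\<lambda>\<Sigma>. f \<Sigma> / g \<Sigma> + f' \<Sigma> / g' \<Sigma>) (\<lambda>\<Sigma>. (f \<Sigma> * g' \<Sigma> + f' \<Sigma> * g \<Sigma>) / (g \<Sigma> * g' \<Sigma>))"
    by (rule germ_eqI[OF pg]) (simp_all add: fg(3) fg'(3) add_frac_eq)
  with germ_eq_add[OF fg(4) fg'(4)]
  have "germ_eq X P (\<lambda>\<Sigma>. \<phi> \<Sigma> + \<psi> \<Sigma>) (\<lambda>\<Sigma>. (f \<Sigma> * g' \<Sigma> + f' \<Sigma> * g \<Sigma>) / (g \<Sigma> * g' \<Sigma>))"
    by (rule germ_eq_trans)
  moreover have "polyfun (\<lambda>\<Sigma>. f \<Sigma> * g' \<Sigma> + f' \<Sigma> * g \<Sigma>)"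
    by (intro polyfun.add polyfun.mult fg fg')
  ultimately show ?thesis
    unfolding local_ring_def mem_Collect_eq using pg fg(3) fg'(3)
    by (intro exI[of _ "\<lambda>\<Sigma>. f \<Sigma> * g' \<Sigma> + f' \<Sigma> * g \<Sigma>"] exI[of _ "\<lambda>\<Sigma>. g \<Sigma> * g' \<Sigma>"]) simp
qed

lemma local_ideal_zero: "(\<lambda>_. 0) \<in> local_ideal X F P"
  unfolding local_ideal_def
  using local_ring_polyfun[OF polyfun.const[of 0], of X P] germ_eq_refl[of X P "\<lambda>_. 0"]
  by (auto intro!: exI[of _ "{}"])

lemma local_ideal_scale:
  assumes "\<phi> \<in> local_ideal X F P" shows "(\<lambda>\<Sigma>. c * \<phi> \<Sigma>) \<in> local_ideal X F P"
proof -
  obtain A a where A: "\<phi> \<in> local_ring X P" "finite A" "A \<subseteq> F" "\<forall>f\<in>A. a f \<in> local_ring X P"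
    "germ_eq X P \<phi> (\<lambda>\<Sigma>. \<Sum>f\<in>A. a f \<Sigma> * f \<Sigma>)"
    using assms unfolding local_ideal_def by blast
  have "germ_eq X P (\<lambda>\<Sigma>. c * \<phi> \<Sigma>) (\<lambda>\<Sigma>. \<Sum>f\<in>A. (c * a f \<Sigma>) * f \<Sigma>)"
    using germ_eq_scale[OF A(5), of c] by (simp add: sum_distrib_left mult.assoc)
  then show ?thesis
    unfolding local_ideal_def mem_Collect_eq using A
    by (intro conjI exI[of _ A] exI[of _ "\<lambda>f \<Sigma>. c * a f \<Sigma>"] ballI local_ring_scale) simp_all
qed

lemma local_ideal_add:
  assumes "\<phi> \<in> local_ideal X F P" "\<psi> \<in> local_ideal X F P"
  shows "(\<lambda>\<Sigma>. \<phi> \<Sigma> + \<psi> \<Sigma>) \<in> local_ideal X F P"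
proof -
  obtain A a where A: "\<phi> \<in> local_ring X P" "finite A" "A \<subseteq> F" "\<forall>f\<in>A. a f \<in> local_ring X P"
    "germ_eq X P \<phi> (\<lambda>\<Sigma>. \<Sum>f\<in>A. a f \<Sigma> * f \<Sigma>)"
    using assms(1) unfolding local_ideal_def by blast
  obtain B b where B: "\<psi> \<in> local_ring X P" "finite B" "B \<subseteq> F" "\<forall>f\<in>B. b f \<in> local_ring X P"
    "germ_eq X P \<psi> (\<lambda>\<Sigma>. \<Sum>f\<in>B. b f \<Sigma> * f \<Sigma>)"
    using assms(2) unfolding local_ideal_def by blast
  define a' where "a' = (\<lambda>f. if f \<in> A then a f else (\<lambda>_. 0))"
  define b' where "b' = (\<lambda>f. if f \<in> B then b f else (\<lambda>_. 0))"
  have 0: "(\<lambda>_. 0) \<in> local_ring X P" by (intro local_ring_polyfun polyfun.intros)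
  have "(\<Sum>f\<in>A. a f \<Sigma> * f \<Sigma>) = (\<Sum>f\<in>A \<union> B. a' f \<Sigma> * f \<Sigma>)" for \<Sigma>
    by (rule sum.mono_neutral_cong_left) (use A B in \<open>auto simp: a'_def\<close>)
  moreover have "(\<Sum>f\<in>B. b f \<Sigma> * f \<Sigma>) = (\<Sum>f\<in>A \<union> B. b' f \<Sigma> * f \<Sigma>)" for \<Sigma>
    by (rule sum.mono_neutral_cong_left) (use A B in \<open>auto simp: b'_def\<close>)
  ultimately have "germ_eq X P (\<lambda>\<Sigma>. \<phi> \<Sigma> + \<psi> \<Sigma>) (\<lambda>\<Sigma>. \<Sum>f\<in>A \<union> B. (a' f \<Sigma> + b' f \<Sigma>) * f \<Sigma>)"
    using germ_eq_add[OF A(5) B(5)] by (simp add: sum.distrib distrib_right)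
  moreover have "(\<lambda>\<Sigma>. a' f \<Sigma> + b' f \<Sigma>) \<in> local_ring X P" for f
    by (rule local_ring_add) (use A B 0 in \<open>auto simp: a'_def b'_def\<close>)
  ultimately show ?thesis
    unfolding local_ideal_def mem_Collect_eq using A(1-3) B(1-3)
    by (intro conjI exI[of _ "A \<union> B"] exI[of _ "\<lambda>f \<Sigma>. a' f \<Sigma> + b' f \<Sigma>"] ballI local_ring_add[of \<phi>])
       simp_all
qed

lemma local_ideal_sum:
  "finite K \<Longrightarrow> (\<And>k. k \<in> K \<Longrightarrow> \<phi> k \<in> local_ideal X F P) \<Longrightarrow> (\<lambda>\<Sigma>. \<Sum>k\<in>K. \<phi> k \<Sigma>) \<in> local_ideal X F P"
proof (induction K rule: finite_induct)
  case empty
  show ?case by (simp add: local_ideal_zero)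
next
  case (insert k K)
  then show ?case using local_ideal_add[of "\<phi> k" X F P "\<lambda>\<Sigma>. \<Sum>k\<in>K. \<phi> k \<Sigma>"] by simp
qed

lemma has_multiplicity_le:
  assumes "has_multiplicity X F P m" "has_multiplicity X F P m'"
  shows "m \<le> m'"
proof (rule ccontr)
  assume less: "\<not> m \<le> m'"
  from assms(1)[unfolded has_multiplicity_def] obtain b where B:
    "(\<forall>k<m. b k \<in> local_ring X P) \<and> (\<forall>\<phi>\<in>local_ring X P. \<exists>!c. (\<forall>k\<ge>m. c k = 0) \<and>
          (\<lambda>\<Sigma>. \<phi> \<Sigma> - (\<Sum>k<m. c k * b k \<Sigma>)) \<in> local_ideal X F P)" ..
  from assms(2)[unfolded has_multiplicity_def] obtain b' where B':
    "(\<forall>k<m'. b' k \<in> local_ring X P) \<and> (\<forall>\<phi>\<in>local_ring X P. \<exists>!c. (\<forall>k\<ge>m'. c k = 0) \<and>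
          (\<lambda>\<Sigma>. \<phi> \<Sigma> - (\<Sum>k<m'. c k * b' k \<Sigma>)) \<in> local_ideal X F P)" ..
  have b: "b k \<in> local_ring X P" if "k < m" for k using B that by simp
  note ub = bspec[OF conjunct2[OF B]] and ub' = bspec[OF conjunct2[OF B']]
  have "\<forall>k. \<exists>c. k < m \<longrightarrow> (\<lambda>\<Sigma>. b k \<Sigma> - (\<Sum>j<m'. c j * b' j \<Sigma>)) \<in> local_ideal X F P"
    using ex1_implies_ex[OF ub'[OF b]] by auto
  then obtain M where M: "\<And>k. k < m \<Longrightarrow> (\<lambda>\<Sigma>. b k \<Sigma> - (\<Sum>j<m'. M k j * b' j \<Sigma>)) \<in> local_ideal X F P"
    by metis
  obtain x where x: "\<exists>k\<in>{..<m}. x k \<noteq> 0" "\<forall>j\<in>{..<m'}. (\<Sum>k<m. x k * M k j) = 0"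
    using homogeneous_system[of "{..<m'}" "{..<m}" M] less by auto
  have "(\<lambda>\<Sigma>. \<Sum>k<m. - x k * (b k \<Sigma> - (\<Sum>j<m'. M k j * b' j \<Sigma>))) \<in> local_ideal X F P"
    by (intro local_ideal_sum local_ideal_scale M) auto
  also have "(\<lambda>\<Sigma>. \<Sum>k<m. - x k * (b k \<Sigma> - (\<Sum>j<m'. M k j * b' j \<Sigma>))) = (\<lambda>\<Sigma>. 0 - (\<Sum>k<m. x k * b k \<Sigma>))"
  proof
    fix \<Sigma>
    have "(\<Sum>k<m. x k * (\<Sum>j<m'. M k j * b' j \<Sigma>)) = (\<Sum>j<m'. (\<Sum>k<m. x k * M k j) * b' j \<Sigma>)"
      by (simp add: sum_distrib_left sum_distrib_right mult.assoc) (rule sum.swap)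
    also have "\<dots> = 0" using x(2) by simp
    finally show "(\<Sum>k<m. - x k * (b k \<Sigma> - (\<Sum>j<m'. M k j * b' j \<Sigma>))) = 0 - (\<Sum>k<m. x k * b k \<Sigma>)"
      by (simp add: right_diff_distrib sum_subtractf sum_negf)
  qed
  finally have 1: "(\<lambda>\<Sigma>. 0 - (\<Sum>k<m. x k * b k \<Sigma>)) \<in> local_ideal X F P" .
  define x' where "x' = (\<lambda>k. if k < m then x k else 0)"
  have "(\<lambda>_. 0) \<in> local_ring X P" by (intro local_ring_polyfun polyfun.const)
  note ub0 = ub[OF this]
  have ex1_unique: "\<exists>!c. Q c \<Longrightarrow> Q y \<Longrightarrow> Q z \<Longrightarrow> y = z" for Q and y z :: "nat \<Rightarrow> complex" by blast
  have x': "x' = (\<lambda>_. 0)"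
    by (rule ex1_unique[OF ub0]) (use 1 local_ideal_zero in \<open>simp_all add: x'_def\<close>)
  obtain k where k: "k < m" "x k \<noteq> 0" using x(1) by auto
  then have "x' k = x k" by (simp add: x'_def)
  with k(2) show False unfolding x' by simp
qed

lemma has_multiplicity_unique:
  "has_multiplicity X F P m \<Longrightarrow> has_multiplicity X F P m' \<Longrightarrow> m = m'"
  by (simp add: has_multiplicity_le order_antisym)

lemma polyfun_sum: "finite K \<Longrightarrow> (\<And>k. k \<in> K \<Longrightarrow> polyfun (f k)) \<Longrightarrow> polyfun (\<lambda>\<Sigma>. \<Sum>k\<in>K. f k \<Sigma>)"
  by (induction K rule: finite_induct) (simp_all add: polyfun.const polyfun.add)

lemma polyfun_prod: "finite K \<Longrightarrow> (\<And>k. k \<in> K \<Longrightarrow> polyfun (f k)) \<Longrightarrow> polyfun (\<lambda>\<Sigma>. \<Prod>k\<in>K. f k \<Sigma>)"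
  by (induction K rule: finite_induct) (simp_all add: polyfun.const polyfun.mult)

lemma polyfun_det: "polyfun (det :: complex^'n::finite^'n \<Rightarrow> complex)"
proof -
  have "polyfun (\<lambda>\<Sigma>::complex^'n^'n. of_int (sign p) * (\<Prod>i\<in>UNIV. \<Sigma> $ i $ p i))" for p
    by (rule polyfun.mult, rule polyfun.const, rule polyfun_prod, simp, rule polyfun.entry)
  from polyfun_sum[of "{p. p permutes (UNIV :: 'n set)}", OF _ this] show ?thesis
    unfolding det_def[abs_def] by (simp add: finite_permutations)
qed

lemma polyfun_line:
  assumes "polyfun h"
  shows "\<exists>p. \<forall>t. h (\<chi> i j. A $ i $ j + t * B $ i $ j) = poly p t"
  using assms
proof induction
  case (const c)
  show ?case by (intro exI[of _ "[:c:]"]) simp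
next
  case (entry i j)
  show ?case by (intro exI[of _ "[:A $ i $ j, B $ i $ j:]"]) simp
next
  case (add f g)
  then obtain p q where "\<forall>t. f (\<chi> i j. A $ i $ j + t * B $ i $ j) = poly p t"
    "\<forall>t. g (\<chi> i j. A $ i $ j + t * B $ i $ j) = poly q t" by blast
  then show ?case by (intro exI[of _ "p + q"]) simp
next
  case (mult f g)
  then obtain p q where "\<forall>t. f (\<chi> i j. A $ i $ j + t * B $ i $ j) = poly p t"
    "\<forall>t. g (\<chi> i j. A $ i $ j + t * B $ i $ j) = poly q t" by blast
  then show ?case by (intro exI[of _ "p * q"]) simp
qed

lemma polyfun_common_nonzero:
  fixes h1 h2 :: "complex^'n::finite^'n \<Rightarrow> complex"
  assumes "polyfun h1" "polyfun h2" "transpose A = A" "transpose B = B" "h1 A \<noteq> 0" "h2 B \<noteq> 0"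
  shows "\<exists>C. transpose C = C \<and> h1 C \<noteq> 0 \<and> h2 C \<noteq> 0"
proof -
  define C where "C = (\<lambda>t. \<chi> i j. A $ i $ j + t * (B - A) $ i $ j)"
  obtain p q where p: "\<And>t. h1 (C t) = poly p t" and q: "\<And>t. h2 (C t) = poly q t"
    using polyfun_line[OF assms(1), of A "B - A"] polyfun_line[OF assms(2), of A "B - A"]
    unfolding C_def by blast
  have "C 0 = A" "C 1 = B" by (simp_all add: C_def vec_eq_iff)
  with assms p[of 0] q[of 1] have "p * q \<noteq> 0" by auto
  then obtain t where "poly (p * q) t \<noteq> 0"
    using poly_all_0_iff_0 by blast
  moreover have "transpose (C t) = C t"
    using assms(3,4) by (simp add: C_def transpose_def vec_eq_iff)
  ultimately show ?thesis using p q by (intro exI[of _ "C t"]) auto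
qed

theorem has_rmld_unique:
  fixes L :: "(real^'n::finite^'n) set"
  assumes "has_rmld L d" "has_rmld L d'"
  shows "d = d'"
proof -
  obtain h S where h: "polyfun h" "transpose S = S" "h S \<noteq> 0" and
    hd: "\<And>S. transpose S = S \<Longrightarrow> invertible S \<Longrightarrow> h S \<noteq> 0 \<Longrightarrow>
      (\<exists>\<mu>. (\<forall>P \<in> critical_points L S.
                  has_multiplicity (complexification L) (critical_equations L S) P (\<mu> P)) \<and>
               (\<Sum>P \<in> critical_points L S. \<mu> P) = d)"
    using assms(1) unfolding has_rmld_def by blast
  obtain h' S' where h': "polyfun h'" "transpose S' = S'" "h' S' \<noteq> 0" and
    hd': "\<And>S. transpose S = S \<Longrightarrow> invertible S \<Longrightarrow> h' S \<noteq> 0 \<Longrightarrow>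
      (\<exists>\<mu>. (\<forall>P \<in> critical_points L S.
                  has_multiplicity (complexification L) (critical_equations L S) P (\<mu> P)) \<and>
               (\<Sum>P \<in> critical_points L S. \<mu> P) = d')"
    using assms(2) unfolding has_rmld_def by blast
  obtain A where A: "transpose A = A" "h A \<noteq> 0" "h' A \<noteq> 0"
    using polyfun_common_nonzero h h' by blast
  obtain C :: "complex^'n^'n" where C: "transpose C = C" "h C * h' C \<noteq> 0" "det C \<noteq> 0"
    using polyfun_common_nonzero[OF polyfun.mult[OF h(1) h'(1)] polyfun_det A(1), of "mat 1"] A
    by (auto simp: transpose_mat)
  then have inv: "invertible C" by (simp add: invertible_det_nz)
  obtain \<mu> where \<mu>: "\<And>P. P \<in> critical_points L C \<Longrightarrow>
        has_multiplicity (complexification L) (critical_equations L C) P (\<mu> P)"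
      "(\<Sum>P \<in> critical_points L C. \<mu> P) = d"
    using hd[OF C(1) inv] C(2) by auto
  obtain \<mu>' where \<mu>': "\<And>P. P \<in> critical_points L C \<Longrightarrow>
        has_multiplicity (complexification L) (critical_equations L C) P (\<mu>' P)"
      "(\<Sum>P \<in> critical_points L C. \<mu>' P) = d'"
    using hd'[OF C(1) inv] C(2) by auto
  have "(\<Sum>P \<in> critical_points L C. \<mu> P) = (\<Sum>P \<in> critical_points L C. \<mu>' P)"
    by (rule sum.cong[OF refl]) (rule has_multiplicity_unique[OF \<mu>(1) \<mu>'(1)])
  then show ?thesis using \<mu>(2) \<mu>'(2) by simp
qed

end

theory Submission
  imports Defs "HOL-Computational_Algebra.Fundamental_Theorem_Algebra"
begin

text \<open>
  The idea is to change coordinates so that the critical equations decouple into one system for each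
  internal vertex, and to count the solutions of each system as the roots of one polynomial.

  A non-root vertex of the tree is recorded by its clade, the set of leaves below it. The clades form
  a laminar family \<open>F\<close>, and the matrices of the model are the sums
  $\Sigma = \sum_{A \in F} \theta_A 1_A 1_A^T$. The critical equations prescribe the
  values of the statistics $s_A = 1_A^T \Sigma^{-1} 1_A$, independently and generically. Let $M_A$
  be the part of \<open>\<Sigma>\<close> that comes from the clades inside \<open>A\<close>, let $w_A = 1_A^T M_A^{-1} 1_A$, and for an
  internal clade \<open>v\<close> let $u_v$ be the sum of $w_c$ over the children \<open>c\<close> of \<open>v\<close>. Reading \<open>\<theta>\<close> as
  resistances along the edges of the tree, $w_A$ is the conductance from the upper end of the edge of
  \<open>A\<close> to the leaves below it, so that $\theta_v = 1/w_v - 1/u_v$ for internal \<open>v\<close> and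
  $\theta_A = 1/w_A$ for single leaves; thus \<open>w\<close> is a coordinate system. In it, the critical equations
  become $w_\rho = s_\rho$ for the largest clade and
  \[ 1/w_c - s_c/w_c^2 = 1/u_v - s_v/u_v^2 \]
  for every child \<open>c\<close> of every internal \<open>v\<close> (\<open>node_equation\<close>). Each $w_c$ occurs as an unknown of the
  system of its parent only. These coordinates exist at every critical point for generic \<open>s\<close>: if no
  $s_A$ is 0, the only obstruction forces a linear relation $s_c = s_v + \sum_{c' \ne c} s_{c'}$
  (\<open>gain_neq_1\<close>).

  In the system at \<open>v\<close> let \<open>z\<close> be the common value of both sides, which is not 0 for generic \<open>s\<close>. Then
  $w_c$ and $u_v$ are roots of $z w^2 - w + s = 0$ with $s = s_c$ and $s = s_v$, so given \<open>z\<close> they are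
  determined by signs for the square roots of the discriminants $1 - 4 z s_j$, where \<open>j\<close> runs
  through the $m = k + 1$ clades consisting of \<open>v\<close> and its \<open>k\<close> children, and $u_v = \sum w_c$ says that
  $m - 2 + \sum \pm\sqrt{1 - 4 z s_j} = 0$ for the chosen signs. The product of the left-hand
  sides over all $2^m$ choices of signs is a polynomial in \<open>z\<close> of degree at most $2^{m-1}$, and it is
  divisible by $z^m$ because the \<open>m\<close> factors with exactly one positive sign vanish at 0. That leaves at most $2^{m-1} - m = 2^k - k - 1$ solutions. A real
  parameter \<open>s\<close> at which the intermediate value theorem produces that many distinct roots
  (\<open>many_roots_point\<close>) shows that generically there are exactly so many, all simple
  (\<open>local_solution_count\<close>).

  Simplicity of these roots also gives the multiplicities: in the quotient of the local ring
  by the critical equations first \<open>z\<close>, then every $w_A$, then every $\theta_A$ becomes a constant, so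
  that the quotient is the field of complex numbers (\<open>crit_multiplicity\<close>). So the degree is the number of critical points,
  which is the product of the numbers of local solutions.
\<close>

section \<open>Polynomial functions and generic points\<close>

text \<open>
  The coordinates will be the values of the statistics, one for each clade.
\<close>

inductive mpolyfun :: "(('j \<Rightarrow> complex) \<Rightarrow> complex) \<Rightarrow> bool" where
  const: "mpolyfun (\<lambda>s. c)"
| coord: "mpolyfun (\<lambda>s. s j)"
| add: "mpolyfun f \<Longrightarrow> mpolyfun g \<Longrightarrow> mpolyfun (\<lambda>s. f s + g s)"
| mult: "mpolyfun f \<Longrightarrow> mpolyfun g \<Longrightarrow> mpolyfun (\<lambda>s. f s * g s)"

lemma mpolyfun_uminus: "mpolyfun f \<Longrightarrow> mpolyfun (\<lambda>s. - f s)"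
  using mpolyfun.mult[OF mpolyfun.const[of "-1"]] by fastforce

lemma mpolyfun_diff: "mpolyfun f \<Longrightarrow> mpolyfun g \<Longrightarrow> mpolyfun (\<lambda>s. f s - g s)"
  using mpolyfun.add[OF _ mpolyfun_uminus] by fastforce

lemma mpolyfun_sum: "(\<And>k. k \<in> K \<Longrightarrow> mpolyfun (f k)) \<Longrightarrow> mpolyfun (\<lambda>s. \<Sum>k\<in>K. f k s)"
  by (induction K rule: infinite_finite_induct) (simp_all add: mpolyfun.const mpolyfun.add)

lemma mpolyfun_prod: "(\<And>k. k \<in> K \<Longrightarrow> mpolyfun (f k)) \<Longrightarrow> mpolyfun (\<lambda>s. \<Prod>k\<in>K. f k s)"
  by (induction K rule: infinite_finite_induct) (simp_all add: mpolyfun.const mpolyfun.mult)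

lemma mpolyfun_line:
  assumes "mpolyfun h"
  shows "\<exists>p. \<forall>t. h (\<lambda>j. a j + t * b j) = poly p t"
  using assms
proof induction
  case (const c)
  show ?case by (intro exI[of _ "[:c:]"]) simp
next
  case (coord j)
  show ?case by (intro exI[of _ "[:a j, b j:]"]) simp
next
  case (add f g)
  then obtain p q where "\<forall>t. f (\<lambda>j. a j + t * b j) = poly p t"
    "\<forall>t. g (\<lambda>j. a j + t * b j) = poly q t" by blast
  then show ?case by (intro exI[of _ "p + q"]) simp
next
  case (mult f g)
  then obtain p q where "\<forall>t. f (\<lambda>j. a j + t * b j) = poly p t"
    "\<forall>t. g (\<lambda>j. a j + t * b j) = poly q t" by blast
  then show ?case by (intro exI[of _ "p * q"]) simp
qed

text \<open>
  Restricted to the line through \<open>a\<close> and \<open>b\<close>, both factors are nonzero univariate polynomials.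
\<close>

lemma mpolyfun_mult_nonzero:
  assumes "mpolyfun f" "mpolyfun g" "f a \<noteq> 0" "g b \<noteq> 0"
  shows "\<exists>c. f c * g c \<noteq> 0"
proof -
  define C where "C t j = a j + t * (b j - a j)" for t j
  obtain p q where p: "\<And>t. f (C t) = poly p t" and q: "\<And>t. g (C t) = poly q t"
    using mpolyfun_line[OF assms(1), of a "\<lambda>j. b j - a j"]
      mpolyfun_line[OF assms(2), of a "\<lambda>j. b j - a j"]
    unfolding C_def[abs_def] by blast
  have "C 0 = a" "C 1 = b" by (simp_all add: C_def fun_eq_iff)
  with assms p[of 0] q[of 1] have "p * q \<noteq> 0" by auto
  then obtain t where "poly (p * q) t \<noteq> 0" using poly_all_0_iff_0 by blast
  then show ?thesis using p q by (intro exI[of _ "C t"]) auto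
qed

lemma mpolyfun_prod_nonzero:
  assumes "finite K" "\<And>k. k \<in> K \<Longrightarrow> mpolyfun (f k)" "\<And>k. k \<in> K \<Longrightarrow> \<exists>s. f k s \<noteq> 0"
  shows "\<exists>s. (\<Prod>k\<in>K. f k s) \<noteq> 0"
  using assms
proof (induction K rule: finite_induct)
  case (insert k K)
  then obtain a b where "f k a \<noteq> 0" "(\<Prod>k\<in>K. f k b) \<noteq> 0" by blast
  with mpolyfun_mult_nonzero[of "f k" "\<lambda>s. \<Prod>k\<in>K. f k s" a b] insert show ?case
    by (simp add: mpolyfun_prod)
qed simp

text \<open>
  Univariate polynomials whose coefficients are polynomial functions of the parameters. Coefficients
  are used instead of the polynomial itself since the degree may drop at special parameters.
\<close>

definition poly_family :: "(('j \<Rightarrow> complex) \<Rightarrow> complex poly) \<Rightarrow> bool" where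
  "poly_family p \<longleftrightarrow> (\<forall>i. mpolyfun (\<lambda>s. coeff (p s) i))"

lemma poly_family_pCons:
  assumes "mpolyfun f" "poly_family p"
  shows "poly_family (\<lambda>s. pCons (f s) (p s))"
  unfolding poly_family_def
proof
  fix i show "mpolyfun (\<lambda>s. coeff (pCons (f s) (p s)) i)"
    using assms by (cases i) (simp_all add: poly_family_def)
qed

lemma poly_family_const: "poly_family (\<lambda>s. p)"
  by (simp add: poly_family_def mpolyfun.const)

lemma poly_family_add: "poly_family p \<Longrightarrow> poly_family q \<Longrightarrow> poly_family (\<lambda>s. p s + q s)"
  by (simp add: poly_family_def mpolyfun.add)

lemma poly_family_mult: "poly_family p \<Longrightarrow> poly_family q \<Longrightarrow> poly_family (\<lambda>s. p s * q s)"
  by (auto simp: poly_family_def coeff_mult intro!: mpolyfun_sum mpolyfun.mult)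

lemma poly_family_pderiv: "poly_family p \<Longrightarrow> poly_family (\<lambda>s. pderiv (p s))"
  by (auto simp: poly_family_def coeff_pderiv intro!: mpolyfun.mult mpolyfun.const)

lemma poly_family_shift: "poly_family p \<Longrightarrow> poly_family (\<lambda>s. poly_shift n (p s))"
  by (simp add: poly_family_def coeff_poly_shift)

text \<open>
  Gaussian elimination without division: a pivot that does not vanish at \<open>s0\<close> becomes a factor of
  \<open>h\<close>, so the same elimination works wherever \<open>h\<close> is nonzero.
\<close>

lemma generic_injective:
  fixes M :: "'k \<Rightarrow> 'i \<Rightarrow> ('j \<Rightarrow> complex) \<Rightarrow> complex"
  assumes "finite I" "\<And>k i. mpolyfun (M k i)"
    and "\<And>v. \<forall>k. (\<Sum>i\<in>I. M k i s0 * v i) = 0 \<Longrightarrow> \<forall>i\<in>I. v i = 0"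
  shows "\<exists>h. mpolyfun h \<and> h s0 \<noteq> 0 \<and>
    (\<forall>s v. h s \<noteq> 0 \<longrightarrow> (\<forall>k. (\<Sum>i\<in>I. M k i s * v i) = 0) \<longrightarrow> (\<forall>i\<in>I. v i = 0))"
  using assms
proof (induction I arbitrary: M rule: finite_induct)
  case empty
  show ?case by (rule exI[of _ "\<lambda>s. 1"]) (simp add: mpolyfun.const)
next
  case (insert j I)
  have split: "(\<Sum>i\<in>insert j I. M k i s * v i) = M k j s * v j + (\<Sum>i\<in>I. M k i s * v i)" for k s v
    using insert.hyps by simp
  have "\<exists>k. M k j s0 \<noteq> 0"
  proof (rule ccontr)
    assume "\<nexists>k. M k j s0 \<noteq> 0"
    then have "(\<Sum>i\<in>insert j I. M k i s0 * (if i = j then 1 else 0)) = 0" for k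
      by (intro sum.neutral) auto
    from insert.prems(2)[rule_format, OF this, of j] show False by simp
  qed
  then obtain k where k: "M k j s0 \<noteq> 0" by blast
  define M' where "M' l i = (\<lambda>s. M k j s * M l i s - M l j s * M k i s)" for l i
  have M': "mpolyfun (M' l i)" for l i
    unfolding M'_def by (intro mpolyfun_diff mpolyfun.mult insert.prems(1))
  have sum': "(\<Sum>i\<in>I. M' l i s * v i) =
    M k j s * (\<Sum>i\<in>I. M l i s * v i) - M l j s * (\<Sum>i\<in>I. M k i s * v i)" for l s v
    by (simp add: M'_def left_diff_distrib sum_subtractf sum_distrib_left mult.assoc)
  have "\<forall>i\<in>I. v i = 0" if v: "\<forall>l. (\<Sum>i\<in>I. M' l i s0 * v i) = 0" for v
  proof -
    define v' where "v' = v(j := - (\<Sum>i\<in>I. M k i s0 * v i) / M k j s0)"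
    have 1: "(\<Sum>i\<in>I. M l i s0 * v' i) = (\<Sum>i\<in>I. M l i s0 * v i)" for l
      using insert.hyps by (intro sum.cong) (auto simp: v'_def)
    have "M k j s0 * (\<Sum>i\<in>insert j I. M l i s0 * v' i) = 0" for l
      using v[rule_format, of l] k unfolding split 1 sum' by (simp add: v'_def field_simps)
    then have "\<forall>l. (\<Sum>i\<in>insert j I. M l i s0 * v' i) = 0" using k by simp
    from insert.prems(2)[OF this] show ?thesis using insert.hyps
      by (metis fun_upd_other insertCI v'_def)
  qed
  from insert.IH[of M', OF M' this] obtain h where h: "mpolyfun h" "h s0 \<noteq> 0"
    "\<And>s v. h s \<noteq> 0 \<Longrightarrow> \<forall>l. (\<Sum>i\<in>I. M' l i s * v i) = 0 \<Longrightarrow> \<forall>i\<in>I. v i = 0" by blast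
  show ?case
  proof (intro exI[of _ "\<lambda>s. M k j s * h s"] conjI allI impI)
    show "mpolyfun (\<lambda>s. M k j s * h s)" by (intro mpolyfun.mult insert.prems h)
    show "M k j s0 * h s0 \<noteq> 0" using k h by simp
    fix s v
    assume nz: "M k j s * h s \<noteq> 0" and v: "\<forall>l. (\<Sum>i\<in>insert j I. M l i s * v i) = 0"
    have e: "(\<Sum>i\<in>I. M l i s * v i) = - (M l j s * v j)" for l
      using v[rule_format, of l] unfolding split by (simp add: eq_neg_iff_add_eq_0 add.commute)
    have "\<forall>l. (\<Sum>i\<in>I. M' l i s * v i) = 0" unfolding sum' e by simp
    then have z: "\<forall>i\<in>I. v i = 0" using h(3) nz by auto
    then have "(\<Sum>i\<in>I. M k i s * v i) = 0" by simp
    with e[of k] nz z show "\<forall>i\<in>insert j I. v i = 0" by auto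
  qed
qed

lemma sum_monom_bound:
  fixes a :: "nat \<Rightarrow> complex"
  shows "d > 0 \<Longrightarrow> degree (\<Sum>i<d. monom (a i) i) < d"
  by (rule degree_sum_less) (auto intro: le_less_trans[OF degree_monom_le])

lemma coeff_sum_monom: "coeff (\<Sum>i<d. monom (a i) i) k = (if k < d then a k else (0::complex))"
  by (simp add: coeff_sum if_distrib sum.delta cong: if_cong)

text \<open>
  The roots of \<open>p\<close> can be split off one at a time, since none of them is a root of \<open>q\<close>.
\<close>

lemma dvd_cancel_no_common_root:
  fixes p q b :: "complex poly"
  assumes "p \<noteq> 0" "\<And>z. \<not> (poly p z = 0 \<and> poly q z = 0)" "p dvd b * q"
  shows "p dvd b"
  using assms
proof (induction "degree p" arbitrary: p b)
  case 0
  then have "is_unit p" by (simp add: is_unit_iff_degree)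
  then show ?case by (rule unit_imp_dvd)
next
  case (Suc n)
  then obtain z where z: "poly p z = 0"
    using fundamental_theorem_of_algebra[of p] by (auto simp: constant_degree)
  then obtain p1 where p1: "p = [:-z, 1:] * p1" by (meson dvdE poly_eq_0_iff_dvd)
  from Suc.prems(3) obtain c where c: "b * q = p * c" by (elim dvdE)
  from arg_cong[OF c, of "\<lambda>p. poly p z"] z Suc.prems(2)[of z] have "poly b z = 0" by auto
  then obtain b1 where b1: "b = [:-z, 1:] * b1" by (meson dvdE poly_eq_0_iff_dvd)
  have "p1 \<noteq> 0" using p1 Suc.prems(1) by auto
  then have "degree p = Suc (degree p1)" unfolding p1 by (subst degree_mult_eq) auto
  with Suc.hyps(2) have "n = degree p1" by simp
  moreover have "[:-z, 1:] * (b1 * q) = [:-z, 1:] * (p1 * c)"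
    using c unfolding p1 b1 by (simp only: mult.assoc)
  then have "b1 * q = p1 * c" by (subst (asm) mult_cancel_left) simp
  then have "p1 dvd b1 * q" by simp
  moreover have "\<not> (poly p1 y = 0 \<and> poly q y = 0)" for y
    using Suc.prems(2)[of y] by (auto simp: p1)
  ultimately have "p1 dvd b1" using Suc.hyps(1)[of p1 b1] \<open>p1 \<noteq> 0\<close> by blast
  then show ?case unfolding p1 b1 by (rule mult_dvd_mono[OF dvd_refl])
qed

text \<open>
  A resultant in disguise: if \<open>p\<close> has degree \<open>d\<close>, it has a common root with \<open>q\<close> iff the linear map
  $(a, b) \mapsto a p + b q$ on polynomials of degrees below \<open>e\<close> and \<open>d\<close> is not injective, and
  injectivity is generic.
\<close>

lemma generic_coprime:
  fixes p q :: "('j \<Rightarrow> complex) \<Rightarrow> complex poly"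
  assumes fam: "poly_family p" "poly_family q"
    and deg: "\<And>s. degree (p s) \<le> d" "\<And>s. degree (q s) \<le> e"
    and s0: "degree (p s0) = d" "p s0 \<noteq> 0" "\<And>z. \<not> (poly (p s0) z = 0 \<and> poly (q s0) z = 0)"
  shows "\<exists>h. mpolyfun h \<and> h s0 \<noteq> 0 \<and>
    (\<forall>s. h s \<noteq> 0 \<longrightarrow> degree (p s) = d \<and> p s \<noteq> 0 \<and> (\<forall>z. \<not> (poly (p s) z = 0 \<and> poly (q s) z = 0)))"
proof -
  \<comment> \<open>Column \<open>i < e\<close> holds the coefficients of $x^i p$ and column \<open>e + i\<close> those of $x^i q$.\<close>
  define M where "M k i s = coeff (if i < e then monom 1 i * p s else monom 1 (i - e) * q s) k" for k i s
  have M: "mpolyfun (M k i)" for k i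
  proof -
    have "poly_family (\<lambda>s. if i < e then monom 1 i * p s else monom 1 (i - e) * q s)"
      by (cases "i < e") (simp_all add: fam poly_family_const poly_family_mult)
    then show ?thesis unfolding M_def poly_family_def by blast
  qed
  define A where "A v = (\<Sum>i<e. monom (v i) i)" for v :: "nat \<Rightarrow> complex"
  define B where "B v = (\<Sum>i<d. monom (v (e + i)) i)" for v :: "nat \<Rightarrow> complex"
  have key: "(\<Sum>i<e + d. M k i s * v i) = coeff (A v * p s + B v * q s) k" for k s v
  proof -
    have "(\<Sum>i<e + d. M k i s * v i) = (\<Sum>i<e. M k i s * v i) + (\<Sum>i<d. M k (e + i) s * v (e + i))"
      by (induction d) (auto simp: algebra_simps)
    moreover have "(\<Sum>i<e. M k i s * v i) = coeff (A v * p s) k"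
      unfolding A_def sum_distrib_right coeff_sum
      by (intro sum.cong) (auto simp: M_def coeff_monom_mult)
    moreover have "(\<Sum>i<d. M k (e + i) s * v (e + i)) = coeff (B v * q s) k"
      unfolding B_def sum_distrib_right coeff_sum
      by (intro sum.cong) (auto simp: M_def coeff_monom_mult)
    ultimately show ?thesis by simp
  qed
  have key0: "(\<forall>k. (\<Sum>i<e + d. M k i s * v i) = 0) \<longleftrightarrow> A v * p s + B v * q s = 0" for s v
    unfolding key poly_eq_iff by simp
  have cA: "coeff (A v) i = (if i < e then v i else 0)" for v i unfolding A_def by (rule coeff_sum_monom)
  have cB: "coeff (B v) i = (if i < d then v (e + i) else 0)" for v i unfolding B_def by (rule coeff_sum_monom)
  have inj0: "\<forall>i<e + d. v i = 0" if "A v * p s0 + B v * q s0 = 0" for v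
  proof -
    have "p s0 dvd B v * q s0"
      using that by (metis add_eq_0_iff dvd_minus_iff dvd_triv_right)
    from dvd_cancel_no_common_root[OF s0(2,3) this] have dvd: "p s0 dvd B v" .
    have "B v = 0"
    proof (cases "d = 0")
      case True
      then show ?thesis by (simp add: B_def)
    next
      case False
      then have "degree (B v) < degree (p s0)" unfolding B_def s0(1) by (intro sum_monom_bound) simp
      then show ?thesis using dvd dvd_imp_degree_le by fastforce
    qed
    moreover from this have "A v = 0" using that s0(2) by simp
    ultimately have "v i = 0" if "i < e + d" for i
      using that cA[of v i] cB[of v "i - e"] by (cases "i < e") (auto simp: not_less split: if_splits)
    then show ?thesis by blast
  qed
  have "\<exists>h. mpolyfun h \<and> h s0 \<noteq> 0 \<and> (\<forall>s v. h s \<noteq> 0 \<longrightarrow>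
    (\<forall>k. (\<Sum>i<e + d. M k i s * v i) = 0) \<longrightarrow> (\<forall>i\<in>{..<e+d}. v i = 0))"
    by (rule generic_injective[OF _ M]) (use inj0 key0 in auto)
  then obtain h where h: "mpolyfun h" "h s0 \<noteq> 0"
    "\<And>s v. h s \<noteq> 0 \<Longrightarrow> A v * p s + B v * q s = 0 \<Longrightarrow> \<forall>i\<in>{..<e+d}. v i = 0"
    unfolding key0 by blast
  show ?thesis
  proof (intro exI[of _ "\<lambda>s. coeff (p s) d * h s"] conjI allI impI)
    show "mpolyfun (\<lambda>s. coeff (p s) d * h s)"
      using fam(1) h(1) by (auto simp: poly_family_def intro: mpolyfun.mult)
    show "coeff (p s0) d * h s0 \<noteq> 0"
      using s0(1,2) h(2) leading_coeff_neq_0[of "p s0"] by simp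
  next
    fix s assume nz: "coeff (p s) d * h s \<noteq> 0"
    show "degree (p s) = d" using nz deg(1)[of s] le_degree[of "p s" d] by simp
    show pnz: "p s \<noteq> 0" using nz by auto
    fix z show "\<not> (poly (p s) z = 0 \<and> poly (q s) z = 0)"
    proof
      assume *: "poly (p s) z = 0 \<and> poly (q s) z = 0"
      then obtain p1 q1 where p1: "p s = [:-z, 1:] * p1" and q1: "q s = [:-z, 1:] * q1"
        by (meson dvdE poly_eq_0_iff_dvd)
      have dp: "degree p1 < d"
      proof -
        have "p1 \<noteq> 0" using p1 pnz by auto
        then have "degree (p s) = Suc (degree p1)" unfolding p1 by (subst degree_mult_eq) auto
        then show ?thesis using deg(1)[of s] by simp
      qed
      have dq: "q1 = 0 \<or> degree q1 < e"
      proof (cases "q1 = 0")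
        case False
        then have "degree (q s) = Suc (degree q1)" unfolding q1 by (subst degree_mult_eq) auto
        then show ?thesis using deg(2)[of s] by simp
      qed simp
      define v where "v i = (if i < e then coeff q1 i else - coeff p1 (i - e))" for i
      have "A v = q1" using dq by (auto simp: poly_eq_iff cA v_def coeff_eq_0)
      moreover have "B v = - p1" using dp by (auto simp: poly_eq_iff cB v_def coeff_eq_0)
      ultimately have "A v * p s + B v * q s = 0" by (simp add: p1 q1 algebra_simps)
      from h(3)[OF _ this] nz have "\<forall>i\<in>{..<e+d}. v i = 0" by simp
      then have "B v = 0" by (simp add: B_def)
      with \<open>B v = - p1\<close> p1 pnz show False by auto
    qed
  qed
qed

section \<open>Products over all choices of signs\<close>

text \<open>
  The choice of signs that is positive exactly on \<open>E\<close>.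
\<close>

definition flip :: "'j set \<Rightarrow> ('j \<Rightarrow> 'a::uminus) \<Rightarrow> 'j \<Rightarrow> 'a" where
  "flip E r = (\<lambda>j. if j \<in> E then r j else - r j)"

abbreviation signed_sum :: "'j set \<Rightarrow> 'j set \<Rightarrow> ('j \<Rightarrow> 'a::ab_group_add) \<Rightarrow> 'a" where
  "signed_sum J E r \<equiv> \<Sum>j\<in>J. flip E r j"

text \<open>
  Polynomial expressions in square roots \<open>r j\<close>, with coefficients in a ring \<open>B\<close> of functions of \<open>x\<close>.
  The roots are free variables here, so that signs can be changed; that \<open>r j\<close> squares to a given
  function enters only when an expression is evaluated.
\<close>

inductive rad_expr :: "('x \<Rightarrow> 'a::comm_ring_1) set \<Rightarrow> 'j set \<Rightarrow> ('x \<Rightarrow> ('j \<Rightarrow> 'a) \<Rightarrow> 'a) \<Rightarrow> bool"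
  for B J where
  base: "\<beta> \<in> B \<Longrightarrow> rad_expr B J (\<lambda>x r. \<beta> x)"
| root: "j \<in> J \<Longrightarrow> rad_expr B J (\<lambda>x r. r j)"
| add: "rad_expr B J f \<Longrightarrow> rad_expr B J g \<Longrightarrow> rad_expr B J (\<lambda>x r. f x r + g x r)"
| mult: "rad_expr B J f \<Longrightarrow> rad_expr B J g \<Longrightarrow> rad_expr B J (\<lambda>x r. f x r * g x r)"

lemma rad_expr_cong:
  "rad_expr B J f \<Longrightarrow> (\<And>j. j \<in> J \<Longrightarrow> r j = r' j) \<Longrightarrow> f x r = f x r'"
  by (induction rule: rad_expr.induct) auto

locale function_ring =
  fixes B :: "('x \<Rightarrow> 'a::comm_ring_1) set"
  assumes const_mem: "(\<lambda>x. c) \<in> B"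
    and add_mem: "f \<in> B \<Longrightarrow> g \<in> B \<Longrightarrow> (\<lambda>x. f x + g x) \<in> B"
    and mult_mem: "f \<in> B \<Longrightarrow> g \<in> B \<Longrightarrow> (\<lambda>x. f x * g x) \<in> B"
begin

text \<open>
  Modulo \<open>r j ^ 2 = a\<close>, every expression is linear in \<open>r j\<close>.
\<close>

lemma rad_expr_split:
  assumes "rad_expr B (insert j J) f" "a \<in> B"
  shows "\<exists>A C. rad_expr B J A \<and> rad_expr B J C \<and>
    (\<forall>x r. r j ^ 2 = a x \<longrightarrow> f x r = A x r + r j * C x r)"
  using assms(1)
proof induction
  case (base \<beta>)
  then show ?case
    by (intro exI[of _ "\<lambda>x r. \<beta> x"] exI[of _ "\<lambda>x r. 0"])
       (simp add: rad_expr.base const_mem)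
next
  case (root i)
  show ?case
  proof (cases "i = j")
    case True
    then show ?thesis
      by (intro exI[of _ "\<lambda>x r. 0"] exI[of _ "\<lambda>x r. 1"]) (simp add: rad_expr.base const_mem)
  next
    case False
    then show ?thesis using root
      by (intro exI[of _ "\<lambda>x r. r i"] exI[of _ "\<lambda>x r. 0"])
         (simp add: rad_expr.base rad_expr.root const_mem)
  qed
next
  case (add f g)
  then obtain A C A' C' where *: "rad_expr B J A" "rad_expr B J C" "rad_expr B J A'" "rad_expr B J C'"
    "\<forall>x r. r j ^ 2 = a x \<longrightarrow> f x r = A x r + r j * C x r"
    "\<forall>x r. r j ^ 2 = a x \<longrightarrow> g x r = A' x r + r j * C' x r" by blast
  show ?case
    by (intro exI[of _ "\<lambda>x r. A x r + A' x r"] exI[of _ "\<lambda>x r. C x r + C' x r"])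
       (simp add: * rad_expr.add algebra_simps)
next
  case (mult f g)
  then obtain A C A' C' where *: "rad_expr B J A" "rad_expr B J C" "rad_expr B J A'" "rad_expr B J C'"
    "\<forall>x r. r j ^ 2 = a x \<longrightarrow> f x r = A x r + r j * C x r"
    "\<forall>x r. r j ^ 2 = a x \<longrightarrow> g x r = A' x r + r j * C' x r" by blast
  have eq: "(p + t * q) * (p' + t * q') = (p * p' + c * (q * q')) + t * (p * q' + q * p')"
    if "t ^ 2 = c" for p q p' q' t c :: 'a
    unfolding that[symmetric] by (simp add: power2_eq_square algebra_simps)
  show ?case
  proof (intro exI conjI allI impI)
    show "rad_expr B J (\<lambda>x r. A x r * A' x r + a x * (C x r * C' x r))"
      by (intro rad_expr.intros * assms(2))
    show "rad_expr B J (\<lambda>x r. A x r * C' x r + C x r * A' x r)"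
      by (intro rad_expr.intros *)
    fix x and r :: "'b \<Rightarrow> 'a" assume r: "r j ^ 2 = a x"
    show "f x r * g x r = (A x r * A' x r + a x * (C x r * C' x r)) +
        r j * (A x r * C' x r + C x r * A' x r)"
      using r *(5,6) eq[OF r] by simp
  qed
qed

text \<open>
  The conjugates $A + r_j C$ and $A - r_j C$ have the product $A^2 - a_j C^2$, in which $r_j$ no
  longer occurs. Thus the roots disappear one at a time.
\<close>

lemma sign_product_rational:
  assumes "finite J" "rad_expr B J f" "\<And>j. j \<in> J \<Longrightarrow> a j \<in> B"
  shows "\<exists>N\<in>B. \<forall>x r. (\<forall>j\<in>J. r j ^ 2 = a j x) \<longrightarrow> N x = (\<Prod>E\<in>Pow J. f x (flip E r))"
  using assms
proof (induction J arbitrary: f rule: finite_induct)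
  case empty
  have "f \<in> {f. \<exists>\<beta>\<in>B. \<forall>x r. f x r = \<beta> x}" using empty(1)
    by induction (auto intro: add_mem mult_mem intro!: bexI)
  then obtain \<beta> where "\<beta> \<in> B" "\<forall>x r. f x r = \<beta> x" by blast
  then show ?case by (intro bexI[of _ \<beta>]) simp_all
next
  case (insert j J)
  from rad_expr_split[OF insert.prems(1), of "a j"] insert.prems(2)
  obtain A C where AC: "rad_expr B J A" "rad_expr B J C"
    and f: "\<And>x r. r j ^ 2 = a j x \<Longrightarrow> f x r = A x r + r j * C x r" by blast
  have "rad_expr B J (\<lambda>x r. A x r * A x r + (- 1) * a j x * (C x r * C x r))"
    by (rule rad_expr.add[OF rad_expr.mult[OF AC(1) AC(1)] rad_expr.mult[OF rad_expr.base
          rad_expr.mult[OF AC(2) AC(2)]]], rule mult_mem[OF const_mem insert.prems(2)]) simp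
  from insert.IH[OF this insert.prems(2)] obtain N where N: "N \<in> B"
    "\<And>x r. (\<forall>j\<in>J. r j ^ 2 = a j x) \<Longrightarrow>
      N x = (\<Prod>E\<in>Pow J. A x (flip E r) * A x (flip E r) + (- 1) * a j x * (C x (flip E r) * C x (flip E r)))"
    by auto
  have "N x = (\<Prod>E\<in>Pow (insert j J). f x (flip E r))" if r: "\<forall>i\<in>insert j J. r i ^ 2 = a i x" for x r
  proof -
    have pair: "f x (flip E r) * f x (flip (insert j E) r) =
      A x (flip E r) * A x (flip E r) + (- 1) * a j x * (C x (flip E r) * C x (flip E r))"
      if E: "E \<in> Pow J" for E
    proof -
      have rad_expr_cong': "A x (flip (insert j E) r) = A x (flip E r)" "C x (flip (insert j E) r) = C x (flip E r)"
        by (rule rad_expr_cong[OF AC(1)] rad_expr_cong[OF AC(2)];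
            use insert.hyps in \<open>auto simp: flip_def\<close>)+
      have j: "flip E r j = - r j" "flip (insert j E) r j = r j"
        using E insert.hyps by (auto simp: flip_def)
      have "f x (flip E r) = A x (flip E r) - r j * C x (flip E r)"
        using f[of "flip E r" x] r j by simp
      moreover have "f x (flip (insert j E) r) = A x (flip E r) + r j * C x (flip E r)"
        using f[of "flip (insert j E) r" x] r j rad_expr_cong' by simp
      moreover have "a j x = r j * r j" using r by (simp add: power2_eq_square)
      ultimately show ?thesis by (simp only:) (simp add: algebra_simps)
    qed
    have "(\<Prod>E\<in>Pow (insert j J). f x (flip E r)) =
      (\<Prod>E\<in>Pow J. f x (flip E r)) * (\<Prod>E\<in>insert j ` Pow J. f x (flip E r))"
      unfolding Pow_insert using insert.hyps by (subst prod.union_disjoint) auto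
    also have "(\<Prod>E\<in>insert j ` Pow J. f x (flip E r)) = (\<Prod>E\<in>Pow J. f x (flip (insert j E) r))"
      using insert.hyps by (subst prod.reindex) (auto simp: inj_on_def)
    also have "(\<Prod>E\<in>Pow J. f x (flip E r)) * \<dots> = N x"
      using r by (subst N(2)) (auto simp: prod.distrib[symmetric] pair)
    finally show ?thesis by simp
  qed
  then show ?case using N(1) by blast
qed

end

text \<open>
  For each \<open>j\<close>, \<open>1 - 4 * z * s j\<close> is the discriminant of the quadratic equation
  $z w^2 - w + s_j = 0$.
\<close>

definition sign_norm :: "complex \<Rightarrow> 'j set \<Rightarrow> (('j \<Rightarrow> complex) \<Rightarrow> complex poly) \<Rightarrow> bool" where
  "sign_norm b J N \<longleftrightarrow> poly_family N \<and> (\<forall>s z r. (\<forall>j\<in>J. r j ^ 2 = 1 - 4 * z * s j) \<longrightarrow>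
     poly (N s) z = (\<Prod>E\<in>Pow J. b + signed_sum J E r))"

lemma sign_norm_exists:
  fixes J :: "'j set"
  assumes "finite J"
  shows "\<exists>N. sign_norm b J N"
proof -
  define B where "B = {f. \<exists>p :: ('j \<Rightarrow> complex) \<Rightarrow> complex poly.
    poly_family p \<and> f = (\<lambda>(s, z). poly (p s) z)}"
  interpret function_ring B
  proof
    fix c :: complex
    show "(\<lambda>x. c) \<in> B"
      using poly_family_const[of "[:c:]"] by (auto simp: B_def intro!: exI[of _ "\<lambda>_. [:c:]"])
  next
    fix f g assume "f \<in> B" "g \<in> B"
    then obtain p q where pq: "poly_family p" "poly_family q"
      and f: "f = (\<lambda>(s, z). poly (p s) z)" and g: "g = (\<lambda>(s, z). poly (q s) z)"
      by (auto simp: B_def)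
    show "(\<lambda>x. f x + g x) \<in> B"
      using poly_family_add[OF pq] f g by (auto simp: B_def intro!: exI[of _ "\<lambda>s. p s + q s"])
    show "(\<lambda>x. f x * g x) \<in> B"
      using poly_family_mult[OF pq] f g by (auto simp: B_def intro!: exI[of _ "\<lambda>s. p s * q s"])
  qed
  have sum: "rad_expr B J (\<lambda>x r. b + (\<Sum>j\<in>K. r j))" if "K \<subseteq> J" for K
    using finite_subset[OF that assms] that
  proof (induction K rule: finite_induct)
    case empty
    show ?case by (simp add: rad_expr.base const_mem)
  next
    case (insert k K)
    then have IH: "rad_expr B J (\<lambda>x r. b + (\<Sum>j\<in>K. r j))" and "k \<in> J" by auto
    have "rad_expr B J (\<lambda>x r. (b + (\<Sum>j\<in>K. r j)) + r k)"
      by (rule rad_expr.add[OF IH rad_expr.root[OF \<open>k \<in> J\<close>]])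
    then show ?case using insert.hyps by (simp add: algebra_simps)
  qed
  define a where "a j = (\<lambda>(s::'j \<Rightarrow> complex, z). 1 - 4 * z * s j)" for j
  have a: "a j \<in> B" for j
  proof -
    have "poly_family (\<lambda>s. [:1, - 4 * s j:])"
      by (intro poly_family_pCons poly_family_const[of 0] mpolyfun.intros)
    then show ?thesis unfolding B_def a_def
      by (auto intro!: exI[of _ "\<lambda>s. [:1, - 4 * s j:]"])
  qed
  obtain M where M: "M \<in> B"
    "\<And>x r. (\<forall>j\<in>J. r j ^ 2 = a j x) \<Longrightarrow> M x = (\<Prod>E\<in>Pow J. b + signed_sum J E r)"
    using sign_product_rational[OF assms sum[OF order_refl], of a] a by blast
  then obtain N where N: "poly_family N" "M = (\<lambda>(s, z). poly (N s) z)" by (auto simp: B_def)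
  have "sign_norm b J N" unfolding sign_norm_def
  proof (intro conjI allI impI)
    fix s :: "'j \<Rightarrow> complex" and z r assume "\<forall>j\<in>J. r j ^ 2 = 1 - 4 * z * s j"
    then show "poly (N s) z = (\<Prod>E\<in>Pow J. b + signed_sum J E r)"
      using M(2)[of r "(s, z)"] by (simp add: a_def N(2))
  qed (rule N(1))
  then show ?thesis by blast
qed

lemma sign_normD:
  "sign_norm b J N \<Longrightarrow> (\<And>j. j \<in> J \<Longrightarrow> r j ^ 2 = 1 - 4 * z * s j) \<Longrightarrow>
    poly (N s) z = (\<Prod>E\<in>Pow J. b + signed_sum J E r)"
  by (auto simp: sign_norm_def)

lemma norm_flip: "norm (flip E r j) = norm (r j)" for r :: "'j \<Rightarrow> 'a::real_normed_vector"
  by (simp add: flip_def)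

text \<open>
  A polynomial that is $O(|z - z_0|^n)$ near $z_0$ vanishes there to order \<open>n\<close>. The bound is only
  required off $z_0$, so that it survives the division by a linear factor.
\<close>

lemma dvd_of_bound:
  fixes p :: "complex poly"
  assumes "\<delta> > 0" "\<And>z. z \<noteq> z0 \<Longrightarrow> norm (z - z0) < \<delta> \<Longrightarrow> norm (poly p z) \<le> C * norm (z - z0) ^ n"
  shows "[:-z0, 1:] ^ n dvd p"
  using assms(2)
proof (induction n arbitrary: p)
  case (Suc n)
  have "(poly p \<longlongrightarrow> 0) (at z0)"
  proof (rule Lim_null_comparison)
    show "\<forall>\<^sub>F z in at z0. norm (poly p z) \<le> C * norm (z - z0) ^ Suc n"
      unfolding eventually_at using assms(1) Suc.prems by (auto simp: dist_norm intro!: exI[of _ \<delta>])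
    have "((\<lambda>z. C * norm (z - z0) ^ Suc n) \<longlongrightarrow> C * norm (z0 - z0) ^ Suc n) (at z0)"
      by (intro tendsto_intros)
    then show "((\<lambda>z. C * norm (z - z0) ^ Suc n) \<longlongrightarrow> 0) (at z0)" by simp
  qed
  moreover have "(poly p \<longlongrightarrow> poly p z0) (at z0)"
    using poly_isCont[of z0 p] by (simp add: isCont_def)
  ultimately have "poly p z0 = 0" using LIM_unique by blast
  then obtain q where q: "p = [:-z0, 1:] * q" by (meson dvdE poly_eq_0_iff_dvd)
  have "norm (poly q z) \<le> C * norm (z - z0) ^ n" if "z \<noteq> z0" "norm (z - z0) < \<delta>" for z
  proof -
    have "norm (z - z0) * norm (poly q z) \<le> norm (z - z0) * (C * norm (z - z0) ^ n)"
      using Suc.prems[OF that] by (simp add: q norm_mult[symmetric] algebra_simps)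
    then show ?thesis using that(1) by (simp add: mult_le_cancel_left)
  qed
  from Suc.IH[OF this] show ?case unfolding q power_Suc by (intro mult_dvd_mono dvd_refl)
qed simp

text \<open>
  Polynomial growth of order \<open>n\<close> at infinity means that the reflected polynomial vanishes at 0 to
  the order by which the degree exceeds \<open>n\<close>; but its value at 0 is the leading coefficient.
\<close>

lemma degree_of_bound:
  fixes p :: "complex poly"
  assumes "\<And>z. norm z \<ge> 1 \<Longrightarrow> norm (poly p z) \<le> C * norm z ^ n"
  shows "degree p \<le> n"
proof (rule ccontr)
  assume n: "\<not> degree p \<le> n"
  define D where "D = degree p"
  have "[:-0, 1:] ^ (D - n) dvd reflect_poly p"
  proof (rule dvd_of_bound[of 1])
    fix z :: complex assume z: "z \<noteq> 0" "norm (z - 0) < 1"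
    then have "norm (inverse z) \<ge> 1" by (simp add: norm_inverse one_le_inverse)
    then have "norm (poly p (inverse z)) \<le> C * norm (inverse z) ^ n" by (rule assms)
    then have "norm z ^ D * norm (poly p (inverse z)) \<le> norm z ^ D * (C * norm (inverse z) ^ n)"
      by (intro mult_left_mono) auto
    also have "norm z ^ D = norm z ^ (D - n) * norm z ^ n"
      using n by (simp add: D_def flip: power_add)
    also have "norm z ^ (D - n) * norm z ^ n * (C * norm (inverse z) ^ n) = C * norm (z - 0) ^ (D - n)"
      using z by (simp add: norm_inverse power_inverse)
    finally show "norm (poly (reflect_poly p) z) \<le> C * norm (z - 0) ^ (D - n)"
      using z n by (simp add: poly_reflect_poly_nz norm_mult norm_power D_def flip: power_add)
  qed simp
  moreover have "D - n \<noteq> 0" using n by (simp add: D_def)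
  ultimately have "poly (reflect_poly p) 0 = 0"
    by (metis dvd_power dvd_trans gr0I minus_zero poly_eq_0_iff_dvd)
  then have "p = 0" by (simp add: poly_0_coeff_0)
  with n show False by simp
qed

text \<open>
  The square root that is closer to \<open>\<rho>\<close> than to \<open>- \<rho>\<close> works: its sum with \<open>\<rho>\<close> is at least as large as
  \<open>\<rho>\<close>, and the product of sum and difference is linear in \<open>z - z0\<close>.
\<close>

lemma sqrt_near:
  fixes \<rho> z0 z s :: complex
  assumes "\<rho> ^ 2 = 1 - 4 * z0 * s" "\<rho> \<noteq> 0"
  shows "\<exists>r. r ^ 2 = 1 - 4 * z * s \<and> norm (r - \<rho>) \<le> 4 * norm s / norm \<rho> * norm (z - z0)"
proof -
  have main: "norm (r - \<rho>) \<le> 4 * norm s / norm \<rho> * norm (z - z0)"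
    if r: "r ^ 2 = 1 - 4 * z * s" "norm (r - \<rho>) \<le> norm (r + \<rho>)" for r
  proof -
    have "(r + \<rho>) - (r - \<rho>) = 2 * \<rho>" by simp
    then have "2 * norm \<rho> = norm ((r + \<rho>) - (r - \<rho>))" by (simp only: norm_mult norm_numeral)
    also have "\<dots> \<le> norm (r + \<rho>) + norm (r - \<rho>)" by (rule norm_triangle_ineq4)
    finally have "norm \<rho> \<le> norm (r + \<rho>)" using r(2) by simp
    then have "norm (r - \<rho>) * norm \<rho> \<le> norm (r - \<rho>) * norm (r + \<rho>)" by (intro mult_left_mono) auto
    also have "\<dots> = norm (r ^ 2 - \<rho> ^ 2)"
      by (simp add: norm_mult[symmetric] power2_eq_square algebra_simps)
    also have "r ^ 2 - \<rho> ^ 2 = - 4 * (s * (z - z0))" unfolding r(1) assms(1) by (simp add: algebra_simps)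
    also have "norm (- 4 * (s * (z - z0))) = 4 * norm s * norm (z - z0)" by (simp add: norm_mult)
    finally show ?thesis using assms(2) by (simp add: field_simps)
  qed
  define c where "c = csqrt (1 - 4 * z * s)"
  have c: "c ^ 2 = 1 - 4 * z * s" by (simp add: c_def)
  show ?thesis
  proof (cases "norm (c - \<rho>) \<le> norm (c + \<rho>)")
    case True
    with main[OF c] c show ?thesis by blast
  next
    case False
    have "norm (- c - \<rho>) = norm (c + \<rho>)" "norm (- c + \<rho>) = norm (c - \<rho>)"
      by (metis minus_add_distrib norm_minus_cancel uminus_add_conv_diff diff_conv_add_uminus add.commute,
          metis norm_minus_commute uminus_add_conv_diff)
    with False main[of "- c"] c show ?thesis by (intro exI[of _ "- c"]) auto
  qed
qed

text \<open>
  Away from branch points the square roots move at most linearly with \<open>z\<close>, so each factor that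
  vanishes at \<open>z0\<close> contributes a factor of order $|z - z_0|$ to the product.
\<close>

lemma sign_norm_dvd:
  assumes N: "sign_norm b J N" and J: "finite J"
    and \<rho>: "\<And>j. j \<in> J \<Longrightarrow> \<rho> j ^ 2 = 1 - 4 * z0 * s j" "\<And>j. j \<in> J \<Longrightarrow> \<rho> j \<noteq> 0"
    and \<E>: "\<E> \<subseteq> Pow J" "\<And>E. E \<in> \<E> \<Longrightarrow> b + signed_sum J E \<rho> = 0"
  shows "[:-z0, 1:] ^ card \<E> dvd N s"
proof -
  define C where "C = (\<Sum>j\<in>J. 4 * norm (s j) / norm (\<rho> j))"
  define F where "F E = norm (b + signed_sum J E \<rho>)" for E
  have C0: "C \<ge> 0" unfolding C_def by (intro sum_nonneg) auto
  show ?thesis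
  proof (rule dvd_of_bound[of 1])
    fix z assume z: "norm (z - z0) < 1"
    have "\<forall>j. \<exists>r. j \<in> J \<longrightarrow> r ^ 2 = 1 - 4 * z * s j \<and>
        norm (r - \<rho> j) \<le> 4 * norm (s j) / norm (\<rho> j) * norm (z - z0)"
      using sqrt_near[OF \<rho>] by blast
    then obtain r where r: "\<And>j. j \<in> J \<Longrightarrow> r j ^ 2 = 1 - 4 * z * s j"
      "\<And>j. j \<in> J \<Longrightarrow> norm (r j - \<rho> j) \<le> 4 * norm (s j) / norm (\<rho> j) * norm (z - z0)" by metis
    have close: "norm (b + signed_sum J E r) \<le> F E + C * norm (z - z0)" for E
    proof -
      have "b + signed_sum J E r = (b + signed_sum J E \<rho>) + (\<Sum>j\<in>J. flip E r j - flip E \<rho> j)"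
        by (simp add: sum_subtractf)
      then have "norm (b + signed_sum J E r) \<le> F E + norm (\<Sum>j\<in>J. flip E r j - flip E \<rho> j)"
        unfolding F_def by (metis norm_triangle_ineq)
      also have "norm (\<Sum>j\<in>J. flip E r j - flip E \<rho> j) \<le>
          (\<Sum>j\<in>J. 4 * norm (s j) / norm (\<rho> j) * norm (z - z0))"
      proof (rule sum_norm_le)
        fix j assume "j \<in> J"
        have "norm (flip E r j - flip E \<rho> j) = norm (r j - \<rho> j)"
          by (auto simp: flip_def norm_minus_commute)
        then show "norm (flip E r j - flip E \<rho> j) \<le> 4 * norm (s j) / norm (\<rho> j) * norm (z - z0)"
          using r(2) \<open>j \<in> J\<close> by simp
      qed
      finally show ?thesis by (simp add: C_def sum_distrib_right)
    qed
    have "norm (poly (N s) z) = (\<Prod>E\<in>Pow J. norm (b + signed_sum J E r))"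
      using sign_normD[OF N, of r z s] r(1) by (simp add: prod_norm)
    also have "\<dots> = (\<Prod>E\<in>\<E>. norm (b + signed_sum J E r)) * (\<Prod>E\<in>Pow J - \<E>. norm (b + signed_sum J E r))"
      using \<E>(1) J by (subst prod.subset_diff[of \<E>]) (auto simp: mult.commute)
    also have "\<dots> \<le> (\<Prod>E\<in>\<E>. C * norm (z - z0)) * (\<Prod>E\<in>Pow J - \<E>. F E + C)"
    proof (intro mult_mono prod_mono conjI norm_ge_zero)
      fix E assume "E \<in> \<E>"
      then show "norm (b + signed_sum J E r) \<le> C * norm (z - z0)"
        using close[of E] \<E>(2)[of E] by (simp add: F_def)
    next
      fix E
      have "C * norm (z - z0) \<le> C" using C0 z by (simp add: mult_left_le)
      then show "norm (b + signed_sum J E r) \<le> F E + C" using close[of E] by linarith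
    qed (use C0 in \<open>auto intro!: prod_nonneg\<close>)
    finally show "norm (poly (N s) z) \<le> (C ^ card \<E> * (\<Prod>E\<in>Pow J - \<E>. F E + C)) * norm (z - z0) ^ card \<E>"
      by (simp add: power_mult_distrib mult_ac)
  qed simp
qed

text \<open>
  Each of the $2^{|J|}$ factors grows at most like the square root of $|z|$.
\<close>

lemma sign_norm_degree:
  assumes N: "sign_norm b J N" and J: "finite J" "J \<noteq> {}"
  shows "degree (N s) \<le> 2 ^ (card J - 1)"
proof (rule degree_of_bound)
  define C where "C = norm b + (\<Sum>j\<in>J. sqrt (1 + 4 * norm (s j)))"
  fix z :: complex assume z: "norm z \<ge> 1"
  define r where "r j = csqrt (1 - 4 * z * s j)" for j
  have r: "r j ^ 2 = 1 - 4 * z * s j" for j by (simp add: r_def)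
  have bound: "norm (b + signed_sum J E r) \<le> C * sqrt (norm z)" for E
  proof -
    have "norm (r j) \<le> sqrt (1 + 4 * norm (s j)) * sqrt (norm z)" for j
    proof -
      have "norm (r j) ^ 2 = norm (1 - 4 * z * s j)" by (simp add: r flip: norm_power)
      also have "\<dots> \<le> 1 + 4 * norm z * norm (s j)"
        using norm_triangle_ineq4[of 1 "4 * z * s j"] by (simp add: norm_mult)
      also have "\<dots> \<le> (1 + 4 * norm (s j)) * norm z" using z by (simp add: algebra_simps)
      finally show ?thesis by (simp add: real_le_rsqrt flip: real_sqrt_mult)
    qed
    then have "norm (signed_sum J E r) \<le> (\<Sum>j\<in>J. sqrt (1 + 4 * norm (s j)) * sqrt (norm z))"
      by (intro sum_norm_le) (simp add: norm_flip)
    moreover have "norm b \<le> norm b * sqrt (norm z)" using z by (simp add: mult_ge1_I mult_le_cancel_left1)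
    ultimately show ?thesis
      using norm_triangle_ineq[of b "signed_sum J E r"]
      by (simp add: C_def distrib_right sum_distrib_right)
  qed
  have "norm (poly (N s) z) = (\<Prod>E\<in>Pow J. norm (b + signed_sum J E r))"
    using sign_normD[OF N, of r z s] r by (simp add: prod_norm)
  also have "\<dots> \<le> (\<Prod>E\<in>Pow J. C * sqrt (norm z))" by (intro prod_mono conjI bound norm_ge_zero)
  also have "\<dots> = (C * sqrt (norm z)) ^ (2 ^ card J)" using J by (simp add: card_Pow)
  also have "(2::nat) ^ card J = 2 * 2 ^ (card J - 1)"
    using J by (metis card_gt_0_iff power_minus_mult mult.commute)
  also have "(C * sqrt (norm z)) ^ (2 * 2 ^ (card J - 1)) = (C ^ 2 * norm z) ^ (2 ^ (card J - 1))"
    by (simp add: power_mult power_mult_distrib)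
  finally show "norm (poly (N s) z) \<le> (C ^ 2) ^ (2 ^ (card J - 1)) * norm z ^ (2 ^ (card J - 1))"
    by (simp add: power_mult_distrib)
qed

section \<open>Counting the critical points at one internal vertex\<close>

lemma abs_sum_flip_le:
  fixes \<alpha> :: "'j \<Rightarrow> real"
  assumes "\<And>j. j \<in> D \<Longrightarrow> \<alpha> j > 0"
  shows "\<bar>signed_sum D E \<alpha>\<bar> \<le> (\<Sum>j\<in>D. \<alpha> j)"
proof (rule order.trans[OF sum_abs], rule sum_mono)
  fix j assume "j \<in> D"
  then show "\<bar>flip E \<alpha> j\<bar> \<le> \<alpha> j" using assms[of j] by (simp add: flip_def)
qed

text \<open>
  Superincreasing weights: each new one exceeds the sum of the previous ones.
\<close>

lemma signed_sums_nonzero_exist: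
  assumes "finite J"
  shows "\<exists>\<alpha> :: 'j \<Rightarrow> real. (\<forall>j\<in>J. \<alpha> j > 0) \<and>
    (\<forall>D E. D \<subseteq> J \<longrightarrow> D \<noteq> {} \<longrightarrow> signed_sum D E \<alpha> \<noteq> 0)"
  using assms
proof (induction J rule: finite_induct)
  case (insert k J)
  then obtain \<alpha> :: "'j \<Rightarrow> real" where \<alpha>: "\<And>j. j \<in> J \<Longrightarrow> \<alpha> j > 0"
    "\<And>D E. D \<subseteq> J \<Longrightarrow> D \<noteq> {} \<Longrightarrow> signed_sum D E \<alpha> \<noteq> 0" by blast
  define \<alpha>' where "\<alpha>' = \<alpha>(k := 1 + (\<Sum>j\<in>J. \<alpha> j))"
  have old: "signed_sum D E \<alpha>' = signed_sum D E \<alpha>" if "D \<subseteq> J" for D E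
    using that insert.hyps by (intro sum.cong) (auto simp: \<alpha>'_def flip_def)
  have "signed_sum D E \<alpha>' \<noteq> 0" if D: "D \<subseteq> insert k J" "D \<noteq> {}" for D E
  proof (cases "k \<in> D")
    case True
    have sub: "D - {k} \<subseteq> J" using D by auto
    have "\<bar>signed_sum (D - {k}) E \<alpha>\<bar> \<le> (\<Sum>j\<in>D - {k}. \<alpha> j)"
      by (rule abs_sum_flip_le) (use sub \<alpha>(1) in auto)
    also have "\<dots> \<le> (\<Sum>j\<in>J. \<alpha> j)"
      using sub \<alpha>(1) insert.hyps by (intro sum_mono2) (auto intro: less_imp_le)
    finally have "\<bar>signed_sum (D - {k}) E \<alpha>'\<bar> < \<bar>flip E \<alpha>' k\<bar>"
      unfolding old[OF sub] using sum_nonneg[of J \<alpha>] \<alpha>(1) by (auto simp: flip_def \<alpha>'_def less_imp_le)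
    moreover have "finite D" using D insert.hyps finite_subset by blast
    ultimately show ?thesis using True by (subst sum.remove[of _ k]) auto
  next
    case False
    with D have "D \<subseteq> J" by auto
    with \<alpha>(2) D(2) old show ?thesis by simp
  qed
  moreover have "\<forall>j\<in>insert k J. \<alpha>' j > 0"
    using \<alpha>(1) sum_nonneg[of J \<alpha>] by (auto simp: \<alpha>'_def less_imp_le)
  ultimately show ?case by blast
qed simp

text \<open>
  The square root of $1 - 4 x s_j$ for $s_j = - \alpha_j^2$. For these parameters and \<open>x > 0\<close> all
  square roots are real, so roots can be found by continuity.
\<close>

definition root_real :: "('j \<Rightarrow> real) \<Rightarrow> real \<Rightarrow> 'j \<Rightarrow> real" where
  "root_real \<alpha> x j = sqrt (1 + 4 * x * (\<alpha> j)\<^sup>2)"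

lemma root_real_asymp:
  assumes "\<And>j. j \<in> D \<Longrightarrow> \<alpha> j > 0"
  shows "((\<lambda>x. (b + signed_sum D E (root_real \<alpha> x)) / sqrt x) \<longlongrightarrow> 2 * (signed_sum D E \<alpha>)) at_top"
proof -
  have inv: "((\<lambda>x::real. 1 / x) \<longlongrightarrow> 0) at_top"
    by (rule tendsto_divide_0[OF tendsto_const filterlim_at_top_imp_at_infinity[OF filterlim_ident]])
  have 1: "((\<lambda>x. root_real \<alpha> x j / sqrt x) \<longlongrightarrow> 2 * \<alpha> j) at_top" if "j \<in> D" for j
  proof -
    have "((\<lambda>x. sqrt (1 / x + 4 * (\<alpha> j)\<^sup>2)) \<longlongrightarrow> sqrt (0 + 4 * (\<alpha> j)\<^sup>2)) at_top"
      by (intro tendsto_intros inv)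
    also have "sqrt (0 + 4 * (\<alpha> j)\<^sup>2) = 2 * \<alpha> j"
      using assms[OF that] by (simp add: real_sqrt_mult)
    finally show ?thesis
    proof (rule Lim_transform_eventually)
      show "\<forall>\<^sub>F x in at_top. sqrt (1 / x + 4 * (\<alpha> j)\<^sup>2) = root_real \<alpha> x j / sqrt x"
        using eventually_gt_at_top[of 0]
        by eventually_elim (simp add: root_real_def field_simps flip: real_sqrt_divide)
    qed
  qed
  have 2: "((\<lambda>x. flip E (root_real \<alpha> x) j / sqrt x) \<longlongrightarrow> 2 * flip E \<alpha> j) at_top" if "j \<in> D" for j
    using 1[OF that] tendsto_minus[OF 1[OF that]] by (auto simp: flip_def)
  have 3: "((\<lambda>x. b / sqrt x) \<longlongrightarrow> 0) at_top"
    by (rule tendsto_divide_0[OF tendsto_const filterlim_at_top_imp_at_infinity[OF sqrt_at_top]])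
  have "((\<lambda>x. b / sqrt x + (\<Sum>j\<in>D. flip E (root_real \<alpha> x) j / sqrt x)) \<longlongrightarrow> 0 + (\<Sum>j\<in>D. 2 * flip E \<alpha> j)) at_top"
    by (intro tendsto_add 3 tendsto_sum 2)
  then show ?thesis by (simp add: add_divide_distrib sum_divide_distrib sum_distrib_left)
qed

lemma root_real_eventually_nonzero:
  assumes "\<And>j. j \<in> D \<Longrightarrow> \<alpha> j > 0" "signed_sum D E \<alpha> \<noteq> 0"
  shows "\<forall>\<^sub>F x in at_top. b + signed_sum D E (root_real \<alpha> x) \<noteq> 0"
  using tendsto_imp_eventually_ne[OF root_real_asymp[where b = b and E = E and D = D and \<alpha> = \<alpha>], of 0] assms
  by (auto elim: eventually_mono)

lemma root_real_eventually_neg: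
  assumes "\<And>j. j \<in> D \<Longrightarrow> \<alpha> j > 0" "signed_sum D E \<alpha> < 0"
  shows "\<forall>\<^sub>F x in at_top. b + signed_sum D E (root_real \<alpha> x) < 0"
proof -
  have "\<forall>\<^sub>F x in at_top. (b + signed_sum D E (root_real \<alpha> x)) / sqrt x < 0"
    using order_tendstoD(2)[OF root_real_asymp[where b = b and E = E and D = D and \<alpha> = \<alpha>], of 0] assms by auto
  then show ?thesis using eventually_gt_at_top[of 0]
    by eventually_elim (auto simp: divide_less_0_iff)
qed

lemma sign_norm_real:
  assumes "sign_norm (complex_of_real b) J N" "x > 0"
  shows "poly (N (\<lambda>j. - (complex_of_real (\<alpha> j))\<^sup>2)) (of_real x) =
    (\<Prod>E\<in>Pow J. complex_of_real (b + signed_sum J E (root_real \<alpha> x)))"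
proof -
  have "(complex_of_real (root_real \<alpha> x j))\<^sup>2 = 1 - 4 * of_real x * - (complex_of_real (\<alpha> j))\<^sup>2" for j
  proof -
    have "(root_real \<alpha> x j)\<^sup>2 = 1 + 4 * x * (\<alpha> j)\<^sup>2" using assms(2) by (simp add: root_real_def)
    then show ?thesis by (simp flip: of_real_power)
  qed
  from sign_normD[OF assms(1), of "\<lambda>j. complex_of_real (root_real \<alpha> x j)", OF this]
  have "poly (N (\<lambda>j. - (complex_of_real (\<alpha> j))\<^sup>2)) (of_real x) =
    (\<Prod>E\<in>Pow J. of_real b + signed_sum J E (\<lambda>j. complex_of_real (root_real \<alpha> x j)))" .
  moreover have "flip E (\<lambda>j. complex_of_real (root_real \<alpha> x j)) j = of_real (flip E (root_real \<alpha> x) j)" for E j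
    by (simp add: flip_def)
  ultimately show ?thesis by simp
qed

lemma sign_norm_real_nonzero:
  assumes "sign_norm (complex_of_real b) J N" "finite J" "\<And>j. j \<in> J \<Longrightarrow> \<alpha> j > 0"
    and "\<And>E. E \<subseteq> J \<Longrightarrow> signed_sum J E \<alpha> \<noteq> 0"
  shows "N (\<lambda>j. - (complex_of_real (\<alpha> j))\<^sup>2) \<noteq> 0"
proof -
  have "\<forall>\<^sub>F x in at_top. \<forall>E\<in>Pow J. b + signed_sum J E (root_real \<alpha> x) \<noteq> 0"
    using assms by (intro eventually_ball_finite ballI root_real_eventually_nonzero) auto
  with eventually_gt_at_top[of 0]
  have "\<forall>\<^sub>F x in at_top. x > 0 \<and> (\<forall>E\<in>Pow J. b + signed_sum J E (root_real \<alpha> x) \<noteq> 0)"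
    by eventually_elim blast
  then obtain x where x: "x > 0" "\<forall>E\<in>Pow J. b + signed_sum J E (root_real \<alpha> x) \<noteq> 0"
    using eventually_happens'[OF trivial_limit_at_top_linorder] by blast
  have "poly (N (\<lambda>j. - (complex_of_real (\<alpha> j))\<^sup>2)) (of_real x) \<noteq> 0"
    unfolding sign_norm_real[OF assms(1) x(1)] using x(2) assms(2)
    by (simp del: of_real_add of_real_sum)
  then show ?thesis by auto
qed

text \<open>
  The zeros are among the roots of a polynomial, the product over all signs, which is nonzero because
  no factor vanishes for large \<open>x\<close>.
\<close>

lemma finite_root_real_zeros:
  assumes "finite D" "\<And>j. j \<in> D \<Longrightarrow> \<alpha> j > 0" "\<And>E. signed_sum D E \<alpha> \<noteq> 0"
  shows "finite {x. x > 0 \<and> (\<exists>E. b + signed_sum D E (root_real \<alpha> x) = 0)}"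
proof -
  obtain N where N: "sign_norm (complex_of_real b) D N" using sign_norm_exists[OF assms(1)] by blast
  let ?p = "N (\<lambda>j. - (complex_of_real (\<alpha> j))\<^sup>2)"
  have "?p \<noteq> 0" by (rule sign_norm_real_nonzero[OF N assms])
  then have "finite {z. poly ?p z = 0}" by (rule poly_roots_finite)
  moreover have "complex_of_real ` {x. x > 0 \<and> (\<exists>E. b + signed_sum D E (root_real \<alpha> x) = 0)} \<subseteq>
      {z. poly ?p z = 0}"
  proof clarify
    fix x E assume x: "x > 0" "b + signed_sum D E (root_real \<alpha> x) = 0"
    have "signed_sum D (E \<inter> D) (root_real \<alpha> x) = signed_sum D E (root_real \<alpha> x)"
      by (intro sum.cong) (auto simp: flip_def)
    with x(2) have z: "complex_of_real (b + signed_sum D (E \<inter> D) (root_real \<alpha> x)) = 0"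
      by (simp only: of_real_0)
    show "poly ?p (complex_of_real x) = 0"
      unfolding sign_norm_real[OF N x(1)] by (rule prod_zero) (use z assms(1) in auto)
  qed
  ultimately have "finite (complex_of_real ` {x. x > 0 \<and> (\<exists>E. b + signed_sum D E (root_real \<alpha> x) = 0)})"
    by (rule finite_subset[rotated])
  then show ?thesis by (rule finite_imageD) (simp add: inj_on_def)
qed

text \<open>
  The dominating weight \<open>\<alpha> o'\<close> is chosen last. If two different choices of signs vanish at the same
  \<open>x\<close>, their difference is a signed sum over a subset of \<open>J\<close>, which has finitely many zeros \<open>x\<close> that
  do not depend on \<open>\<alpha> o'\<close>. For each of these \<open>x\<close> and each choice of signs, the full sum vanishes
  for at most one positive \<open>\<alpha> o'\<close>, so all but finitely many values are good.
\<close>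

lemma separating_point_exists:
  assumes "finite J" "o' \<notin> J"
  shows "\<exists>\<alpha>. (\<forall>j\<in>insert o' J. \<alpha> j > 0) \<and> (\<Sum>j\<in>J. \<alpha> j) < \<alpha> o' \<and>
    (\<forall>x>0. \<forall>E E'. E \<subseteq> J \<longrightarrow> E' \<subseteq> J \<longrightarrow>
       c + signed_sum (insert o' J) E (root_real \<alpha> x) = 0 \<longrightarrow>
       c + signed_sum (insert o' J) E' (root_real \<alpha> x) = 0 \<longrightarrow> E = E')"
proof -
  obtain \<beta> :: "'a \<Rightarrow> real" where \<beta>: "\<And>j. j \<in> J \<Longrightarrow> \<beta> j > 0"
    "\<And>D E. D \<subseteq> J \<Longrightarrow> D \<noteq> {} \<Longrightarrow> signed_sum D E \<beta> \<noteq> 0"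
    using signed_sums_nonzero_exist[OF assms(1)] by blast
  define \<Lambda> where "\<Lambda> = (\<Union>D\<in>Pow J - {{}}. {x. x > 0 \<and> (\<exists>E. 0 + signed_sum D E (root_real \<beta> x) = 0)})"
  have "finite \<Lambda>" unfolding \<Lambda>_def
    using assms(1) \<beta> by (intro finite_UN_I finite_root_real_zeros) (auto intro: finite_subset)
  define bad where "bad = (\<lambda>(x, E). sqrt (((c + signed_sum J E (root_real \<beta> x))\<^sup>2 - 1) / (4 * x))) ` (\<Lambda> \<times> Pow J)"
  have "finite bad" unfolding bad_def using \<open>finite \<Lambda>\<close> assms(1) by simp
  then have "infinite ({(\<Sum>j\<in>J. \<beta> j) <..} - bad)" using infinite_Ioi by (intro Diff_infinite_finite)
  then obtain y where y: "y > (\<Sum>j\<in>J. \<beta> j)" "y \<notin> bad"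
    using infinite_imp_nonempty by blast
  define \<alpha> where "\<alpha> = \<beta>(o' := y)"
  have y0: "y > 0" using y(1) sum_nonneg[of J \<beta>] \<beta>(1) by (smt (verit) less_imp_le)
  have same: "root_real \<alpha> x j = root_real \<beta> x j" "\<alpha> j = \<beta> j" if "j \<in> J" for x j
    using that assms(2) by (auto simp: \<alpha>_def root_real_def)
  have "E = E'" if x: "x > 0" and E: "E \<subseteq> J" "E' \<subseteq> J"
    and z: "c + signed_sum (insert o' J) E (root_real \<alpha> x) = 0"
      "c + signed_sum (insert o' J) E' (root_real \<alpha> x) = 0" for x E E'
  proof (rule ccontr)
    assume "E \<noteq> E'"
    have split: "signed_sum (insert o' J) E (root_real \<alpha> x) =
        - root_real \<alpha> x o' + signed_sum J E (root_real \<beta> x)" if "E \<subseteq> J" for E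
      using assms that same by (auto simp: flip_def intro!: sum.cong)
    define D where "D = (E - E') \<union> (E' - E)"
    have D: "D \<subseteq> J" "D \<noteq> {}" using E \<open>E \<noteq> E'\<close> by (auto simp: D_def)
    have "0 = (\<Sum>j\<in>J. flip E (root_real \<beta> x) j - flip E' (root_real \<beta> x) j)"
      using z unfolding split[OF E(1)] split[OF E(2)] by (simp add: sum_subtractf)
    also have "\<dots> = (\<Sum>j\<in>J. if j \<in> D then 2 * flip E (root_real \<beta> x) j else 0)"
      by (intro sum.cong) (auto simp: flip_def D_def)
    also have "\<dots> = (\<Sum>j\<in>D. 2 * flip E (root_real \<beta> x) j)"
      using D(1) assms(1) by (simp add: sum.inter_restrict[symmetric] Int_absorb1)
    finally have "0 + signed_sum D E (root_real \<beta> x) = 0" by (simp flip: sum_distrib_left)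
    then have "x \<in> \<Lambda>" using D x unfolding \<Lambda>_def by blast
    have "root_real \<alpha> x o' = c + signed_sum J E (root_real \<beta> x)" (is "_ = ?v")
      using z(1) unfolding split[OF E(1)] by simp
    moreover have "(root_real \<alpha> x o')\<^sup>2 = 1 + 4 * x * y\<^sup>2" using x by (simp add: root_real_def \<alpha>_def)
    ultimately have "y\<^sup>2 = (?v\<^sup>2 - 1) / (4 * x)" using x by (simp add: field_simps)
    then have "y = sqrt ((?v\<^sup>2 - 1) / (4 * x))" using y0 by (metis real_sqrt_unique less_imp_le)
    with \<open>x \<in> \<Lambda>\<close> E(1) have "y \<in> bad" unfolding bad_def by (auto intro!: image_eqI[of _ _ "(x, E)"])
    with y(2) show False by simp
  qed
  moreover have "\<forall>j\<in>insert o' J. \<alpha> j > 0" using \<beta>(1) y0 same(2) by (auto simp: \<alpha>_def)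
  moreover have "(\<Sum>j\<in>J. \<alpha> j) < \<alpha> o'" using y(1) same(2) by (simp add: \<alpha>_def)
  ultimately show ?thesis by blast
qed

lemma card_subsets_ge_2:
  assumes "finite J"
  shows "card {E. E \<subseteq> J \<and> card E \<ge> 2} = 2 ^ card J - (card J + 1)"
proof -
  have "{E. E \<subseteq> J \<and> card E \<ge> 2} = Pow J - insert {} ((\<lambda>j. {j}) ` J)"
  proof (intro set_eqI iffI)
    fix E assume "E \<in> Pow J - insert {} ((\<lambda>j. {j}) ` J)"
    then have E: "E \<subseteq> J" "E \<noteq> {}" "\<nexists>j. E = {j}" by auto
    from finite_subset[OF E(1) assms] E(2,3) have "card E \<noteq> 0" "card E \<noteq> 1"
      by (auto simp: card_1_singleton_iff)
    with E(1) show "E \<in> {E. E \<subseteq> J \<and> card E \<ge> 2}" by auto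
  qed auto
  moreover have "card (insert {} ((\<lambda>j. {j}) ` J)) = card J + 1"
    using assms by (subst card_insert_disjoint) (auto simp: card_image)
  moreover have "insert {} ((\<lambda>j. {j}) ` J) \<subseteq> Pow J" by auto
  ultimately show ?thesis using assms by (simp add: card_Diff_subset card_Pow del: insert_subset)
qed

text \<open>
  Let the weight of \<open>o'\<close> dominate all others together. For a set \<open>E\<close> of positive signs that does not
  contain \<open>o'\<close>, the signed sum tends to minus infinity, and its value at 0 is $2 |E| - 2$. So every such
  \<open>E\<close> with at least two elements yields a positive root, and \<open>separating_point_exists\<close> makes these
  roots distinct. Their number is the upper bound that the degree imposes.
\<close>

lemma many_roots_point:
  assumes "finite J" "card J \<ge> 3" "sign_norm (of_nat (card J) - 2) J N"
  shows "\<exists>s Z. N s \<noteq> 0 \<and> finite Z \<and> card Z = 2 ^ (card J - 1) - card J \<and>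
    (\<forall>z\<in>Z. z \<noteq> 0 \<and> poly (N s) z = 0 \<and> (\<forall>j\<in>J. 1 - 4 * z * s j \<noteq> 0))"
proof -
  have "J \<noteq> {}" using assms(2) by auto
  then obtain o' where o: "o' \<in> J" by blast
  define K where "K = J - {o'}"
  have J: "J = insert o' K" "o' \<notin> K" "finite K" using o assms(1) by (auto simp: K_def)
  then have cK: "card J = card K + 1" by simp
  define c where "c = real (card J) - 2"
  obtain \<alpha> where "(\<forall>j\<in>J. \<alpha> j > 0) \<and> (\<Sum>j\<in>K. \<alpha> j) < \<alpha> o' \<and>
    (\<forall>x>0. \<forall>E E'. E \<subseteq> K \<longrightarrow> E' \<subseteq> K \<longrightarrow> c + signed_sum J E (root_real \<alpha> x) = 0 \<longrightarrow>
       c + signed_sum J E' (root_real \<alpha> x) = 0 \<longrightarrow> E = E')"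
    using separating_point_exists[OF J(3,2), of c] unfolding J(1)[symmetric] by (elim exE)
  then have \<alpha>: "\<And>j. j \<in> J \<Longrightarrow> \<alpha> j > 0" "(\<Sum>j\<in>K. \<alpha> j) < \<alpha> o'"
    "\<And>x E E'. x > 0 \<Longrightarrow> E \<subseteq> K \<Longrightarrow> E' \<subseteq> K \<Longrightarrow> c + signed_sum J E (root_real \<alpha> x) = 0 \<Longrightarrow>
       c + signed_sum J E' (root_real \<alpha> x) = 0 \<Longrightarrow> E = E'"
    by simp_all
  have N: "sign_norm (complex_of_real c) J N" using assms(3) by (simp add: c_def)
  have small: "\<bar>signed_sum K E \<alpha>\<bar> < \<alpha> o'" for E
  proof -
    have "\<bar>signed_sum K E \<alpha>\<bar> \<le> (\<Sum>j\<in>K. \<alpha> j)"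
      by (rule abs_sum_flip_le) (use \<alpha>(1) J in auto)
    with \<alpha>(2) show ?thesis by simp
  qed
  have split: "signed_sum J E \<alpha> = flip E \<alpha> o' + signed_sum K E \<alpha>" for E
    using J by simp
  define \<E> where "\<E> = {E. E \<subseteq> K \<and> card E \<ge> 2}"
  have "\<exists>x>0. c + signed_sum J E (root_real \<alpha> x) = 0" if "E \<in> \<E>" for E
  proof -
    from that have E: "E \<subseteq> K" "card E \<ge> 2" by (auto simp: \<E>_def)
    define f where "f x = c + signed_sum J E (root_real \<alpha> x)" for x
    have "\<forall>\<^sub>F x in at_top. f x < 0" unfolding f_def
    proof (rule root_real_eventually_neg)
      show "signed_sum J E \<alpha> < 0"
        using small[of E] E(1) J(2) unfolding split by (auto simp: flip_def)
    qed (rule \<alpha>(1))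
    with eventually_gt_at_top[of 0] have "\<forall>\<^sub>F x in at_top. x > 0 \<and> f x < 0"
      by eventually_elim blast
    then obtain y where y: "y > 0" "f y < 0"
      using eventually_happens'[OF trivial_limit_at_top_linorder] by blast
    have f0: "f 0 = 2 * real (card E) - 2"
    proof -
      have "E \<subseteq> J" using E(1) J(1) by auto
      then have "signed_sum J E (root_real \<alpha> 0) = (\<Sum>j\<in>E. 1) + (\<Sum>j\<in>J - E. - 1)"
        using assms(1) by (subst sum.subset_diff[of E]) (auto simp: flip_def root_real_def)
      also have "\<dots> = real (card E) - real (card J - card E)"
        using \<open>E \<subseteq> J\<close> assms(1) by (simp add: card_Diff_subset finite_subset)
      also have "\<dots> = 2 * real (card E) - real (card J)"
        using card_mono[OF assms(1) \<open>E \<subseteq> J\<close>] by simp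
      finally show ?thesis by (simp add: f_def c_def)
    qed
    have rc: "continuous_on {0..y} (\<lambda>x. root_real \<alpha> x j)" for j
      unfolding root_real_def by (intro continuous_intros)
    have fc: "continuous_on {0..y} (\<lambda>x. flip E (root_real \<alpha> x) j)" for j
      unfolding flip_def using rc[of j] continuous_on_minus[OF rc[of j]] by (cases "j \<in> E") simp_all
    have cont: "continuous_on {0..y} f"
      unfolding f_def[abs_def] by (intro continuous_on_add continuous_on_const continuous_on_sum fc)
    from IVT2'[of f y 0 0, OF _ _ _ cont] y f0 E(2) obtain x where x: "0 \<le> x" "f x = 0" by auto
    moreover from f0 E(2) x have "x \<noteq> 0" by auto
    ultimately show ?thesis unfolding f_def by (intro exI[of _ x]) auto
  qed
  then obtain X where X: "\<And>E. E \<in> \<E> \<Longrightarrow> X E > 0"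
    "\<And>E. E \<in> \<E> \<Longrightarrow> c + signed_sum J E (root_real \<alpha> (X E)) = 0" by metis
  have inj: "inj_on X \<E>"
  proof (rule inj_onI)
    fix E E' assume E: "E \<in> \<E>" "E' \<in> \<E>" "X E = X E'"
    show "E = E'"
      by (rule \<alpha>(3)[OF X(1)[OF E(1)] _ _ X(2)[OF E(1)]])
        (use E X(2)[OF E(2)] in \<open>simp_all add: \<E>_def\<close>)
  qed
  define s where "s = (\<lambda>j. - (complex_of_real (\<alpha> j))\<^sup>2)"
  define Z where "Z = complex_of_real ` X ` \<E>"
  have "card Z = card \<E>" unfolding Z_def
    using inj by (simp add: card_image inj_on_subset[OF inj_of_real])
  then have "card Z = 2 ^ (card J - 1) - card J"
    using card_subsets_ge_2[OF J(3)] cK by (simp add: \<E>_def)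
  moreover have "finite Z" using J(3) by (auto simp: Z_def \<E>_def)
  moreover have "N s \<noteq> 0" unfolding s_def
  proof (rule sign_norm_real_nonzero[OF N assms(1) \<alpha>(1)])
    fix E assume "E \<subseteq> J"
    show "signed_sum J E \<alpha> \<noteq> 0"
      unfolding split using small[of E] by (auto simp: flip_def)
  qed auto
  moreover have "z \<noteq> 0 \<and> poly (N s) z = 0 \<and> (\<forall>j\<in>J. 1 - 4 * z * s j \<noteq> 0)" if "z \<in> Z" for z
  proof -
    from that obtain E where E: "E \<in> \<E>" "z = complex_of_real (X E)" by (auto simp: Z_def)
    have "z \<noteq> 0" using X(1)[OF E(1)] E(2) by simp
    moreover have "poly (N s) z = 0"
      unfolding s_def E(2) sign_norm_real[OF N X(1)[OF E(1)]]
      by (rule prod_zero) (use X(2)[OF E(1)] E(1) assms(1) J in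
          \<open>auto simp: \<E>_def simp del: of_real_add of_real_sum intro!: bexI[of _ E]\<close>)
    moreover have "1 - 4 * z * s j \<noteq> 0" for j
    proof -
      have "1 - 4 * z * s j = complex_of_real (1 + 4 * X E * (\<alpha> j)\<^sup>2)" by (simp add: s_def E(2))
      moreover have "1 + 4 * X E * (\<alpha> j)\<^sup>2 > 0" using X(1)[OF E(1)] by (simp add: add_pos_nonneg)
      ultimately show ?thesis by (metis less_irrefl of_real_eq_0_iff)
    qed
    ultimately show ?thesis by blast
  qed
  ultimately show ?thesis by blast
qed

text \<open>
  The system at one internal vertex. For a child \<open>c\<close> with conductance \<open>w\<close> the root is
  $r_c = 2 z w - 1$; for the vertex itself, with \<open>u\<close> the sum of the conductances of its children, it
  is $r_v = 1 - 2 z u$. The opposite sign makes the last equation symmetric in all of \<open>J\<close>.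
\<close>

definition local_solution :: "'j set \<Rightarrow> ('j \<Rightarrow> complex) \<Rightarrow> complex \<Rightarrow> ('j \<Rightarrow> complex) \<Rightarrow> bool" where
  "local_solution J s z r \<longleftrightarrow> (\<forall>j\<in>J. r j ^ 2 = 1 - 4 * z * s j) \<and> of_nat (card J) - 2 + (\<Sum>j\<in>J. r j) = 0"

lemma no_common_root_of_card_roots:
  fixes p :: "complex poly"
  assumes "p \<noteq> 0" "card {z. poly p z = 0} = degree p"
  shows "\<not> (poly p z = 0 \<and> poly (pderiv p) z = 0)"
proof
  assume *: "poly p z = 0 \<and> poly (pderiv p) z = 0"
  then obtain q where q: "p = [:-z, 1:] * q" by (meson dvdE poly_eq_0_iff_dvd)
  with assms(1) have "q \<noteq> 0" by auto
  have "pderiv p = [:-z, 1:] * pderiv q + q * pderiv [:-z, 1:]" unfolding q by (rule pderiv_mult)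
  then have "poly q z = 0" using * by (simp add: pderiv_pCons)
  then have "{y. poly p y = 0} = {y. poly q y = 0}" by (auto simp: q)
  moreover have "card {y. poly q y = 0} \<le> degree q" using \<open>q \<noteq> 0\<close> by (rule card_poly_roots_bound)
  moreover have "degree p = Suc (degree q)" unfolding q using \<open>q \<noteq> 0\<close> by (subst degree_mult_eq) auto
  ultimately show False using assms(2) by simp
qed

lemma card_roots_rsquarefree:
  fixes p :: "complex poly"
  assumes "rsquarefree p"
  shows "card {z. poly p z = 0} = degree p"
proof -
  have "degree p = degree (smult (lead_coeff p) (\<Prod>z|poly p z = 0. [:-z, 1:]))"
    by (subst complex_poly_decompose_rsquarefree[OF assms]) (rule refl)
  also have "\<dots> = card {z. poly p z = 0}"
    using assms by (auto simp: rsquarefree_def degree_prod_sum_eq)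
  finally show ?thesis by simp
qed

text \<open>
  The univariate polynomial \<open>P s\<close> counts the solutions of the system for all \<open>s\<close> off the hypersurface
  \<open>H s = 0\<close>. The degree bound and the first implication hold for all \<open>s\<close>, since they are applied to
  statistics that vary with the matrix.
\<close>

definition generic_count ::
    "'j set \<Rightarrow> (('j \<Rightarrow> complex) \<Rightarrow> complex poly) \<Rightarrow> (('j \<Rightarrow> complex) \<Rightarrow> complex) \<Rightarrow> bool" where
  "generic_count J P H \<longleftrightarrow> poly_family P \<and> (\<forall>s. degree (P s) \<le> 2 ^ (card J - 1) - card J) \<and>
    mpolyfun H \<and> (\<exists>s. H s \<noteq> 0) \<and>
    (\<forall>s z r. z \<noteq> 0 \<longrightarrow> local_solution J s z r \<longrightarrow> poly (P s) z = 0) \<and>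
    (\<forall>s. H s \<noteq> 0 \<longrightarrow>
       finite {z. poly (P s) z = 0} \<and> card {z. poly (P s) z = 0} = 2 ^ (card J - 1) - card J \<and>
       (\<forall>z. poly (P s) z = 0 \<longrightarrow> z \<noteq> 0 \<and> poly (pderiv (P s)) z \<noteq> 0 \<and>
          (\<exists>r. local_solution J s z r) \<and>
          (\<forall>r r'. local_solution J s z r \<longrightarrow> local_solution J s z r' \<longrightarrow> (\<forall>j\<in>J. r j \<noteq> 0 \<and> r' j = r j))))"

text \<open>
  \<open>P s\<close> is the product over all signs divided by the power $z^{|J|}$ that is due to the $|J|$ factors
  with a single positive sign. \<open>H\<close> collects what has to hold generically: the degree is maximal, the
  roots are simple, 0 is not a root, and no discriminant vanishes at a root. At a simple root only
  one factor vanishes, so the solution \<open>r\<close> is unique.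
\<close>

theorem local_solution_count:
  assumes J: "finite J" "card J \<ge> 3"
  shows "\<exists>P H. generic_count J P H"
proof -
  define m where "m = card J"
  define d where "d = 2 ^ (m - 1) - m"
  have Jne: "J \<noteq> {}" using J by auto
  obtain N where N: "sign_norm (of_nat (card J) - 2) J N" using sign_norm_exists[OF J(1)] by blast
  \<comment> \<open>At 0 all square roots are 1, and with one positive sign the sum is $m - 2 + 1 - (m - 1) = 0$.\<close>
  have dvd: "[:-0, 1:] ^ m dvd N s" for s
  proof -
    have "[:-0, 1:] ^ card ((\<lambda>j. {j}) ` J) dvd N s"
    proof (rule sign_norm_dvd[OF N J(1), of "\<lambda>_. 1"])
      fix E assume "E \<in> (\<lambda>j. {j}) ` J"
      then obtain k where k: "k \<in> J" "E = {k}" by blast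
      have "signed_sum J E (\<lambda>_. 1) = 1 + (\<Sum>j\<in>J - {k}. - 1 :: complex)"
        using k J(1) by (subst sum.remove[of _ k]) (auto simp: flip_def)
      also have "\<dots> = 2 - of_nat (card J)"
        using k J by (simp add: of_nat_diff)
      finally show "of_nat (card J) - 2 + signed_sum J E (\<lambda>_. 1) = (0::complex)" by simp
    qed auto
    then show ?thesis by (simp add: card_image m_def)
  qed
  define P where "P s = poly_shift m (N s)" for s
  have NP: "N s = monom 1 m * P s" for s
  proof -
    from dvd[of s] obtain q where q: "N s = monom 1 m * q" by (auto simp: monom_altdef)
    then have "P s = q" by (auto simp: P_def poly_eq_iff coeff_poly_shift coeff_monom_mult)
    with q show ?thesis by simp
  qed
  have polyN: "poly (N s) z = z ^ m * poly (P s) z" for s z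
    by (simp add: NP poly_monom)
  have famP: "poly_family P"
    using N unfolding P_def by (intro poly_family_shift) (simp add: sign_norm_def)
  have degP: "degree (P s) \<le> d" for s
  proof (cases "P s = 0")
    case False
    then have "degree (N s) = m + degree (P s)"
      unfolding NP by (subst degree_mult_eq) (auto simp: degree_monom_eq)
    with sign_norm_degree[OF N J(1) Jne, of s] show ?thesis by (simp add: d_def m_def)
  qed simp
  obtain s0 Z where s0: "N s0 \<noteq> 0" "finite Z" "card Z = d"
    "\<And>z. z \<in> Z \<Longrightarrow> z \<noteq> 0" "\<And>z. z \<in> Z \<Longrightarrow> poly (N s0) z = 0"
    "\<And>z j. z \<in> Z \<Longrightarrow> j \<in> J \<Longrightarrow> 1 - 4 * z * s0 j \<noteq> 0"
    using many_roots_point[OF J N] unfolding d_def m_def by blast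
  have P0: "P s0 \<noteq> 0" using s0(1) NP[of s0] by auto
  have fin0: "finite {z. poly (P s0) z = 0}" using P0 by (rule poly_roots_finite)
  \<comment> \<open>The degree bound leaves no room for further roots or for a smaller degree.\<close>
  have Zsub: "Z \<subseteq> {z. poly (P s0) z = 0}" using s0(4,5) polyN by force
  have "card {z. poly (P s0) z = 0} \<le> degree (P s0)"
    using P0 by (rule card_poly_roots_bound)
  with card_mono[OF fin0 Zsub] degP[of s0] s0(3)
  have deg0: "degree (P s0) = d" and card0: "card {z. poly (P s0) z = 0} = card Z" by auto
  have Z: "{z. poly (P s0) z = 0} = Z" using card_subset_eq[OF fin0 Zsub] card0 by simp
  have "\<exists>h. mpolyfun h \<and> h s0 \<noteq> 0 \<and> (\<forall>s. h s \<noteq> 0 \<longrightarrow> degree (P s) = d \<and> P s \<noteq> 0 \<and>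
      (\<forall>z. \<not> (poly (P s) z = 0 \<and> poly (pderiv (P s)) z = 0)))"
  proof (rule generic_coprime[OF famP poly_family_pderiv[OF famP] degP _ deg0 P0])
    show "degree (pderiv (P s)) \<le> d" for s
      using degP[of s] degree_pderiv[of "P s"] by simp
    show "\<not> (poly (P s0) z = 0 \<and> poly (pderiv (P s0)) z = 0)" for z
      by (rule no_common_root_of_card_roots[OF P0]) (simp add: card0 deg0 s0(3))
  qed
  then obtain h where h: "mpolyfun h" "h s0 \<noteq> 0" "\<And>s. h s \<noteq> 0 \<Longrightarrow> degree (P s) = d"
    "\<And>s. h s \<noteq> 0 \<Longrightarrow> P s \<noteq> 0"
    "\<And>s z. h s \<noteq> 0 \<Longrightarrow> \<not> (poly (P s) z = 0 \<and> poly (pderiv (P s)) z = 0)" by blast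
  have "\<exists>h. mpolyfun h \<and> h s0 \<noteq> 0 \<and> (\<forall>s. h s \<noteq> 0 \<longrightarrow> degree (P s) = d \<and> P s \<noteq> 0 \<and>
      (\<forall>z. \<not> (poly (P s) z = 0 \<and> poly [:0, 1:] z = 0)))"
    by (rule generic_coprime[where q = "\<lambda>_. [:0, 1:]" and e = 1, OF famP poly_family_const degP _ deg0 P0])
      (use s0(4) Z in auto)
  then obtain h0 where h0: "mpolyfun h0" "h0 s0 \<noteq> 0"
    "\<And>s. h0 s \<noteq> 0 \<Longrightarrow> poly (P s) 0 \<noteq> 0" by auto
  have "\<exists>h. mpolyfun h \<and> h s0 \<noteq> 0 \<and> (\<forall>s. h s \<noteq> 0 \<longrightarrow> degree (P s) = d \<and> P s \<noteq> 0 \<and>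
      (\<forall>z. \<not> (poly (P s) z = 0 \<and> poly [:1, - 4 * s j:] z = 0)))" if "j \<in> J" for j
  proof (rule generic_coprime[OF famP _ degP _ deg0 P0, of _ 1])
    show "poly_family (\<lambda>s. [:1, - 4 * s j:])"
      by (intro poly_family_pCons poly_family_const[of 0] mpolyfun.intros)
    show "\<not> (poly (P s0) z = 0 \<and> poly [:1, - 4 * s0 j:] z = 0)" for z
      using s0(6)[OF _ that, of z] Z by (auto simp: algebra_simps)
  qed auto
  then have "\<forall>j. \<exists>h. j \<in> J \<longrightarrow> mpolyfun h \<and> h s0 \<noteq> 0 \<and>
      (\<forall>s z. h s \<noteq> 0 \<longrightarrow> \<not> (poly (P s) z = 0 \<and> poly [:1, - 4 * s j:] z = 0))" by metis
  then obtain h1 where h1: "\<And>j. j \<in> J \<Longrightarrow> mpolyfun (h1 j)" "\<And>j. j \<in> J \<Longrightarrow> h1 j s0 \<noteq> 0"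
    "\<And>j s z. j \<in> J \<Longrightarrow> h1 j s \<noteq> 0 \<Longrightarrow> \<not> (poly (P s) z = 0 \<and> poly [:1, - 4 * s j:] z = 0)" by metis
  define H where "H s = h s * (h0 s * (\<Prod>j\<in>J. h1 j s))" for s
  have PN: "poly (P s) z = 0 \<longleftrightarrow> poly (N s) z = 0" if "z \<noteq> 0" for s z
    using that by (simp add: polyN)
  have roots: "finite {z. poly (P s) z = 0} \<and> card {z. poly (P s) z = 0} = 2 ^ (card J - 1) - card J"
    if "H s \<noteq> 0" for s
  proof -
    have hs: "h s \<noteq> 0" using that by (simp add: H_def)
    then have "rsquarefree (P s)" using h(5) by (simp add: rsquarefree_roots)
    then have "card {z. poly (P s) z = 0} = d" using card_roots_rsquarefree h(3) hs by simp
    then show ?thesis using poly_roots_finite[OF h(4)[OF hs]] by (simp add: d_def m_def)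
  qed
  have main: "z \<noteq> 0 \<and> poly (pderiv (P s)) z \<noteq> 0 \<and> (\<exists>r. local_solution J s z r) \<and>
      (\<forall>r r'. local_solution J s z r \<longrightarrow> local_solution J s z r' \<longrightarrow> (\<forall>j\<in>J. r j \<noteq> 0 \<and> r' j = r j))"
    if Hs: "H s \<noteq> 0" and z: "poly (P s) z = 0" for s z
  proof (intro conjI allI impI ballI)
    have nz: "h s \<noteq> 0" "h0 s \<noteq> 0" "\<And>j. j \<in> J \<Longrightarrow> h1 j s \<noteq> 0"
      using Hs J(1) by (auto simp: H_def)
    show z0: "z \<noteq> 0" using h0(3)[OF nz(2)] z by auto
    show simple: "poly (pderiv (P s)) z \<noteq> 0" using h(5)[OF nz(1)] z by blast
    define r where "r j = csqrt (1 - 4 * z * s j)" for j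
    have "(\<Prod>E\<in>Pow J. of_nat (card J) - 2 + signed_sum J E r) = 0"
      using sign_normD[OF N, of r z s] z by (simp add: r_def polyN)
    then obtain E where "of_nat (card J) - 2 + signed_sum J E r = 0" using J(1) by auto
    then have "local_solution J s z (flip E r)"
      by (auto simp: local_solution_def flip_def r_def)
    then show "\<exists>r. local_solution J s z r" by blast
    fix r r' assume r: "local_solution J s z r" "local_solution J s z r'"
    fix j assume j: "j \<in> J"
    have rnz: "r j \<noteq> 0" if "j \<in> J" for j
    proof -
      have "1 - 4 * z * s j \<noteq> 0" using h1(3)[OF that nz(3)[OF that], of z] z by (auto simp: algebra_simps)
      then show ?thesis using r(1) that by (auto simp: local_solution_def)
    qed
    then show "r j \<noteq> 0" using j by blast
    show "r' j = r j"
    proof (rule ccontr)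
      assume ne: "r' j \<noteq> r j"
      define E where "E = {j\<in>J. r' j = r j}"
      have sq: "r' j ^ 2 = r j ^ 2" if "j \<in> J" for j using r that by (simp add: local_solution_def)
      have fE: "flip E r j = r' j" if "j \<in> J" for j
        using sq[OF that] that by (auto simp: flip_def E_def power2_eq_iff)
      \<comment> \<open>Two choices of signs that vanish at \<open>z\<close> would make it a double root.\<close>
      have "[:-z, 1:] ^ card {J, E} dvd N s"
      proof (rule sign_norm_dvd[OF N J(1)])
        show "{J, E} \<subseteq> Pow J" by (auto simp: E_def)
        fix A assume "A \<in> {J, E}"
        moreover have "signed_sum J J r = (\<Sum>j\<in>J. r j)" by (simp add: flip_def)
        moreover have "signed_sum J E r = (\<Sum>j\<in>J. r' j)" using fE by simp
        ultimately show "of_nat (card J) - 2 + signed_sum J A r = 0"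
          using r by (auto simp: local_solution_def)
      qed (use r rnz in \<open>auto simp: local_solution_def\<close>)
      moreover have "card {J, E} = 2" using ne j by (auto simp: E_def card_insert_if)
      ultimately obtain q where q: "N s = [:-z, 1:] ^ 2 * q" by (auto elim: dvdE)
      have "pderiv (N s) = monom 1 m * pderiv (P s) + P s * pderiv (monom 1 m)"
        unfolding NP by (rule pderiv_mult)
      then have "poly (pderiv (N s)) z = z ^ m * poly (pderiv (P s)) z" using z by (simp add: poly_monom)
      moreover have "poly (pderiv (N s)) z = 0"
        unfolding q power2_eq_square mult.assoc pderiv_mult[of "[:-z, 1:]"] by simp
      ultimately show False using z0 simple by simp
    qed
  qed
  have "mpolyfun H" unfolding H_def by (intro mpolyfun.mult mpolyfun_prod h h0 h1)
  moreover have "H s0 \<noteq> 0" using h h0 h1 J(1) by (simp add: H_def)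
  moreover have "poly (P s) z = 0" if "z \<noteq> 0" "local_solution J s z r" for s z r
  proof -
    have "of_nat (card J) - 2 + signed_sum J J r = 0"
      using that(2) by (simp add: local_solution_def flip_def)
    then have "poly (N s) z = 0"
      using sign_normD[OF N, of r z s] that(2) J(1) by (force simp: local_solution_def)
    then show ?thesis using PN that(1) by simp
  qed
  moreover have "\<forall>s. degree (P s) \<le> 2 ^ (card J - 1) - card J" using degP by (simp add: d_def m_def)
  ultimately show ?thesis unfolding generic_count_def
    using famP roots main by (intro exI[of _ P] exI[of _ H]) blast
qed

section \<open>Laminar families and their networks\<close>

text \<open>
  The model depends on a tree only through the sets of leaves below its non-root vertices.
\<close>

locale laminar =
  fixes F :: "'n::finite set set"
  assumes UNIV_mem: "UNIV \<in> F"
    and singleton_mem: "{i} \<in> F"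
    and empty_notin: "{} \<notin> F"
    and nested: "A \<in> F \<Longrightarrow> B \<in> F \<Longrightarrow> A \<inter> B = {} \<or> A \<subseteq> B \<or> B \<subseteq> A"
begin

definition children :: "'n set \<Rightarrow> 'n set set" where
  "children v = {c \<in> F. c \<subset> v \<and> (\<forall>A\<in>F. c \<subset> A \<longrightarrow> \<not> A \<subset> v)}"

text \<open>
  The clades of internal vertices.
\<close>

definition inner :: "'n set set" where
  "inner = {v \<in> F. \<forall>i. v \<noteq> {i}}"

definition parent :: "'n set \<Rightarrow> 'n set" where
  "parent c = (THE v. v \<in> F \<and> c \<in> children v)"

lemma mem_cases [consumes 1, case_names singleton inner]:
  assumes "v \<in> F" obtains i where "v = {i}" | "v \<in> inner"
  using assms by (auto simp: inner_def)

lemma innerD: "v \<in> inner \<Longrightarrow> v \<in> F" by (simp add: inner_def)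

lemma childD: "c \<in> children v \<Longrightarrow> c \<in> F" "c \<in> children v \<Longrightarrow> c \<subset> v"
  by (simp_all add: children_def)

lemma mem_nonempty: "v \<in> F \<Longrightarrow> v \<noteq> {}" using empty_notin by auto

lemma meet_cases: "A \<in> F \<Longrightarrow> B \<in> F \<Longrightarrow> i \<in> A \<Longrightarrow> i \<in> B \<Longrightarrow> A \<subseteq> B \<or> B \<subseteq> A"
  using nested by blast

lemma child_covering:
  assumes "v \<in> inner" "i \<in> v" shows "\<exists>c\<in>children v. i \<in> c"
proof -
  have "{i} \<in> {A \<in> F. i \<in> A \<and> A \<subset> v}" using assms singleton_mem by (auto simp: inner_def)
  then have "{A \<in> F. i \<in> A \<and> A \<subset> v} \<noteq> {}" by blast
  from finite_has_maximal[OF finite this] obtain c where c: "c \<in> {A \<in> F. i \<in> A \<and> A \<subset> v}"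
    "\<And>A. A \<in> {A \<in> F. i \<in> A \<and> A \<subset> v} \<Longrightarrow> c \<subseteq> A \<Longrightarrow> c = A" by (elim bexE) (rule that, auto)
  have "c \<in> children v" unfolding children_def using c by blast
  with c(1) show ?thesis by blast
qed

lemma children_disjoint:
  assumes "c \<in> children v" "c' \<in> children v" "c \<noteq> c'" shows "c \<inter> c' = {}"
  using assms nested[of c c'] unfolding children_def by blast

lemma Union_children: "v \<in> inner \<Longrightarrow> \<Union>(children v) = v"
  using child_covering childD(2) by blast

lemma card_children: assumes "v \<in> inner" shows "card (children v) \<ge> 2"
proof -
  have "v \<noteq> {}" using assms mem_nonempty innerD by blast
  then obtain i where "i \<in> v" by blast
  then obtain c where c: "c \<in> children v" "i \<in> c" using child_covering[OF assms] by blast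
  then obtain j where "j \<in> v" "j \<notin> c" using childD(2) by blast
  then obtain c' where c': "c' \<in> children v" "j \<in> c'" using child_covering[OF assms] by blast
  have "card {c, c'} \<le> card (children v)" using c c' by (intro card_mono) auto
  moreover have "c \<noteq> c'" using c' \<open>j \<notin> c\<close> by auto
  ultimately show ?thesis by simp
qed

lemma parent_props:
  assumes "c \<in> F" "c \<noteq> UNIV"
  shows "parent c \<in> inner" "c \<in> children (parent c)"
    and "\<And>v. v \<in> F \<Longrightarrow> c \<in> children v \<Longrightarrow> v = parent c"
proof -
  have "UNIV \<in> {A \<in> F. c \<subset> A}" using assms UNIV_mem by auto
  then have "{A \<in> F. c \<subset> A} \<noteq> {}" by blast
  from finite_has_minimal[OF finite this] obtain v where v: "v \<in> {A \<in> F. c \<subset> A}"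
    "\<And>A. A \<in> {A \<in> F. c \<subset> A} \<Longrightarrow> A \<subseteq> v \<Longrightarrow> v = A" by (elim bexE) (rule that, auto)
  have v': "v \<in> F" "c \<in> children v" unfolding children_def using v assms by blast+
  have uniq: "v'' = v" if "v'' \<in> F" "c \<in> children v''" for v''
  proof -
    obtain i where "i \<in> c" using assms(1) mem_nonempty by blast
    then have "v \<subseteq> v'' \<or> v'' \<subseteq> v"
      using meet_cases[OF v'(1) that(1), of i] childD(2) v'(2) that(2) by blast
    then show ?thesis using v' that unfolding children_def by blast
  qed
  have eq: "parent c = v" unfolding parent_def by (rule the_equality, intro conjI v', elim conjE, rule uniq)
  show "c \<in> children (parent c)" using v' eq by simp
  show "parent c \<in> inner"
    unfolding eq inner_def using v' childD[OF v'(2)] mem_nonempty[of c] by auto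
  show "w = parent c" if "w \<in> F" "c \<in> children w" for w using uniq[OF that] eq by simp
qed

lemma parent_child: "v \<in> F \<Longrightarrow> c \<in> children v \<Longrightarrow> parent c = v \<and> c \<noteq> UNIV"
  using parent_props(3)[of c v] childD by blast

lemma above_child:
  assumes "v \<in> F" "c \<in> children v" "A \<in> F" "i \<in> c" "i \<in> A"
  shows "A \<subseteq> c \<or> v \<subseteq> A"
proof -
  have "A \<subseteq> c \<or> c \<subseteq> A" using meet_cases assms childD by blast
  moreover have "A \<subseteq> v \<or> v \<subseteq> A" using meet_cases[OF assms(3,1), of i] assms childD(2) by blast
  ultimately show ?thesis using assms unfolding children_def by blast
qed

text \<open>
  Induction from the whole set towards the singletons, i.e. from the root to the leaves.
\<close>

lemma mem_induct_down [consumes 1, case_names UNIV child]: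
  assumes "A \<in> F" "P UNIV"
    and step: "\<And>v c. v \<in> inner \<Longrightarrow> c \<in> children v \<Longrightarrow> (\<And>B. B \<in> F \<Longrightarrow> v \<subseteq> B \<Longrightarrow> P B) \<Longrightarrow> P c"
  shows "P A"
  using assms(1)
proof (induction "card (UNIV - A)" arbitrary: A rule: less_induct)
  case less
  show ?case
  proof (cases "A = UNIV")
    case True
    with assms(2) show ?thesis by simp
  next
    case False
    note p = parent_props[OF less.prems False]
    show ?thesis
    proof (rule step[OF p(1,2)])
      fix B assume B: "B \<in> F" "parent A \<subseteq> B"
      then have "UNIV - B \<subset> UNIV - A" using childD(2)[OF p(2)] by blast
      then show "P B" by (intro less.hyps B psubset_card_mono) auto
    qed
  qed
qed

definition tot :: "('n \<Rightarrow> complex) \<Rightarrow> 'n set \<Rightarrow> complex" where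
  "tot x A = (\<Sum>i\<in>A. x i)"

lemma tot_children: "v \<in> inner \<Longrightarrow> tot x v = (\<Sum>c\<in>children v. tot x c)"
  unfolding tot_def using sum.Union_disjoint[of "children v" x] children_disjoint[of _ v]
  by (simp add: Union_children)

text \<open>
  In the network of the tree, \<open>\<theta> A\<close> is the resistance of the edge that enters the vertex of \<open>A\<close>, and \<open>x\<close>
  prescribes the currents that enter at the leaves and flow to the root, so that \<open>tot x A\<close> flows
  through that edge. The root has voltage 0: \<open>above\<close> is the voltage at the vertex of \<open>v\<close> and \<open>volt\<close> the voltage at a leaf, while
  \<open>below\<close> collects the contribution of the edges inside \<open>v\<close>, including the one that enters \<open>v\<close>.
\<close>

definition above :: "('n set \<Rightarrow> complex) \<Rightarrow> ('n \<Rightarrow> complex) \<Rightarrow> 'n set \<Rightarrow> complex" where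
  "above \<theta> x v = (\<Sum>A | A \<in> F \<and> v \<subseteq> A. \<theta> A * tot x A)"

definition below :: "('n set \<Rightarrow> complex) \<Rightarrow> ('n \<Rightarrow> complex) \<Rightarrow> 'n set \<Rightarrow> 'n \<Rightarrow> complex" where
  "below \<theta> x v i = (\<Sum>A | A \<in> F \<and> i \<in> A \<and> A \<subseteq> v. \<theta> A * tot x A)"

definition volt :: "('n set \<Rightarrow> complex) \<Rightarrow> ('n \<Rightarrow> complex) \<Rightarrow> 'n \<Rightarrow> complex" where
  "volt \<theta> x i = (\<Sum>A | A \<in> F \<and> i \<in> A. \<theta> A * tot x A)"

lemma volt_UNIV: "volt \<theta> x i = below \<theta> x UNIV i"
  by (simp add: volt_def below_def)

lemma volt_split:
  assumes "v \<in> F" "c \<in> children v" "i \<in> c"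
  shows "volt \<theta> x i = below \<theta> x c i + above \<theta> x v"
proof -
  have "{A. A \<in> F \<and> i \<in> A} = {A. A \<in> F \<and> i \<in> A \<and> A \<subseteq> c} \<union> {A. A \<in> F \<and> v \<subseteq> A}"
    using above_child[OF assms(1,2) _ assms(3)] assms childD(2)[OF assms(2)] by blast
  moreover have "{A. A \<in> F \<and> i \<in> A \<and> A \<subseteq> c} \<inter> {A. A \<in> F \<and> v \<subseteq> A} = {}"
    using childD(2)[OF assms(2)] by blast
  ultimately show ?thesis
    by (simp add: volt_def below_def above_def sum.union_disjoint)
qed

lemma below_child:
  assumes "v \<in> F" "c \<in> children v" "i \<in> c"
  shows "below \<theta> x v i = below \<theta> x c i + \<theta> v * tot x v"
proof -
  have "{A. A \<in> F \<and> i \<in> A \<and> A \<subseteq> v} = insert v {A. A \<in> F \<and> i \<in> A \<and> A \<subseteq> c}"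
    using above_child[OF assms(1,2) _ assms(3)] assms childD(2)[OF assms(2)] by blast
  moreover have "v \<notin> {A. A \<in> F \<and> i \<in> A \<and> A \<subseteq> c}" using childD(2)[OF assms(2)] by blast
  ultimately show ?thesis by (simp add: below_def add.commute)
qed

lemma below_singleton: "below \<theta> x {i} i = \<theta> {i} * x i"
proof -
  have "{A. A \<in> F \<and> i \<in> A \<and> A \<subseteq> {i}} = {{i}}" using singleton_mem by auto
  then show ?thesis by (simp add: below_def tot_def)
qed

lemma sum_below:
  "(\<Sum>i\<in>c. y i * below \<theta> x c i) = (\<Sum>A | A \<in> F \<and> A \<subseteq> c. \<theta> A * tot x A * tot y A)"
proof -
  have "(\<Sum>i\<in>c. y i * below \<theta> x c i) =
      (\<Sum>i\<in>c. \<Sum>A | A \<in> F \<and> A \<subseteq> c. if i \<in> A then \<theta> A * tot x A * y i else 0)"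
    unfolding below_def sum_distrib_left
    by (intro sum.cong refl sum.mono_neutral_cong_left) auto
  also have "\<dots> = (\<Sum>A | A \<in> F \<and> A \<subseteq> c. \<Sum>i\<in>c. if i \<in> A then \<theta> A * tot x A * y i else 0)"
    by (rule sum.swap)
  also have "\<dots> = (\<Sum>A | A \<in> F \<and> A \<subseteq> c. \<theta> A * tot x A * tot y A)"
  proof (intro sum.cong refl)
    fix A assume "A \<in> {A. A \<in> F \<and> A \<subseteq> c}"
    then show "(\<Sum>i\<in>c. if i \<in> A then \<theta> A * tot x A * y i else 0) = \<theta> A * tot x A * tot y A"
      unfolding tot_def[of y] sum_distrib_left by (intro sum.mono_neutral_cong_right) auto
  qed
  finally show ?thesis .
qed

text \<open>
  Both sides compute the symmetric bilinear form that the network inside \<open>c\<close> defines, evaluated at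
  \<open>x\<close> and \<open>y\<close>.
\<close>

lemma reciprocity:
  assumes "\<And>i. i \<in> c \<Longrightarrow> below \<theta> x c i = a" "\<And>i. i \<in> c \<Longrightarrow> below \<theta> y c i = b"
  shows "b * tot x c = a * tot y c"
proof -
  have "(\<Sum>i\<in>c. y i * below \<theta> x c i) = (\<Sum>i\<in>c. x i * below \<theta> y c i)"
    unfolding sum_below by (simp add: mult_ac)
  also have "(\<Sum>i\<in>c. y i * below \<theta> x c i) = a * tot y c"
    using assms(1) by (simp add: tot_def sum_distrib_left mult.commute)
  also have "(\<Sum>i\<in>c. x i * below \<theta> y c i) = b * tot x c"
    using assms(2) by (simp add: tot_def sum_distrib_left mult.commute)
  finally show ?thesis by simp
qed

text \<open>
  Currents in the network inside \<open>c\<close> that produce voltage 1 at all of its leaves; their sum \<open>w\<close> is the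
  conductance. Asking for \<open>y\<close> instead of inverting a submatrix avoids any discussion of singular
  submatrices.
\<close>

definition unit_response :: "('n set \<Rightarrow> complex) \<Rightarrow> 'n set \<Rightarrow> complex \<Rightarrow> ('n \<Rightarrow> complex) \<Rightarrow> bool" where
  "unit_response \<theta> c w y \<longleftrightarrow> (\<forall>i\<in>c. below \<theta> y c i = 1) \<and> tot y c = w"

lemma tot_scale: "tot (\<lambda>i. k * x i) A = k * tot x A"
  by (simp add: tot_def sum_distrib_left)

lemma below_scale: "below \<theta> (\<lambda>i. k * x i) c i = k * below \<theta> x c i"
  by (simp add: below_def tot_scale sum_distrib_left mult_ac)

lemma unit_responseD:
  assumes "unit_response \<theta> c w y" "\<And>i. i \<in> c \<Longrightarrow> below \<theta> x c i = a"
  shows "tot x c = a * w"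
  using reciprocity[OF assms(2), of y 1] assms(1) by (simp add: unit_response_def)

lemma unit_response_singleton: "unit_response \<theta> {i} w y \<Longrightarrow> \<theta> {i} * w = 1"
  by (auto simp: unit_response_def below_singleton tot_def)

text \<open>
  The law for resistances: the reciprocals of \<open>w\<close> and of the sum of the parallel conductances
  $w'_c$ differ by the series resistance \<open>\<theta> v\<close>.
\<close>

lemma unit_response_inner:
  assumes v: "v \<in> inner" and y: "unit_response \<theta> v w y"
    and y': "\<And>c. c \<in> children v \<Longrightarrow> unit_response \<theta> c (w' c) (y' c)"
  shows "w = (1 - \<theta> v * w) * (\<Sum>c\<in>children v. w' c)"
proof -
  have "tot y c = (1 - \<theta> v * w) * w' c" if c: "c \<in> children v" for c
  proof (rule unit_responseD[OF y'[OF c]])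
    fix i assume i: "i \<in> c"
    then have "i \<in> v" using childD(2)[OF c] by blast
    then show "below \<theta> y c i = 1 - \<theta> v * w"
      using below_child[OF innerD[OF v] c i, of \<theta> y] y \<open>i \<in> v\<close>
      by (simp add: unit_response_def eq_diff_eq)
  qed
  then show ?thesis
    using y tot_children[OF v, of y] by (simp add: unit_response_def sum_distrib_left)
qed

text \<open>
  Currents entering \<open>v\<close> split among the children in proportion to their conductances.
\<close>

lemma unit_response_exists:
  assumes "\<And>v. v \<in> F \<Longrightarrow> w v \<noteq> 0" "\<And>v. v \<in> inner \<Longrightarrow> (\<Sum>c\<in>children v. w c) \<noteq> 0"
    and "\<And>v. v \<in> inner \<Longrightarrow> \<theta> v = 1 / w v - 1 / (\<Sum>c\<in>children v. w c)"
    and "\<And>i. \<theta> {i} = 1 / w {i}"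
    and "v \<in> F"
  shows "\<exists>y. unit_response \<theta> v (w v) y"
  using assms(5)
proof (induction "card v" arbitrary: v rule: less_induct)
  case less
  from less.prems show ?case
  proof (cases rule: mem_cases)
    case (singleton i)
    show ?thesis using assms(1)[of "{i}"] singleton_mem
      by (intro exI[of _ "\<lambda>_. w v"]) (simp add: unit_response_def singleton below_singleton tot_def assms(4))
  next
    case inner
    have "\<exists>y. unit_response \<theta> c (w c) y" if "c \<in> children v" for c
      using less.hyps[of c] childD[OF that] psubset_card_mono[of v c] by simp
    then obtain Y where Y: "\<And>c. c \<in> children v \<Longrightarrow> unit_response \<theta> c (w c) (Y c)" by metis
    define u where "u = (\<Sum>c\<in>children v. w c)"
    have u: "u \<noteq> 0" using assms(2)[OF inner] by (simp add: u_def)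
    define y where "y i = w v / u * Y (THE c. c \<in> children v \<and> i \<in> c) i" for i
    have y_eq: "y i = w v / u * Y c i" if "c \<in> children v" "i \<in> c" for c i
    proof -
      have "(THE c. c \<in> children v \<and> i \<in> c) = c"
        using that children_disjoint by (intro the_equality) blast+
      then show ?thesis by (simp add: y_def)
    qed
    have tot_sub: "tot y A = w v / u * tot (Y c) A" if "c \<in> children v" "A \<subseteq> c" for c A
      unfolding tot_def sum_distrib_left using that by (intro sum.cong) (auto simp: y_eq)
    have "tot y v = (\<Sum>c\<in>children v. w v / u * w c)"
      unfolding tot_children[OF inner] using tot_sub Y by (intro sum.cong) (auto simp: unit_response_def)
    also have "\<dots> = w v" using u by (simp add: u_def flip: sum_distrib_left sum_divide_distrib)
    finally have ty: "tot y v = w v" .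
    have "below \<theta> y v i = 1" if i: "i \<in> v" for i
    proof -
      obtain c where c: "c \<in> children v" "i \<in> c" using child_covering[OF inner i] by blast
      have "below \<theta> y c i = w v / u * below \<theta> (Y c) c i"
        unfolding below_def sum_distrib_left using tot_sub[OF c(1)] by (intro sum.cong) auto
      also have "\<dots> = w v / u" using Y[OF c(1)] c(2) by (simp add: unit_response_def)
      finally have "below \<theta> y v i = w v / u + \<theta> v * w v"
        unfolding below_child[OF less.prems c] ty by simp
      also have "\<dots> = 1" using u assms(1)[OF less.prems] assms(3)[OF inner]
        by (simp add: u_def[symmetric] field_simps)
      finally show ?thesis .
    qed
    with ty show ?thesis by (intro exI[of _ y]) (simp add: unit_response_def)
  qed
qed

text \<open>
  Descending from the root, the conductance of each clade turns vanishing voltage into vanishing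
  current.
\<close>

lemma volt_injective:
  assumes "\<And>v. v \<in> F \<Longrightarrow> \<exists>y. unit_response \<theta> v (w v) y" "\<And>i. volt \<theta> x i = 0"
  shows "x i = 0"
proof -
  have "tot x A = 0" if "A \<in> F" for A
    using that
  proof (induction rule: mem_induct_down)
    case UNIV
    obtain y where "unit_response \<theta> UNIV (w UNIV) y" using assms(1)[OF UNIV_mem] by blast
    from unit_responseD[OF this, of x 0] assms(2) show ?case by (simp add: volt_UNIV)
  next
    case (child v c)
    obtain y where y: "unit_response \<theta> c (w c) y" using assms(1) childD child.hyps by blast
    have "above \<theta> x v = 0" unfolding above_def using child.IH by (intro sum.neutral) auto
    then have "below \<theta> x c i = 0" if "i \<in> c" for i
      using volt_split[OF innerD child.hyps(2) that, of \<theta> x] child.hyps assms(2) by simp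
    from unit_responseD[OF y this] show ?case by simp
  qed
  from this[OF singleton_mem] show ?thesis by (simp add: tot_def)
qed

end

text \<open>
  \<open>q\<close> is the inverse of the matrix with resistances \<open>\<theta>\<close>: its column \<open>j\<close> consists of the currents that
  produce voltage 1 at leaf \<open>j\<close> and voltage 0 at all others.
\<close>

locale network = laminar F for F :: "'n::finite set set" +
  fixes \<theta> :: "'n set \<Rightarrow> complex" and q :: "'n \<Rightarrow> 'n \<Rightarrow> complex"
  assumes q_sym: "q i j = q j i"
    and q_inverse: "volt \<theta> (\<lambda>k. q k j) i = (if i = j then 1 else 0)"
begin

definition curr :: "'n set \<Rightarrow> 'n \<Rightarrow> complex" where
  "curr B i = (\<Sum>j\<in>B. q i j)"

definition bil :: "'n set \<Rightarrow> 'n set \<Rightarrow> complex" where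
  "bil A B = (\<Sum>i\<in>A. \<Sum>j\<in>B. q i j)"

text \<open>
  The voltage at the vertex of \<open>v\<close> when all leaves below it are held at voltage 1 and all other leaves
  at 0. The conductances of the children of \<open>v\<close> exist unless this is 1.
\<close>

definition gain :: "'n set \<Rightarrow> complex" where
  "gain v = above \<theta> (curr v) v"

lemma tot_curr: "tot (curr B) A = bil A B"
  by (simp add: tot_def curr_def bil_def)

lemma bil_sym: "bil A B = bil B A"
  unfolding bil_def by (subst sum.swap) (simp add: q_sym)

lemma bil_children_left: "v \<in> inner \<Longrightarrow> bil v A = (\<Sum>c\<in>children v. bil c A)"
  using tot_children[of v "curr A"] by (simp add: tot_curr)

lemma bil_children_right: "v \<in> inner \<Longrightarrow> bil A v = (\<Sum>c\<in>children v. bil A c)"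
  unfolding bil_sym[of A] by (rule bil_children_left)

lemma above_curr_children:
  assumes "v \<in> inner" shows "above \<theta> (curr v) z = (\<Sum>c\<in>children v. above \<theta> (curr c) z)"
proof -
  have "(\<Sum>c\<in>children v. above \<theta> (curr c) z) = (\<Sum>A | A \<in> F \<and> z \<subseteq> A. \<Sum>c\<in>children v. \<theta> A * bil A c)"
    unfolding above_def tot_curr by (rule sum.swap)
  then show ?thesis
    by (simp add: above_def tot_curr bil_children_right[OF assms] sum_distrib_left)
qed

lemma volt_curr: "volt \<theta> (curr B) i = (if i \<in> B then 1 else 0)"
proof -
  have "volt \<theta> (curr B) i = (\<Sum>A | A \<in> F \<and> i \<in> A. \<Sum>j\<in>B. \<theta> A * tot (\<lambda>k. q k j) A)"
    unfolding volt_def tot_curr bil_def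
    by (subst sum.swap) (simp add: tot_def sum_distrib_left)
  also have "\<dots> = (\<Sum>j\<in>B. volt \<theta> (\<lambda>k. q k j) i)" unfolding volt_def by (rule sum.swap)
  also have "\<dots> = (if i \<in> B then 1 else 0)" by (simp add: q_inverse)
  finally show ?thesis .
qed

lemma below_curr:
  assumes "v \<in> inner" "c \<in> children v" "i \<in> c"
  shows "below \<theta> (curr B) c i = (if i \<in> B then 1 else 0) - above \<theta> (curr B) v"
  using volt_split[OF innerD[OF assms(1)] assms(2,3), of \<theta> "curr B"] by (simp add: volt_curr)

lemma below_curr_parent:
  assumes "v \<in> inner" "c \<in> children v" "i \<in> c"
  shows "below \<theta> (curr v) c i = 1 - gain v"
  using below_curr[OF assms, of v] childD(2)[OF assms(2)] assms(3) by (auto simp: gain_def)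

lemma below_curr_self:
  assumes "v \<in> inner" "c \<in> children v" "i \<in> c"
  shows "below \<theta> (curr c) c i = 1 - above \<theta> (curr c) v"
  using below_curr[OF assms, of c] assms(3) by simp

lemma below_curr_sibling:
  assumes "v \<in> inner" "c \<in> children v" "i \<in> c" "c' \<in> children v" "c' \<noteq> c"
  shows "below \<theta> (curr c') c i = - above \<theta> (curr c') v"
  using below_curr[OF assms(1-3), of c'] children_disjoint[OF assms(4,2,5)] assms(3) by auto

text \<open>
  If the voltage at \<open>v\<close> is 1, reciprocity shows that one child \<open>c\<close> carries all the current, that
  holding the leaves below another child at voltage 1 produces voltage 0 at \<open>v\<close>, and hence that the
  blocks of \<open>q\<close> between different children other than \<open>c\<close> have sum 0. Adding up the blocks then yields
  the excluded relation.
\<close>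

lemma gain_neq_1:
  assumes v: "v \<in> inner" and nz: "bil v v \<noteq> 0"
    and nd: "\<And>c. c \<in> children v \<Longrightarrow> bil c c \<noteq> bil v v + (\<Sum>c'\<in>children v - {c}. bil c' c')"
  shows "gain v \<noteq> 1"
proof
  assume G: "gain v = 1"
  let ?g = "\<lambda>c. above \<theta> (curr c) v"
  have "\<exists>c\<in>children v. bil c v \<noteq> 0"
  proof (rule ccontr)
    assume "\<not> ?thesis"
    then have "bil v v = 0" using bil_children_left[OF v, of v] by simp
    with nz show False by simp
  qed
  then obtain c where c: "c \<in> children v" "bil c v \<noteq> 0" by blast
  have g0: "?g c' = 0" if c': "c' \<in> children v - {c}" for c'
  proof -
    from c' have n: "c' \<in> children v" "c' \<noteq> c" by auto
    have "- ?g c' * tot (curr v) c = 0 * tot (curr c') c"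
      by (rule reciprocity[where \<theta> = \<theta>]) (simp_all add: below_curr_parent[OF v c(1)] G below_curr_sibling[OF v c(1) _ n])
    with c(2) show ?thesis by (simp add: tot_curr)
  qed
  have g1: "?g c = 1"
  proof -
    have "gain v = ?g c + (\<Sum>c'\<in>children v - {c}. ?g c')"
      unfolding gain_def above_curr_children[OF v] using c by (simp add: sum.remove)
    then show ?thesis using G g0 by simp
  qed
  have off: "bil c' c = - bil c' c'" if c': "c' \<in> children v - {c}" for c'
  proof -
    from c' have n: "c' \<in> children v" "c \<noteq> c'" by auto
    have "1 * tot (curr c) c' = - 1 * tot (curr c') c'"
      by (rule reciprocity[where \<theta> = \<theta>])
        (simp_all add: below_curr_self[OF v n(1)] below_curr_sibling[OF v n(1) _ c(1) n(2)] g0[OF c'] g1)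
    then show ?thesis by (simp add: tot_curr)
  qed
  have zero: "bil c' c'' = 0" if c': "c' \<in> children v - {c}" "c'' \<in> children v - {c}" "c' \<noteq> c''" for c' c''
  proof -
    from c' have n: "c' \<in> children v" "c'' \<in> children v" "c'' \<noteq> c'" by auto
    have "1 * tot (curr c'') c' = 0 * tot (curr c') c'"
      by (rule reciprocity[where \<theta> = \<theta>])
        (simp_all add: below_curr_self[OF v n(1)] below_curr_sibling[OF v n(1) _ n(2,3)] g0[OF c'(1)] g0[OF c'(2)])
    then show ?thesis by (simp add: tot_curr)
  qed
  have row: "bil c' v = 0" if c': "c' \<in> children v - {c}" for c'
  proof -
    have "bil c' v = bil c' c + (\<Sum>c''\<in>children v - {c}. bil c' c'')"
      unfolding bil_children_right[OF v] using c by (simp add: sum.remove)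
    also have "(\<Sum>c''\<in>children v - {c}. bil c' c'') = (\<Sum>c''\<in>children v - {c}. if c'' = c' then bil c' c' else 0)"
      using zero[OF c'] by (intro sum.cong) auto
    also have "\<dots> = bil c' c'" using c' by simp
    finally show ?thesis using off[OF c'] by simp
  qed
  have "bil v v = (\<Sum>c'\<in>children v. bil c' v)" by (rule bil_children_left[OF v])
  also have "\<dots> = bil c v" using c row by (simp add: sum.remove[of _ c])
  also have "\<dots> = bil c c + (\<Sum>c'\<in>children v - {c}. bil c c')"
    unfolding bil_children_right[OF v] using c by (simp add: sum.remove)
  also have "(\<Sum>c'\<in>children v - {c}. bil c c') = (\<Sum>c'\<in>children v - {c}. - bil c' c')"
    using off unfolding bil_sym[of c] by (intro sum.cong) auto
  finally have "bil c c = bil v v + (\<Sum>c'\<in>children v - {c}. bil c' c')"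
    by (simp add: sum_negf)
  with nd[OF c(1)] show False by simp
qed

lemma unit_response_curr:
  assumes "v \<in> inner" "c \<in> children v" "gain v \<noteq> 1"
  shows "unit_response \<theta> c (bil c v / (1 - gain v)) (\<lambda>i. 1 / (1 - gain v) * curr v i)"
  using assms unfolding unit_response_def below_scale tot_scale tot_curr
  by (simp add: below_curr_parent[OF assms(1,2)])

lemma unit_response_UNIV: "unit_response \<theta> UNIV (bil UNIV UNIV) (curr UNIV)"
  by (simp add: unit_response_def tot_curr volt_UNIV[symmetric] volt_curr)

lemma node_currents:
  assumes v: "v \<in> inner" and y: "\<And>c. c \<in> children v \<Longrightarrow> unit_response \<theta> c (w c) (y c)"
  shows "c \<in> children v \<Longrightarrow> bil c v = (1 - gain v) * w c"
    and "bil v v = (1 - gain v) * (\<Sum>c\<in>children v. w c)"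
proof -
  show row: "bil c v = (1 - gain v) * w c" if "c \<in> children v" for c
    using unit_responseD[OF y[OF that], of "curr v" "1 - gain v"] v that
    by (simp add: below_curr_parent tot_curr)
  have "bil v v = (\<Sum>c\<in>children v. bil c v)" by (rule bil_children_left[OF v])
  then show "bil v v = (1 - gain v) * (\<Sum>c\<in>children v. w c)" using row by (simp add: sum_distrib_left)
qed

text \<open>
  Comparing \<open>bil v c\<close>, computed from the voltage \<open>g\<close> that is produced at \<open>v\<close> by the leaves of \<open>c\<close>, with
  \<open>bil c v\<close>, computed from the voltage that is produced at \<open>v\<close> by all leaves below it, determines \<open>g\<close>.
  The network above \<open>v\<close> enters only through \<open>bil v v\<close>, which is why the critical equations decouple.
\<close>

lemma node_equation:
  assumes v: "v \<in> inner" and c: "c \<in> children v"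
    and y: "\<And>c. c \<in> children v \<Longrightarrow> unit_response \<theta> c (w c) (y c)"
    and u: "u = (\<Sum>c\<in>children v. w c)" "u \<noteq> 0"
  shows "bil c c = w c - (w c)\<^sup>2 * (1 / u - bil v v / u\<^sup>2)"
proof -
  define g where "g = above \<theta> (curr c) v"
  have self: "bil c c = (1 - g) * w c"
    using unit_responseD[OF y[OF c], of "curr c" "1 - g"] v c
    by (simp add: below_curr_self tot_curr g_def)
  have sib: "bil c' c = - g * w c'" if c': "c' \<in> children v - {c}" for c'
  proof -
    from c' have n: "c' \<in> children v" "c \<noteq> c'" by auto
    have "tot (curr c) c' = - g * w c'"
      by (rule unit_responseD[OF y[OF n(1)]]) (simp add: below_curr_sibling[OF v n(1) _ c n(2)] g_def)
    then show ?thesis by (simp add: tot_curr)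
  qed
  have "bil v c = (\<Sum>c'\<in>children v. bil c' c)"
    by (rule bil_children_left[OF v])
  also have "\<dots> = bil c c + (\<Sum>c'\<in>children v - {c}. bil c' c)" using c by (simp add: sum.remove)
  also have "(\<Sum>c'\<in>children v - {c}. bil c' c) = - g * (\<Sum>c'\<in>children v - {c}. w c')"
    using sib by (simp add: sum_distrib_left)
  also have "(\<Sum>c'\<in>children v - {c}. w c') = u - w c" using c u(1) by (simp add: sum.remove)
  finally have 1: "bil c v = w c - g * u" using self unfolding bil_sym[of v] by (simp add: algebra_simps)
  have 2: "bil c v = (1 - gain v) * w c" using node_currents(1)[OF v y c] .
  have 3: "bil v v = (1 - gain v) * u" using node_currents(2)[OF v y] u(1) by simp
  have "g = (w c - (1 - gain v) * w c) / u" using 1 2 u(2) by (simp add: field_simps)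
  then have "bil c c = w c - w c * ((w c - (1 - gain v) * w c) / u)"
    using self by (simp add: algebra_simps)
  also have "\<dots> = w c - (w c)\<^sup>2 * (1 / u - bil v v / u\<^sup>2)"
    unfolding 3 using u(2) by (simp add: field_simps power2_eq_square)
  finally show ?thesis .
qed

end

section \<open>Local rings of linear spaces\<close>

lemma matrix_inv_mult:
  fixes A :: "complex^'n::finite^'n"
  assumes "invertible A"
  shows "A ** matrix_inv A = mat 1" "matrix_inv A ** A = mat 1"
  using assms unfolding invertible_def matrix_inv_def by (rule someI2_ex, simp)+

text \<open>
  The numerator in Cramer's rule for an entry of the inverse matrix.
\<close>

definition cofactor_num :: "'n \<Rightarrow> 'n \<Rightarrow> complex^'n::finite^'n \<Rightarrow> complex" where
  "cofactor_num i j A = det (\<chi> k l. if l = i then (if k = j then 1 else 0) else A $ k $ l)"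

lemma matrix_inv_entry:
  fixes A :: "complex^'n::finite^'n"
  assumes "invertible A"
  shows "matrix_inv A $ i $ j = cofactor_num i j A / det A"
proof -
  have "A *v column j (matrix_inv A) = column j (mat 1)"
    unfolding matrix_inv_mult(1)[OF assms, symmetric]
    by (simp add: vec_eq_iff column_def matrix_vector_mult_def matrix_matrix_mult_def)
  moreover have "det A \<noteq> 0" using assms by (simp add: invertible_det_nz)
  ultimately have "column j (matrix_inv A) =
      (\<chi> k. det (\<chi> i l. if l = k then column j (mat 1) $ i else A $ i $ l) / det A)"
    using cramer[of A] by blast
  from arg_cong[OF this, of "\<lambda>x. x $ i"] show ?thesis
    by (simp add: column_def cofactor_num_def mat_def cong: if_cong)
qed

lemma polyfun_cofactor_num: "polyfun (cofactor_num i j)"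
  unfolding cofactor_num_def[abs_def] det_def
proof (intro polyfun_sum polyfun.mult polyfun.const polyfun_prod)
  fix p k
  show "polyfun (\<lambda>A. (\<chi> k l. if l = i then (if k = j then 1 else 0) else A $ k $ l) $ k $ p k)"
    by (cases "p k = i") (simp_all add: polyfun.const polyfun.entry)
qed (simp_all add: finite_permutations)

lemma polyfun_diff: "polyfun f \<Longrightarrow> polyfun g \<Longrightarrow> polyfun (\<lambda>\<Sigma>. f \<Sigma> - g \<Sigma>)"
  using polyfun.add[OF _ polyfun.mult[OF polyfun.const[of "-1"]], of f g] by simp

lemma polyfun_power: "polyfun f \<Longrightarrow> polyfun (\<lambda>\<Sigma>. f \<Sigma> ^ k)"
  by (induction k) (simp_all add: polyfun.const polyfun.mult)

text \<open>
  Genericity is obtained in terms of the inverse of \<open>S\<close>; clearing denominators translates it into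
  a polynomial condition on \<open>S\<close>.
\<close>

lemma polyfun_matrix_inv:
  fixes f :: "complex^'n::finite^'n \<Rightarrow> complex"
  assumes "polyfun f"
  shows "\<exists>g N. polyfun g \<and> (\<forall>S. invertible S \<longrightarrow> f (matrix_inv S) * det S ^ N = g S)"
  using assms
proof induction
  case (const c)
  show ?case by (intro exI[of _ "\<lambda>_. c"] exI[of _ 0]) (simp add: polyfun.const)
next
  case (entry i j)
  show ?case
    by (intro exI[of _ "cofactor_num i j"] exI[of _ 1])
       (simp add: polyfun_cofactor_num matrix_inv_entry invertible_det_nz)
next
  case (add f f')
  then obtain g N g' N' where "polyfun g" "polyfun g'"
    "\<And>S. invertible S \<Longrightarrow> f (matrix_inv S) * det S ^ N = g S"
    "\<And>S. invertible S \<Longrightarrow> f' (matrix_inv S) * det S ^ N' = g' S" by blast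
  then show ?case
    by (intro exI[of _ "\<lambda>S. g S * det S ^ N' + g' S * det S ^ N"] exI[of _ "N + N'"])
       (auto intro!: polyfun.add polyfun.mult polyfun_power polyfun_det simp: power_add algebra_simps)
next
  case (mult f f')
  then obtain g N g' N' where "polyfun g" "polyfun g'"
    "\<And>S. invertible S \<Longrightarrow> f (matrix_inv S) * det S ^ N = g S"
    "\<And>S. invertible S \<Longrightarrow> f' (matrix_inv S) * det S ^ N' = g' S" by blast
  then show ?case
    by (intro exI[of _ "\<lambda>S. g S * g' S"] exI[of _ "N + N'"])
       (auto intro!: polyfun.mult simp: power_add mult_ac)
qed

text \<open>
  \<open>R\<close> and \<open>I\<close> are the local ring at \<open>P\<close> and the ideal of the equations \<open>F\<close>, and \<open>near\<close> says that a
  property holds on a Zariski neighbourhood of \<open>P\<close> in \<open>X\<close>.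
\<close>

locale local_algebra =
  fixes X :: "(complex^'n::finite^'n) set" and P :: "complex^'n^'n" and F :: "(complex^'n^'n \<Rightarrow> complex) set"
  assumes P_mem: "P \<in> X"
    and gen_mem: "f \<in> F \<Longrightarrow> f \<in> local_ring X P"
    and gen_zero: "f \<in> F \<Longrightarrow> f P = 0"
begin

abbreviation "R \<equiv> local_ring X P"
abbreviation "I \<equiv> local_ideal X F P"

definition near :: "(complex^'n^'n \<Rightarrow> bool) \<Rightarrow> bool" where
  "near Q \<longleftrightarrow> (\<exists>g. polyfun g \<and> g P \<noteq> 0 \<and> (\<forall>\<Sigma>\<in>X. g \<Sigma> \<noteq> 0 \<longrightarrow> Q \<Sigma>))"

lemma germ_eq_near: "germ_eq X P \<phi> \<psi> \<longleftrightarrow> near (\<lambda>\<Sigma>. \<phi> \<Sigma> = \<psi> \<Sigma>)"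
  by (simp add: germ_eq_def near_def)

lemma near_conj: "near Q \<Longrightarrow> near Q' \<Longrightarrow> near (\<lambda>\<Sigma>. Q \<Sigma> \<and> Q' \<Sigma>)"
  unfolding near_def
proof (elim exE conjE)
  fix g g' assume "polyfun g" "g P \<noteq> 0" "\<forall>\<Sigma>\<in>X. g \<Sigma> \<noteq> 0 \<longrightarrow> Q \<Sigma>"
    "polyfun g'" "g' P \<noteq> 0" "\<forall>\<Sigma>\<in>X. g' \<Sigma> \<noteq> 0 \<longrightarrow> Q' \<Sigma>"
  then show "\<exists>g. polyfun g \<and> g P \<noteq> 0 \<and> (\<forall>\<Sigma>\<in>X. g \<Sigma> \<noteq> 0 \<longrightarrow> Q \<Sigma> \<and> Q' \<Sigma>)"
    by (intro exI[of _ "\<lambda>\<Sigma>. g \<Sigma> * g' \<Sigma>"]) (auto intro: polyfun.mult)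
qed

lemma near_mono: "near Q \<Longrightarrow> (\<And>\<Sigma>. \<Sigma> \<in> X \<Longrightarrow> Q \<Sigma> \<Longrightarrow> Q' \<Sigma>) \<Longrightarrow> near Q'"
  unfolding near_def by blast

lemma near_at: "near Q \<Longrightarrow> Q P"
  unfolding near_def using P_mem by blast

lemma near_all: "(\<And>\<Sigma>. \<Sigma> \<in> X \<Longrightarrow> Q \<Sigma>) \<Longrightarrow> near Q"
  unfolding near_def using polyfun.const[of 1] by fastforce

lemma near_polyfun: "polyfun g \<Longrightarrow> g P \<noteq> 0 \<Longrightarrow> near (\<lambda>\<Sigma>. g \<Sigma> \<noteq> 0)"
  unfolding near_def by blast

lemma near_ball: "finite K \<Longrightarrow> (\<And>k. k \<in> K \<Longrightarrow> near (Q k)) \<Longrightarrow> near (\<lambda>\<Sigma>. \<forall>k\<in>K. Q k \<Sigma>)"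
proof (induction K rule: finite_induct)
  case empty
  show ?case by (rule near_all) simp
next
  case (insert k K)
  then have "near (\<lambda>\<Sigma>. Q k \<Sigma> \<and> (\<forall>k\<in>K. Q k \<Sigma>))" by (intro near_conj) auto
  then show ?case by (rule near_mono) auto
qed

lemma R_memE:
  assumes "\<phi> \<in> R"
  obtains f g where "polyfun f" "polyfun g" "g P \<noteq> 0" "near (\<lambda>\<Sigma>. \<phi> \<Sigma> = f \<Sigma> / g \<Sigma>)"
  using assms unfolding local_ring_def germ_eq_near by blast

lemma R_memI:
  "polyfun f \<Longrightarrow> polyfun g \<Longrightarrow> g P \<noteq> 0 \<Longrightarrow> near (\<lambda>\<Sigma>. \<phi> \<Sigma> = f \<Sigma> / g \<Sigma>) \<Longrightarrow> \<phi> \<in> R"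
  unfolding local_ring_def germ_eq_near by blast

lemma R_cong: "near (\<lambda>\<Sigma>. \<phi> \<Sigma> = \<psi> \<Sigma>) \<Longrightarrow> \<psi> \<in> R \<Longrightarrow> \<phi> \<in> R"
proof (elim R_memE)
  fix f g assume *: "near (\<lambda>\<Sigma>. \<phi> \<Sigma> = \<psi> \<Sigma>)" "polyfun f" "polyfun g" "g P \<noteq> 0" "near (\<lambda>\<Sigma>. \<psi> \<Sigma> = f \<Sigma> / g \<Sigma>)"
  show "\<phi> \<in> R" by (rule R_memI[OF *(2-4) near_mono[OF near_conj[OF *(1,5)]]]) simp
qed

lemma R_const: "(\<lambda>\<Sigma>. c) \<in> R"
  by (rule local_ring_polyfun[OF polyfun.const])

lemma R_mult: "\<phi> \<in> R \<Longrightarrow> \<psi> \<in> R \<Longrightarrow> (\<lambda>\<Sigma>. \<phi> \<Sigma> * \<psi> \<Sigma>) \<in> R"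
proof (elim R_memE)
  fix f g f' g' assume *: "polyfun f" "polyfun g" "g P \<noteq> 0" "near (\<lambda>\<Sigma>. \<phi> \<Sigma> = f \<Sigma> / g \<Sigma>)"
    "polyfun f'" "polyfun g'" "g' P \<noteq> 0" "near (\<lambda>\<Sigma>. \<psi> \<Sigma> = f' \<Sigma> / g' \<Sigma>)"
  show "(\<lambda>\<Sigma>. \<phi> \<Sigma> * \<psi> \<Sigma>) \<in> R"
    by (rule R_memI[OF polyfun.mult[OF *(1,5)] polyfun.mult[OF *(2,6)] _ near_mono[OF near_conj[OF *(4,8)]]])
       (simp_all add: *(3,7))
qed

lemma R_add: "\<phi> \<in> R \<Longrightarrow> \<psi> \<in> R \<Longrightarrow> (\<lambda>\<Sigma>. \<phi> \<Sigma> + \<psi> \<Sigma>) \<in> R"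
  by (rule local_ring_add)

lemma R_uminus: "\<phi> \<in> R \<Longrightarrow> (\<lambda>\<Sigma>. - \<phi> \<Sigma>) \<in> R"
  using local_ring_scale[of \<phi> X P "-1"] by simp

lemma R_diff: "\<phi> \<in> R \<Longrightarrow> \<psi> \<in> R \<Longrightarrow> (\<lambda>\<Sigma>. \<phi> \<Sigma> - \<psi> \<Sigma>) \<in> R"
  using R_add[OF _ R_uminus, of \<phi> \<psi>] by simp

lemma R_sum: "(\<And>k. k \<in> K \<Longrightarrow> \<phi> k \<in> R) \<Longrightarrow> (\<lambda>\<Sigma>. \<Sum>k\<in>K. \<phi> k \<Sigma>) \<in> R"
  by (induction K rule: infinite_finite_induct) (simp_all add: R_const R_add)

lemma R_inverse:
  assumes "\<phi> \<in> R" "\<phi> P \<noteq> 0"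
  shows "(\<lambda>\<Sigma>. inverse (\<phi> \<Sigma>)) \<in> R" and "near (\<lambda>\<Sigma>. \<phi> \<Sigma> \<noteq> 0)"
proof -
  obtain f g where *: "polyfun f" "polyfun g" "g P \<noteq> 0" "near (\<lambda>\<Sigma>. \<phi> \<Sigma> = f \<Sigma> / g \<Sigma>)"
    by (rule R_memE[OF assms(1)])
  have fP: "f P \<noteq> 0" using near_at[OF *(4)] assms(2) by auto
  show "(\<lambda>\<Sigma>. inverse (\<phi> \<Sigma>)) \<in> R"
    by (rule R_memI[OF *(2,1) fP near_mono[OF *(4)]]) simp
  show "near (\<lambda>\<Sigma>. \<phi> \<Sigma> \<noteq> 0)"
    by (rule near_mono[OF near_conj[OF *(4) near_conj[OF near_polyfun[OF *(2,3)] near_polyfun[OF *(1) fP]]]]) simp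
qed

lemma R_divide: "\<phi> \<in> R \<Longrightarrow> \<psi> \<in> R \<Longrightarrow> \<psi> P \<noteq> 0 \<Longrightarrow> (\<lambda>\<Sigma>. \<phi> \<Sigma> / \<psi> \<Sigma>) \<in> R"
  unfolding divide_inverse by (intro R_mult R_inverse)

lemma R_power: "\<phi> \<in> R \<Longrightarrow> (\<lambda>\<Sigma>. \<phi> \<Sigma> ^ k) \<in> R"
  by (induction k) (simp_all add: R_const R_mult)

lemma R_poly: "\<phi> \<in> R \<Longrightarrow> (\<lambda>\<Sigma>. poly p (\<phi> \<Sigma>)) \<in> R"
  by (induction p) (simp_all add: R_const R_add R_mult)

lemma I_memE:
  assumes "\<phi> \<in> I"
  obtains A a where "\<phi> \<in> R" "finite A" "A \<subseteq> F" "\<And>f. f \<in> A \<Longrightarrow> a f \<in> R"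
    "near (\<lambda>\<Sigma>. \<phi> \<Sigma> = (\<Sum>f\<in>A. a f \<Sigma> * f \<Sigma>))"
  using assms unfolding local_ideal_def germ_eq_near mem_Collect_eq by (elim conjE exE) (rule that, auto)

lemma I_memI:
  "\<phi> \<in> R \<Longrightarrow> finite A \<Longrightarrow> A \<subseteq> F \<Longrightarrow> (\<And>f. f \<in> A \<Longrightarrow> a f \<in> R) \<Longrightarrow>
    near (\<lambda>\<Sigma>. \<phi> \<Sigma> = (\<Sum>f\<in>A. a f \<Sigma> * f \<Sigma>)) \<Longrightarrow> \<phi> \<in> I"
  unfolding local_ideal_def germ_eq_near mem_Collect_eq by (intro conjI exI[of _ A] exI[of _ a]) auto

lemma I_sub: "\<phi> \<in> I \<Longrightarrow> \<phi> \<in> R" by (elim I_memE)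

lemma I_cong: "near (\<lambda>\<Sigma>. \<phi> \<Sigma> = \<psi> \<Sigma>) \<Longrightarrow> \<psi> \<in> I \<Longrightarrow> \<phi> \<in> I"
proof (elim I_memE)
  fix A a assume *: "near (\<lambda>\<Sigma>. \<phi> \<Sigma> = \<psi> \<Sigma>)" "\<psi> \<in> R" "finite A" "A \<subseteq> F" "\<And>f. f \<in> A \<Longrightarrow> a f \<in> R"
    "near (\<lambda>\<Sigma>. \<psi> \<Sigma> = (\<Sum>f\<in>A. a f \<Sigma> * f \<Sigma>))"
  show "\<phi> \<in> I"
    by (rule I_memI[OF R_cong[OF *(1,2)] *(3,4,5) near_mono[OF near_conj[OF *(1,6)]]]) simp_all
qed

lemma I_mult: "\<rho> \<in> R \<Longrightarrow> \<phi> \<in> I \<Longrightarrow> (\<lambda>\<Sigma>. \<rho> \<Sigma> * \<phi> \<Sigma>) \<in> I"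
proof (elim I_memE)
  fix A a assume *: "\<rho> \<in> R" "\<phi> \<in> R" "finite A" "A \<subseteq> F" "\<And>f. f \<in> A \<Longrightarrow> a f \<in> R"
    "near (\<lambda>\<Sigma>. \<phi> \<Sigma> = (\<Sum>f\<in>A. a f \<Sigma> * f \<Sigma>))"
  show "(\<lambda>\<Sigma>. \<rho> \<Sigma> * \<phi> \<Sigma>) \<in> I"
    by (rule I_memI[OF R_mult[OF *(1,2)] *(3,4) R_mult[OF *(1) *(5)] near_mono[OF *(6)]])
       (simp_all add: sum_distrib_left mult.assoc)
qed

lemma I_zero: "(\<lambda>\<Sigma>. 0) \<in> I" by (rule local_ideal_zero)

lemma I_add: "\<phi> \<in> I \<Longrightarrow> \<psi> \<in> I \<Longrightarrow> (\<lambda>\<Sigma>. \<phi> \<Sigma> + \<psi> \<Sigma>) \<in> I" by (rule local_ideal_add)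

lemma I_uminus: "\<phi> \<in> I \<Longrightarrow> (\<lambda>\<Sigma>. - \<phi> \<Sigma>) \<in> I"
  using local_ideal_scale[of \<phi> X F P "-1"] by simp

lemma I_gen: assumes "f \<in> F" shows "f \<in> I"
proof (rule I_memI[of _ "{f}" "\<lambda>_ _. 1"])
  show "near (\<lambda>\<Sigma>. f \<Sigma> = (\<Sum>f\<in>{f}. 1 * f \<Sigma>))" by (rule near_all) simp
qed (use assms gen_mem R_const in auto)

lemma I_at: assumes "\<phi> \<in> I" shows "\<phi> P = 0"
proof -
  obtain A a where *: "A \<subseteq> F" "near (\<lambda>\<Sigma>. \<phi> \<Sigma> = (\<Sum>f\<in>A. a f \<Sigma> * f \<Sigma>))"
    by (rule I_memE[OF assms]) (rule that)
  have "\<phi> P = (\<Sum>f\<in>A. a f P * f P)" using near_at[OF *(2)] .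
  also have "\<dots> = 0" using *(1) gen_zero by (intro sum.neutral) auto
  finally show ?thesis .
qed

lemma I_cancel:
  assumes "\<phi> \<in> R" "\<psi> \<in> R" "\<psi> P \<noteq> 0" "(\<lambda>\<Sigma>. \<phi> \<Sigma> * \<psi> \<Sigma>) \<in> I"
  shows "\<phi> \<in> I"
  by (rule I_cong[OF near_mono[OF R_inverse(2)[OF assms(2,3)]] I_mult[OF R_inverse(1)[OF assms(2,3)] assms(4)]]) simp

text \<open>
  Germs that are congruent to a constant modulo the ideal. Multiplicity one means that all germs are
  of this kind.
\<close>

definition resid :: "(complex^'n^'n \<Rightarrow> complex) set" where
  "resid = {\<phi> \<in> R. (\<lambda>\<Sigma>. \<phi> \<Sigma> - \<phi> P) \<in> I}"

lemma residD: "\<phi> \<in> resid \<Longrightarrow> \<phi> \<in> R" "\<phi> \<in> resid \<Longrightarrow> (\<lambda>\<Sigma>. \<phi> \<Sigma> - \<phi> P) \<in> I"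
  by (simp_all add: resid_def)

lemma residI: assumes "(\<lambda>\<Sigma>. \<phi> \<Sigma> - c) \<in> I" shows "\<phi> \<in> resid"
proof -
  have "\<phi> \<in> R" using R_add[OF I_sub[OF assms] R_const[of c]] by simp
  moreover have "\<phi> P = c" using I_at[OF assms] by simp
  ultimately show ?thesis using assms by (simp add: resid_def)
qed

lemma resid_cong: assumes "near (\<lambda>\<Sigma>. \<phi> \<Sigma> = \<psi> \<Sigma>)" "\<psi> \<in> resid" shows "\<phi> \<in> resid"
  by (rule residI[of _ "\<psi> P"], rule I_cong[OF near_mono[OF assms(1)] residD(2)[OF assms(2)]]) simp

lemma resid_const: "(\<lambda>\<Sigma>. c) \<in> resid"
  by (rule residI[of _ c]) (simp add: I_zero)

lemma resid_add: assumes "\<phi> \<in> resid" "\<psi> \<in> resid" shows "(\<lambda>\<Sigma>. \<phi> \<Sigma> + \<psi> \<Sigma>) \<in> resid"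
proof (rule residI)
  have "(\<lambda>\<Sigma>. (\<phi> \<Sigma> - \<phi> P) + (\<psi> \<Sigma> - \<psi> P)) \<in> I" by (intro I_add residD assms)
  then show "(\<lambda>\<Sigma>. \<phi> \<Sigma> + \<psi> \<Sigma> - (\<phi> P + \<psi> P)) \<in> I" by (simp add: algebra_simps)
qed

lemma resid_mult: assumes "\<phi> \<in> resid" "\<psi> \<in> resid" shows "(\<lambda>\<Sigma>. \<phi> \<Sigma> * \<psi> \<Sigma>) \<in> resid"
proof (rule residI)
  have "(\<lambda>\<Sigma>. \<psi> \<Sigma> * (\<phi> \<Sigma> - \<phi> P) + \<phi> P * (\<psi> \<Sigma> - \<psi> P)) \<in> I"
    by (intro I_add I_mult R_const residD assms)
  then show "(\<lambda>\<Sigma>. \<phi> \<Sigma> * \<psi> \<Sigma> - \<phi> P * \<psi> P) \<in> I" by (simp add: algebra_simps)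
qed

lemma resid_uminus: "\<phi> \<in> resid \<Longrightarrow> (\<lambda>\<Sigma>. - \<phi> \<Sigma>) \<in> resid"
  using resid_mult[OF resid_const[of "-1"]] by simp

lemma resid_diff: "\<phi> \<in> resid \<Longrightarrow> \<psi> \<in> resid \<Longrightarrow> (\<lambda>\<Sigma>. \<phi> \<Sigma> - \<psi> \<Sigma>) \<in> resid"
  using resid_add[OF _ resid_uminus, of \<phi> \<psi>] by simp

lemma resid_sum: "(\<And>k. k \<in> K \<Longrightarrow> \<phi> k \<in> resid) \<Longrightarrow> (\<lambda>\<Sigma>. \<Sum>k\<in>K. \<phi> k \<Sigma>) \<in> resid"
  by (induction K rule: infinite_finite_induct) (simp_all add: resid_const resid_add)

lemma resid_inverse:
  assumes "\<phi> \<in> resid" "\<phi> P \<noteq> 0" shows "(\<lambda>\<Sigma>. inverse (\<phi> \<Sigma>)) \<in> resid"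
proof (rule residI, rule I_cong)
  show "(\<lambda>\<Sigma>. (inverse (\<phi> \<Sigma>) * - inverse (\<phi> P)) * (\<phi> \<Sigma> - \<phi> P)) \<in> I"
    by (intro I_mult R_mult R_inverse R_const residD assms)
  show "near (\<lambda>\<Sigma>. inverse (\<phi> \<Sigma>) - inverse (\<phi> P) =
      (inverse (\<phi> \<Sigma>) * - inverse (\<phi> P)) * (\<phi> \<Sigma> - \<phi> P))"
    by (rule near_mono[OF R_inverse(2)[OF residD(1)[OF assms(1)] assms(2)]])
       (use assms(2) in \<open>simp add: field_simps\<close>)
qed

lemma resid_divide: "\<phi> \<in> resid \<Longrightarrow> \<psi> \<in> resid \<Longrightarrow> \<psi> P \<noteq> 0 \<Longrightarrow> (\<lambda>\<Sigma>. \<phi> \<Sigma> / \<psi> \<Sigma>) \<in> resid"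
  unfolding divide_inverse by (intro resid_mult resid_inverse)

lemma resid_mpolyfun:
  assumes "mpolyfun f" "\<And>j. s j \<in> resid"
  shows "(\<lambda>\<Sigma>. f (\<lambda>j. s j \<Sigma>)) \<in> resid"
  using assms(1) by induction (simp_all add: assms(2) resid_const resid_add resid_mult)

text \<open>
  A root of a polynomial whose coefficients are constant modulo the ideal is itself constant modulo
  the ideal if it is simple at \<open>P\<close>: after splitting off the root at \<open>P\<close>, the other factor is a unit
  of the local ring.
\<close>

lemma resid_simple_root:
  assumes fam: "poly_family p" "\<And>s. degree (p s) \<le> D"
    and s: "\<And>j. s j \<in> resid" and x: "x \<in> R"
    and root: "near (\<lambda>\<Sigma>. poly (p (\<lambda>j. s j \<Sigma>)) (x \<Sigma>) = 0)"
    and simple: "poly (pderiv (p (\<lambda>j. s j P))) (x P) \<noteq> 0"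
  shows "x \<in> resid"
proof -
  let ?p0 = "p (\<lambda>j. s j P)"
  have expand: "poly (p t) y = (\<Sum>i\<le>D. coeff (p t) i * y ^ i)" for t y
    unfolding poly_altdef using fam(2)[of t]
    by (intro sum.mono_neutral_left) (auto simp: coeff_eq_0)
  have "(\<lambda>\<Sigma>. \<Sum>i\<le>D. x \<Sigma> ^ i * (coeff (p (\<lambda>j. s j \<Sigma>)) i - coeff ?p0 i)) \<in> I"
  proof (intro local_ideal_sum I_mult R_power x)
    fix i
    have "(\<lambda>\<Sigma>. coeff (p (\<lambda>j. s j \<Sigma>)) i) \<in> resid"
      by (rule resid_mpolyfun[OF _ s]) (use fam(1) in \<open>auto simp: poly_family_def\<close>)
    then show "(\<lambda>\<Sigma>. coeff (p (\<lambda>j. s j \<Sigma>)) i - coeff ?p0 i) \<in> I" by (rule residD(2))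
  qed simp
  then have "(\<lambda>\<Sigma>. - (\<Sum>i\<le>D. x \<Sigma> ^ i * (coeff (p (\<lambda>j. s j \<Sigma>)) i - coeff ?p0 i))) \<in> I"
    by (rule I_uminus)
  then have p0: "(\<lambda>\<Sigma>. poly ?p0 (x \<Sigma>)) \<in> I"
    by (rule I_cong[OF near_mono[OF root], rotated])
       (simp add: expand algebra_simps sum_subtractf)
  from I_at[OF p0] obtain g where g: "?p0 = [:- x P, 1:] * g" by (meson dvdE poly_eq_0_iff_dvd)
  have "pderiv ?p0 = [:- x P, 1:] * pderiv g + g * pderiv [:- x P, 1:]"
    unfolding g by (rule pderiv_mult)
  with simple have gP: "poly g (x P) \<noteq> 0" by (auto simp: pderiv_pCons)
  show ?thesis
  proof (rule residI, rule I_cancel[OF R_diff[OF x R_const] R_poly[OF x] gP])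
    show "(\<lambda>\<Sigma>. (x \<Sigma> - x P) * poly g (x \<Sigma>)) \<in> I"
      using p0 unfolding g by (simp add: algebra_simps)
  qed
qed

text \<open>
  The same for $x w^2 - w + s = 0$: subtracting the equation at \<open>P\<close> leaves a multiple of
  \<open>w - w P\<close> whose cofactor at \<open>P\<close> is a square root of the discriminant.
\<close>

lemma resid_quadratic_root:
  assumes "x \<in> resid" "s \<in> resid" "w \<in> R"
    and eq: "near (\<lambda>\<Sigma>. x \<Sigma> * (w \<Sigma>)\<^sup>2 - w \<Sigma> + s \<Sigma> = 0)" and nz: "2 * x P * w P - 1 \<noteq> 0"
  shows "w \<in> resid"
proof -
  have eqP: "x P * (w P)\<^sup>2 - w P + s P = 0" by (rule near_at[OF eq])
  have mem: "(\<lambda>\<Sigma>. (w \<Sigma> - w P) * (x P * (w \<Sigma> + w P) - 1)) \<in> I"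
  proof (rule I_cong)
    show "(\<lambda>\<Sigma>. - ((w \<Sigma>)\<^sup>2 * (x \<Sigma> - x P) + (s \<Sigma> - s P))) \<in> I"
      by (intro I_uminus I_add I_mult R_power residD assms)
    show "near (\<lambda>\<Sigma>. (w \<Sigma> - w P) * (x P * (w \<Sigma> + w P) - 1) = - ((w \<Sigma>)\<^sup>2 * (x \<Sigma> - x P) + (s \<Sigma> - s P)))"
    proof (rule near_mono[OF eq])
      fix \<Sigma> assume "x \<Sigma> * (w \<Sigma>)\<^sup>2 - w \<Sigma> + s \<Sigma> = 0"
      then have s: "s \<Sigma> = w \<Sigma> - x \<Sigma> * (w \<Sigma>)\<^sup>2" by (simp add: algebra_simps)
      have sP: "s P = w P - x P * (w P)\<^sup>2" using eqP by (simp add: algebra_simps)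
      show "(w \<Sigma> - w P) * (x P * (w \<Sigma> + w P) - 1) = - ((w \<Sigma>)\<^sup>2 * (x \<Sigma> - x P) + (s \<Sigma> - s P))"
        unfolding s sP by (simp add: algebra_simps power2_eq_square)
    qed
  qed
  have "(\<lambda>\<Sigma>. x P * (w \<Sigma> + w P) - 1) \<in> R"
    by (intro R_diff R_mult R_add R_const assms(3))
  moreover have "x P * (w P + w P) - 1 \<noteq> 0" using nz by (simp add: mult_2 algebra_simps)
  ultimately have "(\<lambda>\<Sigma>. w \<Sigma> - w P) \<in> I"
    by (intro I_cancel[OF R_diff[OF assms(3) R_const] _ _ mem])
  then show ?thesis by (rule residI)
qed

lemma has_multiplicity_1:
  assumes "\<And>i j. (\<lambda>\<Sigma>. \<Sigma> $ i $ j) \<in> resid"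
  shows "has_multiplicity X F P 1"
proof -
  have poly: "f \<in> resid" if "polyfun f" for f
    using that by induction (simp_all add: assms resid_const resid_add resid_mult)
  have all: "\<phi> \<in> resid" if \<phi>: "\<phi> \<in> R" for \<phi>
  proof -
    obtain f g where *: "polyfun f" "polyfun g" "g P \<noteq> 0" "near (\<lambda>\<Sigma>. \<phi> \<Sigma> = f \<Sigma> / g \<Sigma>)"
      by (rule R_memE[OF \<phi>])
    show ?thesis by (rule resid_cong[OF *(4) resid_divide[OF poly[OF *(1)] poly[OF *(2)] *(3)]])
  qed
  have "\<exists>!c :: nat \<Rightarrow> complex. (\<forall>k\<ge>1. c k = 0) \<and> (\<lambda>\<Sigma>. \<phi> \<Sigma> - (\<Sum>k<1. c k * 1)) \<in> I"
    if \<phi>: "\<phi> \<in> R" for \<phi>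
  proof (rule ex1I)
    show "(\<forall>k\<ge>1::nat. (if k = 0 then \<phi> P else 0) = 0) \<and>
        (\<lambda>\<Sigma>. \<phi> \<Sigma> - (\<Sum>k<1::nat. (if k = 0 then \<phi> P else 0) * 1)) \<in> I"
      using residD(2)[OF all[OF \<phi>]] by simp
    fix c :: "nat \<Rightarrow> complex"
    assume c: "(\<forall>k\<ge>1. c k = 0) \<and> (\<lambda>\<Sigma>. \<phi> \<Sigma> - (\<Sum>k<1. c k * 1)) \<in> I"
    then have "\<phi> P - c 0 = 0" using I_at[of "\<lambda>\<Sigma>. \<phi> \<Sigma> - c 0"] by simp
    with c show "c = (\<lambda>k. if k = 0 then \<phi> P else 0)" by (auto simp: fun_eq_iff)
  qed
  then show ?thesis unfolding has_multiplicity_def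
    by (intro exI[of _ "\<lambda>_ _. 1"]) (simp add: R_const)
qed

end

section \<open>Matrices of a laminar family\<close>

definition block :: "complex^'n^'n \<Rightarrow> 'n::finite set \<Rightarrow> 'n set \<Rightarrow> complex" where
  "block Q A B = (\<Sum>i\<in>A. \<Sum>j\<in>B. Q $ i $ j)"

lemma matrix_inv_unique:
  fixes A B :: "complex^'n::finite^'n"
  assumes "A ** B = mat 1"
  shows "B = matrix_inv A"
proof -
  have "invertible A" using assms matrix_left_right_inverse unfolding invertible_def by blast
  then have "matrix_inv A ** (A ** B) = B"
    by (simp add: matrix_mul_assoc matrix_inv_mult)
  then show ?thesis by (simp add: assms)
qed

lemma invertible_matrix_inv: "invertible A \<Longrightarrow> invertible (matrix_inv A)" for A :: "complex^'n::finite^'n"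
  unfolding invertible_def[of "matrix_inv A"] using matrix_inv_mult by blast

lemma matrix_inv_matrix_inv: "invertible A \<Longrightarrow> matrix_inv (matrix_inv A) = A" for A :: "complex^'n::finite^'n"
  using matrix_inv_unique[of "matrix_inv A" A] matrix_inv_mult(2)[of A] by simp

lemma transpose_matrix_inv:
  fixes A :: "complex^'n::finite^'n"
  assumes "invertible A" "transpose A = A"
  shows "transpose (matrix_inv A) = matrix_inv A"
proof (rule matrix_inv_unique)
  have "transpose (matrix_inv A ** A) = mat 1"
    by (simp add: matrix_inv_mult(2)[OF assms(1)] transpose_mat)
  then show "A ** transpose (matrix_inv A) = mat 1"
    by (simp add: matrix_transpose_mul assms(2))
qed

context laminar
begin

text \<open>
  The clade of the most recent common ancestor.
\<close>

definition join :: "'n \<Rightarrow> 'n \<Rightarrow> 'n set" where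
  "join i j = \<Inter>{A \<in> F. i \<in> A \<and> j \<in> A}"

lemma join_mem: "join i j \<in> F"
proof -
  have "{A \<in> F. i \<in> A \<and> j \<in> A} \<noteq> {}" using UNIV_mem by blast
  from finite_has_minimal[OF finite this] obtain m where m: "m \<in> {A \<in> F. i \<in> A \<and> j \<in> A}"
    "\<And>A. A \<in> {A \<in> F. i \<in> A \<and> j \<in> A} \<Longrightarrow> A \<subseteq> m \<Longrightarrow> m = A" by (elim bexE) (rule that, auto)
  have "m \<subseteq> A" if "A \<in> F" "i \<in> A" "j \<in> A" for A
    using meet_cases[of A m i] m that by blast
  then have "join i j = m" unfolding join_def using m(1) by blast
  with m(1) show ?thesis by simp
qed

lemma join_subset_iff: "A \<in> F \<Longrightarrow> join i j \<subseteq> A \<longleftrightarrow> i \<in> A \<and> j \<in> A"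
  unfolding join_def by auto

lemma join_sym: "join i j = join j i"
  unfolding join_def by (rule arg_cong[of _ _ Inter]) auto

lemma join_exists: assumes "A \<in> F" shows "\<exists>i j. join i j = A"
  using assms
proof (cases rule: mem_cases)
  case (singleton i)
  have "join i i \<subseteq> A" "join i i \<noteq> {}"
    using join_subset_iff[OF assms] mem_nonempty[OF join_mem] by (auto simp: singleton)
  then show ?thesis using singleton by blast
next
  case inner
  obtain i where "i \<in> A" using mem_nonempty[OF assms] by blast
  then obtain c where c: "c \<in> children A" "i \<in> c" using child_covering[OF inner] by blast
  then obtain j where j: "j \<in> A" "j \<notin> c" using childD(2) by blast
  have "join i j \<subseteq> A" using join_subset_iff[OF assms] \<open>i \<in> A\<close> j by blast
  moreover have ij: "i \<in> join i j" "j \<in> join i j" using join_subset_iff[OF join_mem[of i j], of i j] by auto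
  have "join i j \<subseteq> c \<or> A \<subseteq> join i j"
    by (rule above_child[OF assms c(1) join_mem c(2) ij(1)])
  ultimately show ?thesis using j(2) ij(2) by blast
qed

definition lam_space :: "(real^'n^'n) set" where
  "lam_space = {\<Sigma>. \<forall>i j k l. join i j = join k l \<longrightarrow> \<Sigma> $ i $ j = \<Sigma> $ k $ l}"

abbreviation "X \<equiv> complexification lam_space"

lemma X_iff: "\<Sigma> \<in> X \<longleftrightarrow> (\<forall>i j k l. join i j = join k l \<longrightarrow> \<Sigma> $ i $ j = \<Sigma> $ k $ l)"
proof -
  have "\<Sigma> \<in> X \<longleftrightarrow> (\<forall>i j k l. join i j = join k l \<longrightarrow> Re (\<Sigma> $ i $ j) = Re (\<Sigma> $ k $ l)) \<and>
      (\<forall>i j k l. join i j = join k l \<longrightarrow> Im (\<Sigma> $ i $ j) = Im (\<Sigma> $ k $ l))"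
    unfolding complexification_def lam_space_def map_matrix_def by simp
  then show ?thesis unfolding complex_eq_iff by meson
qed

definition pair_of :: "'n set \<Rightarrow> 'n \<times> 'n" where
  "pair_of A = (SOME p. join (fst p) (snd p) = A)"

lemma pair_of: "A \<in> F \<Longrightarrow> join (fst (pair_of A)) (snd (pair_of A)) = A"
  unfolding pair_of_def by (rule someI_ex) (use join_exists in auto)

definition level :: "complex^'n^'n \<Rightarrow> 'n set \<Rightarrow> complex" where
  "level \<Sigma> A = \<Sigma> $ fst (pair_of A) $ snd (pair_of A)"

text \<open>
  The coefficient of the clade \<open>A\<close> in a matrix of the space, obtained by Moebius inversion along the
  chain of clades above \<open>A\<close>. It is a linear form in the matrix entries.
\<close>

definition edge :: "complex^'n^'n \<Rightarrow> 'n set \<Rightarrow> complex" where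
  "edge \<Sigma> A = level \<Sigma> A - (if A = UNIV then 0 else level \<Sigma> (parent A))"

lemma level_join: "\<Sigma> \<in> X \<Longrightarrow> \<Sigma> $ i $ j = level \<Sigma> (join i j)"
  unfolding X_iff level_def using pair_of[OF join_mem[of i j]] by metis

lemma supersets_child:
  assumes "v \<in> F" "c \<in> children v"
  shows "{B \<in> F. c \<subseteq> B} = insert c {B \<in> F. v \<subseteq> B}" "c \<notin> {B \<in> F. v \<subseteq> B}"
proof -
  obtain i where "i \<in> c" using mem_nonempty childD(1)[OF assms(2)] by blast
  then have "B \<subseteq> c \<or> v \<subseteq> B" if "B \<in> F" "c \<subseteq> B" for B using above_child[OF assms that(1)] that by blast
  then show "{B \<in> F. c \<subseteq> B} = insert c {B \<in> F. v \<subseteq> B}" using assms childD[OF assms(2)] by blast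
  show "c \<notin> {B \<in> F. v \<subseteq> B}" using childD[OF assms(2)] by blast
qed

lemma level_sum: "A \<in> F \<Longrightarrow> level \<Sigma> A = (\<Sum>B\<in>{B \<in> F. A \<subseteq> B}. edge \<Sigma> B)"
proof (induction rule: mem_induct_down)
  case UNIV
  have "{B \<in> F. UNIV \<subseteq> B} = {UNIV}" using UNIV_mem by auto
  then show ?case by (simp add: edge_def)
next
  case (child v c)
  have "(\<Sum>B\<in>{B \<in> F. c \<subseteq> B}. edge \<Sigma> B) = edge \<Sigma> c + level \<Sigma> v"
    unfolding supersets_child(1)[OF innerD[OF child.hyps(1)] child.hyps(2)]
    using supersets_child(2)[OF innerD[OF child.hyps(1)] child.hyps(2)] child.IH[OF innerD[OF child.hyps(1)]]
    by (subst sum.insert) auto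
  then show ?case using parent_child[OF innerD[OF child.hyps(1)] child.hyps(2)] by (simp add: edge_def)
qed

definition tree_matrix :: "('n set \<Rightarrow> complex) \<Rightarrow> complex^'n^'n" where
  "tree_matrix \<theta> = (\<chi> i j. \<Sum>B\<in>{B \<in> F. join i j \<subseteq> B}. \<theta> B)"

lemma tree_matrix_edge: "\<Sigma> \<in> X \<Longrightarrow> \<Sigma> = tree_matrix (edge \<Sigma>)"
  by (simp add: tree_matrix_def vec_eq_iff level_join level_sum[OF join_mem])

lemma tree_matrix_in_X: "tree_matrix \<theta> \<in> X"
  by (simp add: X_iff tree_matrix_def)

lemma edge_tree_matrix: assumes "A \<in> F" shows "edge (tree_matrix \<theta>) A = \<theta> A"
proof -
  have lev: "level (tree_matrix \<theta>) A = (\<Sum>B\<in>{B \<in> F. A \<subseteq> B}. \<theta> B)" if "A \<in> F" for A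
    by (simp add: level_def tree_matrix_def pair_of[OF that])
  show ?thesis
  proof (cases "A = UNIV")
    case True
    have "{B \<in> F. UNIV \<subseteq> B} = {UNIV}" using UNIV_mem by auto
    then show ?thesis using lev[OF assms] True by (simp add: edge_def)
  next
    case False
    note p = parent_props[OF assms False]
    show ?thesis using lev[OF assms] lev[OF innerD[OF p(1)]] False
      unfolding supersets_child(1)[OF innerD[OF p(1)] p(2)]
      using supersets_child(2)[OF innerD[OF p(1)] p(2)] by (simp add: edge_def)
  qed
qed

lemma tree_matrix_apply: "(\<Sum>j\<in>UNIV. tree_matrix \<theta> $ i $ j * x j) = volt \<theta> x i"
proof -
  have "(\<Sum>j\<in>UNIV. tree_matrix \<theta> $ i $ j * x j) =
      (\<Sum>j\<in>UNIV. \<Sum>B\<in>{B \<in> F. i \<in> B}. if j \<in> B then \<theta> B * x j else 0)"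
  proof (intro sum.cong refl)
    fix j
    have "tree_matrix \<theta> $ i $ j * x j = (\<Sum>B\<in>{B \<in> F. i \<in> B \<and> j \<in> B}. \<theta> B * x j)"
      unfolding tree_matrix_def sum_distrib_right[symmetric]
      by (simp add: join_subset_iff cong: conj_cong)
    also have "\<dots> = (\<Sum>B\<in>{B \<in> F. i \<in> B}. if j \<in> B then \<theta> B * x j else 0)"
      by (intro sum.mono_neutral_cong_left) auto
    finally show "tree_matrix \<theta> $ i $ j * x j = (\<Sum>B\<in>{B \<in> F. i \<in> B}. if j \<in> B then \<theta> B * x j else 0)" .
  qed
  also have "\<dots> = (\<Sum>B\<in>{B \<in> F. i \<in> B}. \<Sum>j\<in>UNIV. if j \<in> B then \<theta> B * x j else 0)"
    by (rule sum.swap)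
  also have "\<dots> = volt \<theta> x i"
    unfolding volt_def tot_def sum_distrib_left
    by (intro sum.cong refl sum.mono_neutral_cong_right) auto
  finally show ?thesis .
qed

lemma network_of_matrix:
  assumes "\<Sigma> \<in> X" "invertible \<Sigma>"
  shows "network F (edge \<Sigma>) (\<lambda>i j. matrix_inv \<Sigma> $ i $ j)"
proof
  have "\<Sigma> $ j $ i = \<Sigma> $ i $ j" for i j
    using assms(1)[unfolded X_iff, rule_format, OF join_sym] .
  then have "transpose \<Sigma> = \<Sigma>" by (simp add: transpose_def vec_eq_iff)
  then have "transpose (matrix_inv \<Sigma>) = matrix_inv \<Sigma>" by (rule transpose_matrix_inv[OF assms(2)])
  then show "matrix_inv \<Sigma> $ i $ j = matrix_inv \<Sigma> $ j $ i" for i j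
    by (metis (no_types) transpose_def vec_lambda_beta)
  have "volt (edge \<Sigma>) (\<lambda>k. matrix_inv \<Sigma> $ k $ j) i = (\<Sigma> ** matrix_inv \<Sigma>) $ i $ j" for i j
    unfolding tree_matrix_apply[symmetric] tree_matrix_edge[OF assms(1), symmetric]
    by (simp add: matrix_matrix_mult_def)
  then show "volt (edge \<Sigma>) (\<lambda>k. matrix_inv \<Sigma> $ k $ j) i = (if i = j then 1 else 0)" for i j
    by (simp add: matrix_inv_mult(1)[OF assms(2)] mat_def)
qed

lemma trace_mult_X:
  assumes "E \<in> X"
  shows "trace (Q ** E) = (\<Sum>B\<in>F. edge E B * block Q B B)"
proof -
  have "trace (Q ** E) = (\<Sum>i\<in>UNIV. \<Sum>k\<in>UNIV. E $ i $ k * Q $ k $ i)"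
    by (subst sum.swap) (simp add: trace_def matrix_matrix_mult_def mult.commute)
  also have "\<dots> = (\<Sum>i\<in>UNIV. volt (edge E) (\<lambda>k. Q $ k $ i) i)"
    by (subst (1) tree_matrix_edge[OF assms]) (simp add: tree_matrix_apply)
  also have "\<dots> = (\<Sum>i\<in>UNIV. \<Sum>B\<in>F. if i \<in> B then edge E B * (\<Sum>k\<in>B. Q $ k $ i) else 0)"
    unfolding volt_def tot_def by (intro sum.cong refl sum.mono_neutral_cong_left) auto
  also have "\<dots> = (\<Sum>B\<in>F. \<Sum>i\<in>UNIV. if i \<in> B then edge E B * (\<Sum>k\<in>B. Q $ k $ i) else 0)"
    by (rule sum.swap)
  also have "\<dots> = (\<Sum>B\<in>F. edge E B * block Q B B)"
  proof (intro sum.cong refl)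
    fix B
    have "(\<Sum>i\<in>UNIV. if i \<in> B then edge E B * (\<Sum>k\<in>B. Q $ k $ i) else 0) = (\<Sum>i\<in>B. edge E B * (\<Sum>k\<in>B. Q $ k $ i))"
      by (intro sum.mono_neutral_cong_right) auto
    also have "\<dots> = edge E B * block Q B B"
      unfolding block_def by (subst sum.swap) (simp add: sum_distrib_left)
    finally show "(\<Sum>i\<in>UNIV. if i \<in> B then edge E B * (\<Sum>k\<in>B. Q $ k $ i) else 0) = edge E B * block Q B B" .
  qed
  finally show ?thesis .
qed

definition clade :: "'n set \<Rightarrow> real^'n^'n" where
  "clade A = (\<chi> i j. if i \<in> A \<and> j \<in> A then 1 else 0)"

lemma clade_mem: assumes "A \<in> F" shows "clade A \<in> lam_space"
  unfolding lam_space_def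
proof (intro CollectI allI impI)
  fix i j k l assume "join i j = join k l"
  then have "(i \<in> A \<and> j \<in> A) = (k \<in> A \<and> l \<in> A)" by (metis join_subset_iff[OF assms])
  then show "clade A $ i $ j = clade A $ k $ l" unfolding clade_def vec_lambda_beta by (rule if_cong) auto
qed

lemma trace_clade: "trace (Q ** map_matrix complex_of_real (clade A)) = block Q A A"
proof -
  have "trace (Q ** map_matrix complex_of_real (clade A)) =
      (\<Sum>i\<in>UNIV. \<Sum>k\<in>UNIV. if i \<in> A \<and> k \<in> A then Q $ i $ k else 0)"
    unfolding trace_def matrix_matrix_mult_def map_matrix_def clade_def
    by (auto intro!: sum.cong)
  also have "\<dots> = (\<Sum>i\<in>A. \<Sum>k\<in>UNIV. if i \<in> A \<and> k \<in> A then Q $ i $ k else 0)"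
    by (intro sum.mono_neutral_right) auto
  also have "\<dots> = block Q A A" unfolding block_def
    by (intro sum.cong refl sum.mono_neutral_cong_right) auto
  finally show ?thesis .
qed

text \<open>
  The matrices \<open>clade A\<close> span the space, so it suffices to test the critical equations on them.
\<close>

lemma critical_iff:
  "(\<forall>f\<in>critical_equations lam_space S. f \<Sigma> = 0) \<longleftrightarrow>
    (\<forall>A\<in>F. block (matrix_inv \<Sigma>) A A = block (matrix_inv S) A A)"
proof
  assume *: "\<forall>f\<in>critical_equations lam_space S. f \<Sigma> = 0"
  show "\<forall>A\<in>F. block (matrix_inv \<Sigma>) A A = block (matrix_inv S) A A"
  proof
    fix A assume "A \<in> F"
    with * clade_mem show "block (matrix_inv \<Sigma>) A A = block (matrix_inv S) A A"
      unfolding critical_equations_def by (auto simp: trace_clade dest!: bspec)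
  qed
next
  assume *: "\<forall>A\<in>F. block (matrix_inv \<Sigma>) A A = block (matrix_inv S) A A"
  show "\<forall>f\<in>critical_equations lam_space S. f \<Sigma> = 0"
    unfolding critical_equations_def
  proof (intro ballI, elim imageE)
    fix f E assume f: "f = (\<lambda>\<Sigma>. trace (matrix_inv \<Sigma> ** map_matrix complex_of_real E) -
        trace (matrix_inv S ** map_matrix complex_of_real E))" and E: "E \<in> lam_space"
    have "map_matrix complex_of_real E $ i $ j = map_matrix complex_of_real E $ k $ l"
      if "join i j = join k l" for i j k l
      using E[unfolded lam_space_def mem_Collect_eq, rule_format, OF that] by (simp add: map_matrix_def)
    then have "map_matrix complex_of_real E \<in> X" unfolding X_iff by blast
    from trace_mult_X[OF this] * show "f \<Sigma> = 0" unfolding f by simp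
  qed
qed

text \<open>
  The next definitions express the coordinates of the decoupled system as rational functions of \<open>\<Sigma>\<close>:
  conductances, their sums over the children of a vertex, the common value \<open>z\<close> of the equations at a
  vertex, and the corresponding roots of discriminants.
\<close>

definition gain_of :: "complex^'n^'n \<Rightarrow> 'n set \<Rightarrow> complex" where
  "gain_of \<Sigma> v = (\<Sum>A\<in>{A \<in> F. v \<subseteq> A}. edge \<Sigma> A * block (matrix_inv \<Sigma>) A v)"

definition cond :: "complex^'n^'n \<Rightarrow> 'n set \<Rightarrow> complex" where
  "cond \<Sigma> c = (if c = UNIV then block (matrix_inv \<Sigma>) UNIV UNIV
     else block (matrix_inv \<Sigma>) c (parent c) / (1 - gain_of \<Sigma> (parent c)))"

definition cond_sum :: "complex^'n^'n \<Rightarrow> 'n set \<Rightarrow> complex" where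
  "cond_sum \<Sigma> v = (\<Sum>c\<in>children v. cond \<Sigma> c)"

definition mult_at :: "complex^'n^'n \<Rightarrow> 'n set \<Rightarrow> complex" where
  "mult_at \<Sigma> v = 1 / cond_sum \<Sigma> v - block (matrix_inv \<Sigma>) v v / (cond_sum \<Sigma> v)\<^sup>2"

definition node_roots :: "complex^'n^'n \<Rightarrow> 'n set \<Rightarrow> 'n set \<Rightarrow> complex" where
  "node_roots \<Sigma> v j = (if j = v then 1 - 2 * mult_at \<Sigma> v * cond_sum \<Sigma> v
     else 2 * mult_at \<Sigma> v * cond \<Sigma> j - 1)"

lemma network_simps:
  assumes "\<Sigma> \<in> X" "invertible \<Sigma>"
  shows "network.bil (\<lambda>i j. matrix_inv \<Sigma> $ i $ j) = block (matrix_inv \<Sigma>)"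
    and "network.gain F (edge \<Sigma>) (\<lambda>i j. matrix_inv \<Sigma> $ i $ j) = gain_of \<Sigma>"
proof -
  interpret network F "edge \<Sigma>" "\<lambda>i j. matrix_inv \<Sigma> $ i $ j" by (rule network_of_matrix[OF assms])
  show *: "bil = block (matrix_inv \<Sigma>)" by (simp add: bil_def block_def fun_eq_iff)
  show "gain = gain_of \<Sigma>"
    by (simp add: gain_def gain_of_def above_def tot_curr * fun_eq_iff)
qed

lemma cond_response:
  assumes \<Sigma>: "\<Sigma> \<in> X" "invertible \<Sigma>" and g: "\<And>v. v \<in> inner \<Longrightarrow> gain_of \<Sigma> v \<noteq> 1" and c: "c \<in> F"
  shows "\<exists>y. unit_response (edge \<Sigma>) c (cond \<Sigma> c) y"
proof -
  interpret network F "edge \<Sigma>" "\<lambda>i j. matrix_inv \<Sigma> $ i $ j" by (rule network_of_matrix[OF \<Sigma>])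
  note simps = network_simps[OF \<Sigma>]
  show ?thesis
  proof (cases "c = UNIV")
    case True
    then show ?thesis using unit_response_UNIV by (auto simp: cond_def simps)
  next
    case False
    note p = parent_props[OF c False]
    from unit_response_curr[OF p(1,2)] g[OF p(1)] False show ?thesis
      by (auto simp: cond_def simps)
  qed
qed

text \<open>
  These identities hold wherever the denominators do not vanish, whether or not \<open>\<Sigma>\<close> is critical, so
  they can be used as identities of germs.
\<close>

lemma cond_equations:
  assumes \<Sigma>: "\<Sigma> \<in> X" "invertible \<Sigma>" and g: "\<And>v. v \<in> inner \<Longrightarrow> gain_of \<Sigma> v \<noteq> 1"
  shows "v \<in> inner \<Longrightarrow> block (matrix_inv \<Sigma>) v v = (1 - gain_of \<Sigma> v) * cond_sum \<Sigma> v"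
    and "v \<in> inner \<Longrightarrow> c \<in> children v \<Longrightarrow> cond_sum \<Sigma> v \<noteq> 0 \<Longrightarrow>
      block (matrix_inv \<Sigma>) c c = cond \<Sigma> c - (cond \<Sigma> c)\<^sup>2 * mult_at \<Sigma> v"
    and "v \<in> inner \<Longrightarrow> cond \<Sigma> v \<noteq> 0 \<Longrightarrow> cond_sum \<Sigma> v \<noteq> 0 \<Longrightarrow> edge \<Sigma> v = 1 / cond \<Sigma> v - 1 / cond_sum \<Sigma> v"
    and "edge \<Sigma> {i} = 1 / cond \<Sigma> {i}"
proof -
  interpret network F "edge \<Sigma>" "\<lambda>i j. matrix_inv \<Sigma> $ i $ j" by (rule network_of_matrix[OF \<Sigma>])
  note simps = network_simps[OF \<Sigma>]
  obtain Y where Y: "\<And>c. c \<in> F \<Longrightarrow> unit_response (edge \<Sigma>) c (cond \<Sigma> c) (Y c)"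
    using cond_response[OF \<Sigma> g] by metis
  show "block (matrix_inv \<Sigma>) v v = (1 - gain_of \<Sigma> v) * cond_sum \<Sigma> v" if "v \<in> inner"
    using node_currents(2)[OF that Y[OF childD(1)]] by (simp add: simps cond_sum_def)
  show "block (matrix_inv \<Sigma>) c c = cond \<Sigma> c - (cond \<Sigma> c)\<^sup>2 * mult_at \<Sigma> v"
    if "v \<in> inner" "c \<in> children v" "cond_sum \<Sigma> v \<noteq> 0"
    using node_equation[OF that(1,2) Y[OF childD(1)] cond_sum_def that(3)] by (simp add: simps mult_at_def)
  show "edge \<Sigma> v = 1 / cond \<Sigma> v - 1 / cond_sum \<Sigma> v" if "v \<in> inner" "cond \<Sigma> v \<noteq> 0" "cond_sum \<Sigma> v \<noteq> 0"
  proof -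
    have "cond \<Sigma> v = (1 - edge \<Sigma> v * cond \<Sigma> v) * cond_sum \<Sigma> v"
      using unit_response_inner[OF that(1) Y[OF innerD[OF that(1)]] Y[OF childD(1)]]
      by (simp add: cond_sum_def)
    then show ?thesis using that(2,3) by (simp add: field_simps)
  qed
  show "edge \<Sigma> {i} = 1 / cond \<Sigma> {i}"
  proof -
    have 1: "edge \<Sigma> {i} * cond \<Sigma> {i} = 1"
      using unit_response_singleton[OF Y[OF singleton_mem]] .
    then have "cond \<Sigma> {i} \<noteq> 0" by auto
    with 1 show ?thesis by (simp add: field_simps)
  qed
qed

text \<open>
  A vertex together with its children: the clades whose statistics occur in the system at that
  vertex.
\<close>

definition star :: "'n set \<Rightarrow> 'n set set" where
  "star v = insert v (children v)"

lemma card_star: "card (star v) = card (children v) + 1"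
  unfolding star_def using childD(2)[of v v] by (subst card_insert_disjoint) auto

lemma sum_star: "(\<Sum>j\<in>star v. f j) = f v + (\<Sum>c\<in>children v. f c)" for f :: "'n set \<Rightarrow> complex"
  unfolding star_def using childD(2)[of v v] by (subst sum.insert) auto

lemma star_sub: "v \<in> inner \<Longrightarrow> star v \<subseteq> F"
  using innerD childD by (auto simp: star_def)

lemma node_roots_solution:
  assumes v: "v \<in> inner" and u: "cond_sum \<Sigma> v \<noteq> 0"
    and t: "\<And>j. j \<in> star v \<Longrightarrow> t j = block (matrix_inv \<Sigma>) j j"
    and eq: "\<And>c. c \<in> children v \<Longrightarrow> t c = cond \<Sigma> c - (cond \<Sigma> c)\<^sup>2 * mult_at \<Sigma> v"
  shows "local_solution (star v) t (mult_at \<Sigma> v) (node_roots \<Sigma> v)"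
  unfolding local_solution_def
proof (intro conjI ballI)
  let ?l = "mult_at \<Sigma> v" and ?u = "cond_sum \<Sigma> v"
  have ne: "c \<noteq> v" if "c \<in> children v" for c using childD(2)[OF that] by blast
  have "?l * ?u\<^sup>2 = ?u - t v"
    using u t[of v] by (simp add: mult_at_def star_def field_simps power2_eq_square)
  then have tv: "t v = ?u - ?l * ?u\<^sup>2" by simp
  fix j assume "j \<in> star v"
  then consider "j = v" | "j \<in> children v" by (auto simp: star_def)
  then show "(node_roots \<Sigma> v j)\<^sup>2 = 1 - 4 * ?l * t j"
  proof cases
    case 1
    then show ?thesis unfolding 1 tv by (simp add: node_roots_def power2_eq_square algebra_simps)
  next
    case 2
    then show ?thesis using ne[OF 2] unfolding eq[OF 2]
      by (simp add: node_roots_def power2_eq_square algebra_simps)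
  qed
next
  have ne: "c \<noteq> v" if "c \<in> children v" for c using childD(2)[OF that] by blast
  have "(\<Sum>c\<in>children v. node_roots \<Sigma> v c) = (\<Sum>c\<in>children v. 2 * mult_at \<Sigma> v * cond \<Sigma> c - 1)"
    using ne by (intro sum.cong) (auto simp: node_roots_def)
  also have "\<dots> = 2 * mult_at \<Sigma> v * cond_sum \<Sigma> v - of_nat (card (children v))"
    by (simp add: sum_subtractf cond_sum_def sum_distrib_left)
  finally show "of_nat (card (star v)) - 2 + (\<Sum>j\<in>star v. node_roots \<Sigma> v j) = 0"
    unfolding sum_star card_star by (simp add: node_roots_def)
qed

end

section \<open>Critical points with generic statistics\<close>

text \<open>
  The values \<open>s\<close> of the statistics are generic in the sense of \<open>local_solution_count\<close> at every
  internal vertex. Outside \<open>F\<close> the function \<open>s\<close> has arbitrary values, fixed by \<open>\<kappa>\<close>; this makes it a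
  point of the full parameter space, on which the exceptional polynomials are defined.
\<close>

locale generic_target = laminar F for F :: "'n::finite set set" +
  fixes \<kappa> s :: "'n set \<Rightarrow> complex" and p :: "'n set \<Rightarrow> ('n set \<Rightarrow> complex) \<Rightarrow> complex poly"
    and D :: "'n set \<Rightarrow> nat"
  assumes family: "v \<in> inner \<Longrightarrow> poly_family (p v)" "v \<in> inner \<Longrightarrow> degree (p v t) \<le> D v"
    and solution_root: "v \<in> inner \<Longrightarrow> z \<noteq> 0 \<Longrightarrow> local_solution (star v) t z r \<Longrightarrow> poly (p v t) z = 0"
    and finite_roots: "v \<in> inner \<Longrightarrow> finite {z. poly (p v s) z = 0}"
    and card_roots: "v \<in> inner \<Longrightarrow> card {z. poly (p v s) z = 0} = 2 ^ card (children v) - card (children v) - 1"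
    and root_nonzero: "v \<in> inner \<Longrightarrow> poly (p v s) z = 0 \<Longrightarrow> z \<noteq> 0"
    and root_simple: "v \<in> inner \<Longrightarrow> poly (p v s) z = 0 \<Longrightarrow> poly (pderiv (p v s)) z \<noteq> 0"
    and root_solution: "v \<in> inner \<Longrightarrow> poly (p v s) z = 0 \<Longrightarrow> \<exists>r. local_solution (star v) s z r"
    and solution_unique: "v \<in> inner \<Longrightarrow> poly (p v s) z = 0 \<Longrightarrow> local_solution (star v) s z r \<Longrightarrow>
      local_solution (star v) s z r' \<Longrightarrow> j \<in> star v \<Longrightarrow> r j \<noteq> 0 \<and> r' j = r j"
    and s_nonzero: "A \<in> F \<Longrightarrow> s A \<noteq> 0"
    and s_unbalanced: "v \<in> inner \<Longrightarrow> i \<in> star v \<Longrightarrow> s i \<noteq> (\<Sum>j\<in>star v - {i}. s j)"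
    and s_outside: "A \<notin> F \<Longrightarrow> s A = \<kappa> A"
begin

definition stat :: "complex^'n^'n \<Rightarrow> 'n set \<Rightarrow> complex" where
  "stat \<Sigma> A = (if A \<in> F then block (matrix_inv \<Sigma>) A A else \<kappa> A)"

definition crit :: "(complex^'n^'n) set" where
  "crit = {\<Sigma> \<in> X. invertible \<Sigma> \<and> (\<forall>A\<in>F. block (matrix_inv \<Sigma>) A A = s A)}"

lemma critD: assumes "\<Sigma> \<in> crit"
  shows "\<Sigma> \<in> X" "invertible \<Sigma>" "A \<in> F \<Longrightarrow> block (matrix_inv \<Sigma>) A A = s A" "stat \<Sigma> = s"
  using assms s_outside by (auto simp: crit_def stat_def fun_eq_iff)

lemma unbalanced_child:
  assumes "v \<in> inner" "c \<in> children v"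
  shows "s c \<noteq> s v + (\<Sum>c'\<in>children v - {c}. s c')"
proof -
  have "v \<notin> children v" "c \<noteq> v" using childD(2)[of _ v] assms(2) by blast+
  then have "star v - {c} = insert v (children v - {c})" by (auto simp: star_def)
  then have "(\<Sum>j\<in>star v - {c}. s j) = s v + (\<Sum>c'\<in>children v - {c}. s c')"
    using \<open>v \<notin> children v\<close> by simp
  then show ?thesis using s_unbalanced[OF assms(1), of c] assms(2) by (auto simp: star_def)
qed

lemma unbalanced_node:
  assumes "v \<in> inner" shows "s v \<noteq> (\<Sum>c\<in>children v. s c)"
proof -
  have "v \<notin> children v" using childD(2)[of _ v] by blast
  then have "star v - {v} = children v" by (auto simp: star_def)
  then show ?thesis using s_unbalanced[OF assms, of v] by (simp add: star_def)
qed

context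
  fixes \<Sigma> assumes \<Sigma>: "\<Sigma> \<in> crit"
begin

text \<open>
  At a critical point the coordinates of the decoupled system exist, because the relation that
  \<open>gain_neq_1\<close> excludes is a relation between the statistics.
\<close>

lemma crit_gain: assumes "v \<in> inner" shows "gain_of \<Sigma> v \<noteq> 1"
proof -
  note C = critD[OF \<Sigma>]
  interpret network F "edge \<Sigma>" "\<lambda>i j. matrix_inv \<Sigma> $ i $ j" by (rule network_of_matrix[OF C(1,2)])
  note simps = network_simps[OF C(1,2)]
  have kids: "(\<Sum>c'\<in>children v - {c}. block (matrix_inv \<Sigma>) c' c') = (\<Sum>c'\<in>children v - {c}. s c')" for c
    using C(3) childD(1) by (intro sum.cong) auto
  show ?thesis
    using gain_neq_1[OF assms] C(3)[OF innerD[OF assms]] s_nonzero[OF innerD[OF assms]]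
      C(3)[OF childD(1)] unbalanced_child[OF assms]
    by (simp add: simps kids)
qed

lemma crit_cond_sum: assumes "v \<in> inner" shows "cond_sum \<Sigma> v \<noteq> 0"
  using cond_equations(1)[OF critD(1,2)[OF \<Sigma>] crit_gain assms] critD(3)[OF \<Sigma> innerD[OF assms]]
    s_nonzero[OF innerD[OF assms]] by auto

lemma crit_node:
  assumes "v \<in> inner" "c \<in> children v"
  shows "s c = cond \<Sigma> c - (cond \<Sigma> c)\<^sup>2 * mult_at \<Sigma> v"
  using cond_equations(2)[OF critD(1,2)[OF \<Sigma>] crit_gain assms crit_cond_sum[OF assms(1)]]
    critD(3)[OF \<Sigma> childD(1)[OF assms(2)]] by simp

lemma crit_cond_UNIV: "cond \<Sigma> UNIV = s UNIV"
  using critD(3)[OF \<Sigma> UNIV_mem] by (simp add: cond_def)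

lemma crit_cond: assumes "A \<in> F" shows "cond \<Sigma> A \<noteq> 0"
proof (cases "A = UNIV")
  case True
  then show ?thesis using crit_cond_UNIV s_nonzero[OF assms] by simp
next
  case False
  note par = parent_props[OF assms False]
  show ?thesis using crit_node[OF par(1,2)] s_nonzero[OF assms] by auto
qed

lemma crit_edge:
  "v \<in> inner \<Longrightarrow> edge \<Sigma> v = 1 / cond \<Sigma> v - 1 / cond_sum \<Sigma> v" "edge \<Sigma> {i} = 1 / cond \<Sigma> {i}"
  using cond_equations(3,4)[OF critD(1,2)[OF \<Sigma>] crit_gain] crit_cond[OF innerD] crit_cond_sum by auto

lemma crit_solution:
  assumes v: "v \<in> inner"
  shows "local_solution (star v) s (mult_at \<Sigma> v) (node_roots \<Sigma> v)"
proof (rule node_roots_solution[OF v crit_cond_sum[OF v]])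
  show "s j = block (matrix_inv \<Sigma>) j j" if "j \<in> star v" for j
    using critD(3)[OF \<Sigma>, of j] star_sub[OF v] that by auto
qed (rule crit_node[OF v])

lemma crit_mult_nonzero:
  assumes v: "v \<in> inner" shows "mult_at \<Sigma> v \<noteq> 0"
proof
  assume 0: "mult_at \<Sigma> v = 0"
  then have "cond_sum \<Sigma> v = s v"
    using crit_cond_sum[OF v] critD(3)[OF \<Sigma> innerD[OF v]]
    by (simp add: mult_at_def field_simps power2_eq_square)
  moreover have "cond_sum \<Sigma> v = (\<Sum>c\<in>children v. s c)"
    using crit_node[OF v] by (simp add: cond_sum_def 0)
  ultimately show False using unbalanced_node[OF v] by simp
qed

lemma crit_root: assumes "v \<in> inner" shows "poly (p v s) (mult_at \<Sigma> v) = 0"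
  by (rule solution_root[OF assms crit_mult_nonzero[OF assms] crit_solution[OF assms]])

end

text \<open>
  The values \<open>z\<close> at the internal vertices determine the roots, these the conductances, and these the
  resistances.
\<close>

lemma crit_inj:
  assumes C: "\<Sigma> \<in> crit" "\<Sigma>' \<in> crit" and eq: "\<And>v. v \<in> inner \<Longrightarrow> mult_at \<Sigma> v = mult_at \<Sigma>' v"
  shows "\<Sigma> = \<Sigma>'"
proof -
  have cond: "cond \<Sigma> A = cond \<Sigma>' A" if A: "A \<in> F" for A
  proof (cases "A = UNIV")
    case True
    then show ?thesis using crit_cond_UNIV C by simp
  next
    case False
    note par = parent_props[OF A False]
    let ?v = "parent A"
    have "A \<in> star ?v" "A \<noteq> ?v" using par(2) childD(2) by (auto simp: star_def)
    have "node_roots \<Sigma>' ?v A = node_roots \<Sigma> ?v A"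
      using solution_unique[OF par(1) crit_root[OF C(1) par(1)] crit_solution[OF C(1) par(1)]]
        crit_solution[OF C(2) par(1)] eq[OF par(1)] \<open>A \<in> star ?v\<close> by auto
    then show ?thesis
      using \<open>A \<noteq> ?v\<close> eq[OF par(1)] crit_mult_nonzero[OF C(1) par(1)] by (simp add: node_roots_def)
  qed
  have sums: "cond_sum \<Sigma> v = cond_sum \<Sigma>' v" if "v \<in> inner" for v
    unfolding cond_sum_def using cond childD(1) by (intro sum.cong) auto
  have "edge \<Sigma> A = edge \<Sigma>' A" if "A \<in> F" for A
    using that
  proof (cases rule: mem_cases)
    case (singleton i)
    then show ?thesis using crit_edge(2)[OF C(1)] crit_edge(2)[OF C(2)] cond[OF that] by simp
  next
    case inner
    then show ?thesis
      using crit_edge(1)[OF C(1)] crit_edge(1)[OF C(2)] cond[OF that] sums by simp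
  qed
  then have "tree_matrix (edge \<Sigma>) = tree_matrix (edge \<Sigma>')"
    by (simp add: tree_matrix_def)
  then show ?thesis using tree_matrix_edge critD(1) C by metis
qed

text \<open>
  Conversely, arbitrary local solutions can be combined: they prescribe all conductances, hence all
  resistances, and the node equations yield the statistics from the root downwards.
\<close>

lemma crit_surj:
  assumes l: "\<And>v. v \<in> inner \<Longrightarrow> poly (p v s) (l v) = 0"
  shows "\<exists>\<Sigma>\<in>crit. \<forall>v\<in>inner. mult_at \<Sigma> v = l v"
proof -
  have l0: "l v \<noteq> 0" if "v \<in> inner" for v using root_nonzero[OF that l[OF that]] .
  obtain r where r: "\<And>v. v \<in> inner \<Longrightarrow> local_solution (star v) s (l v) (r v)"
    using root_solution[OF _ l] by metis
  have r2: "r v j ^ 2 = 1 - 4 * l v * s j" if "v \<in> inner" "j \<in> star v" for v j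
    using r[OF that(1)] that(2) by (simp add: local_solution_def)
  define w where "w c = (if c = UNIV then s UNIV else (1 + r (parent c) c) / (2 * l (parent c)))" for c
  define u where "u v = (1 - r v v) / (2 * l v)" for v
  have w_child: "w c = (1 + r v c) / (2 * l v)" if "v \<in> inner" "c \<in> children v" for v c
    using parent_child[OF innerD[OF that(1)] that(2)] by (simp add: w_def)
  have sum_w: "(\<Sum>c\<in>children v. w c) = u v" if v: "v \<in> inner" for v
  proof -
    have "of_nat (card (children v)) + (\<Sum>c\<in>children v. r v c) = 1 - r v v"
      using r[OF v] unfolding local_solution_def sum_star card_star by (simp add: algebra_simps eq_neg_iff_add_eq_0)
    moreover have "(\<Sum>c\<in>children v. w c) = (\<Sum>c\<in>children v. (1 + r v c) / (2 * l v))"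
      using w_child[OF v] by simp
    ultimately show ?thesis
      by (simp add: u_def sum.distrib flip: sum_divide_distrib)
  qed
  have w_eq: "s c = w c - (w c)\<^sup>2 * l v" if v: "v \<in> inner" and c: "c \<in> children v" for v c
  proof -
    have "4 * l v * (w c - (w c)\<^sup>2 * l v) = 1 - r v c ^ 2"
      unfolding w_child[OF v c] using l0[OF v] by (simp add: field_simps power2_eq_square)
    also have "\<dots> = 4 * l v * s c" using r2[OF v, of c] c by (simp add: star_def)
    finally show ?thesis using l0[OF v] by simp
  qed
  have u_eq: "s v = u v - (u v)\<^sup>2 * l v" if v: "v \<in> inner" for v
  proof -
    have "4 * l v * (u v - (u v)\<^sup>2 * l v) = 1 - r v v ^ 2"
      unfolding u_def using l0[OF v] by (simp add: field_simps power2_eq_square)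
    also have "\<dots> = 4 * l v * s v" using r2[OF v, of v] by (simp add: star_def)
    finally show ?thesis using l0[OF v] by simp
  qed
  have u0: "u v \<noteq> 0" if "v \<in> inner" for v
    using u_eq[OF that] s_nonzero[OF innerD[OF that]] by auto
  have l_eq: "l v = 1 / u v - s v / (u v)\<^sup>2" if "v \<in> inner" for v
    using u_eq[OF that] u0[OF that] by (simp add: field_simps power2_eq_square)
  have w0: "w A \<noteq> 0" if A: "A \<in> F" for A
  proof (cases "A = UNIV")
    case True
    then show ?thesis using s_nonzero[OF A] by (simp add: w_def)
  next
    case False
    show ?thesis using w_eq[OF parent_props(1,2)[OF A False]] s_nonzero[OF A] by auto
  qed
  define \<theta> where "\<theta> A = (if A \<in> inner then 1 / w A - 1 / u A else 1 / w A)" for A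
  define \<Sigma> where "\<Sigma> = tree_matrix \<theta>"
  have X: "\<Sigma> \<in> X" by (simp add: \<Sigma>_def tree_matrix_in_X)
  have edge: "edge \<Sigma> A = \<theta> A" if "A \<in> F" for A using that by (simp add: \<Sigma>_def edge_tree_matrix)
  have resp: "\<exists>y. unit_response (edge \<Sigma>) A (w A) y" if "A \<in> F" for A
  proof (rule unit_response_exists[OF w0 _ _ _ that])
    show "(\<Sum>c\<in>children v. w c) \<noteq> 0" if "v \<in> inner" for v using sum_w u0 that by simp
    show "edge \<Sigma> v = 1 / w v - 1 / (\<Sum>c\<in>children v. w c)" if "v \<in> inner" for v
      using that edge[OF innerD[OF that]] sum_w by (simp add: \<theta>_def)
    show "edge \<Sigma> {i} = 1 / w {i}" for i
      using edge[OF singleton_mem] by (simp add: \<theta>_def inner_def)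
  qed
  then obtain Y where Y: "\<And>A. A \<in> F \<Longrightarrow> unit_response (edge \<Sigma>) A (w A) (Y A)" by metis
  have inv: "invertible \<Sigma>"
  proof -
    have "x = 0" if x: "\<Sigma> *v x = 0" for x
    proof -
      have "volt (edge \<Sigma>) (\<lambda>j. x $ j) i = (\<Sigma> *v x) $ i" for i
        unfolding tree_matrix_apply[symmetric] tree_matrix_edge[OF X, symmetric]
        by (simp add: matrix_vector_mult_def)
      then have "volt (edge \<Sigma>) (\<lambda>j. x $ j) i = 0" for i using x by simp
      from volt_injective[OF resp this] show ?thesis by (simp add: vec_eq_iff)
    qed
    then have "\<exists>B. B ** \<Sigma> = mat 1" using matrix_left_invertible_ker by blast
    then show ?thesis using invertible_left_inverse by blast
  qed
  interpret network F "edge \<Sigma>" "\<lambda>i j. matrix_inv \<Sigma> $ i $ j" by (rule network_of_matrix[OF X inv])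
  note simps = network_simps[OF X inv]
  have st: "block (matrix_inv \<Sigma>) A A = s A" if "A \<in> F" for A
    using that
  proof (induction rule: mem_induct_down)
    case UNIV
    have "tot (curr UNIV) UNIV = 1 * w UNIV"
      by (rule unit_responseD[OF Y[OF UNIV_mem]]) (simp add: volt_UNIV[symmetric] volt_curr)
    then show ?case by (simp add: tot_curr simps w_def)
  next
    case (child v c)
    have "block (matrix_inv \<Sigma>) v v = s v" by (rule child.IH[OF innerD[OF child.hyps(1)] order_refl])
    moreover have "block (matrix_inv \<Sigma>) c c = w c - (w c)\<^sup>2 * (1 / u v - block (matrix_inv \<Sigma>) v v / (u v)\<^sup>2)"
      using node_equation[OF child.hyps Y[OF childD(1)] sum_w[OF child.hyps(1), symmetric] u0[OF child.hyps(1)]]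
      by (simp add: simps)
    ultimately show ?case using w_eq[OF child.hyps] l_eq[OF child.hyps(1)] by simp
  qed
  have crit: "\<Sigma> \<in> crit" using X inv st by (simp add: crit_def)
  have "cond \<Sigma> c = w c" if "v \<in> inner" "c \<in> children v" for v c
  proof -
    have "block (matrix_inv \<Sigma>) c v = (1 - gain_of \<Sigma> v) * w c"
      using node_currents(1)[OF that(1) Y[OF childD(1)] that(2)] by (simp add: simps)
    then show ?thesis
      using crit_gain[OF crit that(1)] parent_child[OF innerD[OF that(1)] that(2)] by (simp add: cond_def)
  qed
  then have "cond_sum \<Sigma> v = u v" if "v \<in> inner" for v
    using sum_w[OF that] that by (simp add: cond_sum_def)
  then have "mult_at \<Sigma> v = l v" if "v \<in> inner" for v
    using that l_eq[OF that] st[OF innerD[OF that]] by (simp add: mult_at_def)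
  then show ?thesis using crit by blast
qed

lemma crit_card:
  "finite crit" "card crit = (\<Prod>v\<in>inner. 2 ^ card (children v) - card (children v) - 1)"
proof -
  have bij: "bij_betw (\<lambda>\<Sigma>. restrict (mult_at \<Sigma>) inner) crit (PiE inner (\<lambda>v. {z. poly (p v s) z = 0}))"
    unfolding bij_betw_def
  proof
    show "inj_on (\<lambda>\<Sigma>. restrict (mult_at \<Sigma>) inner) crit"
    proof (rule inj_onI)
      fix \<Sigma> \<Sigma>' assume *: "\<Sigma> \<in> crit" "\<Sigma>' \<in> crit" "restrict (mult_at \<Sigma>) inner = restrict (mult_at \<Sigma>') inner"
      show "\<Sigma> = \<Sigma>'" by (rule crit_inj[OF *(1,2)]) (metis *(3) restrict_apply')
    qed
    show "(\<lambda>\<Sigma>. restrict (mult_at \<Sigma>) inner) ` crit = (PiE inner (\<lambda>v. {z. poly (p v s) z = 0}))"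
    proof (intro equalityI subsetI)
      fix l assume l: "l \<in> PiE inner (\<lambda>v. {z. poly (p v s) z = 0})"
      then obtain \<Sigma> where \<Sigma>: "\<Sigma> \<in> crit" "\<And>v. v \<in> inner \<Longrightarrow> mult_at \<Sigma> v = l v"
        using crit_surj[of l] by (auto simp: PiE_iff)
      have "l = restrict (mult_at \<Sigma>) inner"
        using \<Sigma>(2) l by (auto simp: fun_eq_iff PiE_iff extensional_def)
      with \<Sigma>(1) show "l \<in> (\<lambda>\<Sigma>. restrict (mult_at \<Sigma>) inner) ` crit" by blast
    qed (auto simp: crit_root)
  qed
  have fin: "finite (PiE inner (\<lambda>v. {z. poly (p v s) z = 0}))"
    by (intro finite_PiE finite finite_roots)
  show "finite crit" using bij_betw_finite[OF bij] fin by simp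
  show "card crit = (\<Prod>v\<in>inner. 2 ^ card (children v) - card (children v) - 1)"
    unfolding bij_betw_same_card[OF bij] by (simp add: card_PiE card_roots)
qed

text \<open>
  Near \<open>P\<close> the coordinates of the decoupled system are elements of the local ring. The critical
  equations make the statistics constant modulo the ideal; the simple roots do the same for \<open>z\<close>, the
  quadratic equations for the conductances, and then the resistances and all matrix entries follow.
\<close>

lemma crit_multiplicity:
  assumes P: "P \<in> crit" and S: "\<And>A. A \<in> F \<Longrightarrow> block (matrix_inv S) A A = s A"
  shows "has_multiplicity X (critical_equations lam_space S) P 1"
proof -
  note C = critD[OF P]
  have det: "det P \<noteq> 0" using C(2) by (simp add: invertible_det_nz)
  have entry_mem: "(\<lambda>\<Sigma>. matrix_inv \<Sigma> $ i $ j) \<in> local_ring X P" for i j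
  proof -
    have "germ_eq X P (\<lambda>\<Sigma>. matrix_inv \<Sigma> $ i $ j) (\<lambda>\<Sigma>. cofactor_num i j \<Sigma> / det \<Sigma>)"
      by (rule germ_eqI[OF polyfun_det det]) (simp add: matrix_inv_entry invertible_det_nz)
    then show ?thesis unfolding local_ring_def
      using polyfun_cofactor_num polyfun_det det by blast
  qed
  have crit0: "\<forall>f\<in>critical_equations lam_space S. f P = 0"
    unfolding critical_iff using C(3) S by simp
  have zero_ring: "(\<lambda>_. 0) \<in> local_ring X P" by (intro local_ring_polyfun polyfun.const)
  have sum_ring: "(\<lambda>\<Sigma>. \<Sum>k\<in>K. g k \<Sigma>) \<in> local_ring X P"
    if "\<And>k. k \<in> K \<Longrightarrow> g k \<in> local_ring X P" for g and K :: "'n set"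
    using that by (induction K rule: infinite_finite_induct) (simp_all add: zero_ring local_ring_add)
  interpret local_algebra X P "critical_equations lam_space S"
  proof
    fix f assume f: "f \<in> critical_equations lam_space S"
    then obtain E where E: "f = (\<lambda>\<Sigma>. trace (matrix_inv \<Sigma> ** map_matrix complex_of_real E) -
        trace (matrix_inv S ** map_matrix complex_of_real E))" unfolding critical_equations_def by blast
    have "f = (\<lambda>\<Sigma>. (\<Sum>i\<in>UNIV. \<Sum>k\<in>UNIV. complex_of_real (E $ k $ i) * matrix_inv \<Sigma> $ i $ k) +
        (- trace (matrix_inv S ** map_matrix complex_of_real E)))"
      by (simp add: E trace_def matrix_matrix_mult_def map_matrix_def mult.commute)
    also have "\<dots> \<in> local_ring X P"
      by (intro local_ring_add sum_ring local_ring_scale entry_mem local_ring_polyfun polyfun.const)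
    finally show "f \<in> local_ring X P" .
    show "f P = 0" using crit0 f by blast
  qed (rule C(1))
  have near_inv: "near (\<lambda>\<Sigma>. invertible \<Sigma>)"
    by (rule near_mono[OF near_polyfun[OF polyfun_det det]]) (simp add: invertible_det_nz)
  have block_R: "(\<lambda>\<Sigma>. block (matrix_inv \<Sigma>) A B) \<in> R" for A B
    unfolding block_def by (intro R_sum entry_mem)
  have edge_R: "(\<lambda>\<Sigma>. edge \<Sigma> A) \<in> R" for A
    unfolding edge_def level_def by (cases "A = UNIV") (auto intro!: local_ring_polyfun polyfun_diff polyfun.entry polyfun.const)
  have gain_R: "(\<lambda>\<Sigma>. 1 - gain_of \<Sigma> v) \<in> R" for v
    unfolding gain_of_def by (intro R_diff R_const R_sum R_mult edge_R block_R)
  have gP: "1 - gain_of P v \<noteq> 0" if "v \<in> inner" for v using crit_gain[OF P that] by simp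
  have cond_R: "(\<lambda>\<Sigma>. cond \<Sigma> A) \<in> R" if "A \<in> F" for A
  proof (cases "A = UNIV")
    case True
    then show ?thesis by (simp add: cond_def block_R)
  next
    case False
    then show ?thesis using gP[OF parent_props(1)[OF that False]]
      by (simp add: cond_def R_divide block_R gain_R)
  qed
  have sum_R: "(\<lambda>\<Sigma>. cond_sum \<Sigma> v) \<in> R" for v
    unfolding cond_sum_def by (intro R_sum cond_R childD(1))
  have mult_R: "(\<lambda>\<Sigma>. mult_at \<Sigma> v) \<in> R" if "v \<in> inner" for v
    unfolding mult_at_def using crit_cond_sum[OF P that]
    by (intro R_diff R_divide R_const R_power sum_R block_R) auto
  have stat_resid: "(\<lambda>\<Sigma>. stat \<Sigma> A) \<in> resid" for A
  proof (cases "A \<in> F")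
    case True
    have "(\<lambda>\<Sigma>. trace (matrix_inv \<Sigma> ** map_matrix complex_of_real (clade A)) -
        trace (matrix_inv S ** map_matrix complex_of_real (clade A))) \<in> I"
      by (rule I_gen) (use clade_mem[OF True] in \<open>auto simp: critical_equations_def\<close>)
    then show ?thesis using True unfolding trace_clade stat_def by (auto intro: residI)
  next
    case False
    then show ?thesis by (simp add: stat_def resid_const)
  qed
  have stat_P: "(\<lambda>j. stat P j) = s" using C(4) .
  have near_gain: "near (\<lambda>\<Sigma>. \<forall>v\<in>inner. gain_of \<Sigma> v \<noteq> 1)"
    by (intro near_ball finite) (rule near_mono[OF R_inverse(2)[OF gain_R gP]], auto)
  have near_cond: "near (\<lambda>\<Sigma>. \<forall>A\<in>F. cond \<Sigma> A \<noteq> 0)"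
    by (intro near_ball finite R_inverse(2) cond_R crit_cond[OF P])
  have near_sum: "near (\<lambda>\<Sigma>. \<forall>v\<in>inner. cond_sum \<Sigma> v \<noteq> 0)"
    by (intro near_ball finite R_inverse(2) sum_R crit_cond_sum[OF P])
  have regular: "near (\<lambda>\<Sigma>. invertible \<Sigma> \<and> (\<forall>v\<in>inner. gain_of \<Sigma> v \<noteq> 1) \<and>
      (\<forall>A\<in>F. cond \<Sigma> A \<noteq> 0) \<and> (\<forall>v\<in>inner. cond_sum \<Sigma> v \<noteq> 0))"
    by (intro near_conj near_inv near_gain near_cond near_sum)
  have node: "near (\<lambda>\<Sigma>. stat \<Sigma> c = cond \<Sigma> c - (cond \<Sigma> c)\<^sup>2 * mult_at \<Sigma> v)"
    if "v \<in> inner" "c \<in> children v" for v c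
    by (rule near_mono[OF regular]) (use that childD(1) in \<open>simp add: stat_def cond_equations(2)\<close>)
  have mult_resid: "(\<lambda>\<Sigma>. mult_at \<Sigma> v) \<in> resid" if v: "v \<in> inner" for v
  proof (rule resid_simple_root[OF family(1)[OF v] family(2)[OF v] stat_resid mult_R[OF v]])
    have "near (\<lambda>\<Sigma>. mult_at \<Sigma> v \<noteq> 0)"
      by (rule R_inverse(2)[OF mult_R[OF v] crit_mult_nonzero[OF P v]])
    from near_conj[OF this regular]
    show "near (\<lambda>\<Sigma>. poly (p v (\<lambda>j. stat \<Sigma> j)) (mult_at \<Sigma> v) = 0)"
    proof (rule near_mono)
      fix \<Sigma> assume \<Sigma>: "\<Sigma> \<in> X" and *: "mult_at \<Sigma> v \<noteq> 0 \<and> invertible \<Sigma> \<and> (\<forall>v\<in>inner. gain_of \<Sigma> v \<noteq> 1) \<and>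
        (\<forall>A\<in>F. cond \<Sigma> A \<noteq> 0) \<and> (\<forall>v\<in>inner. cond_sum \<Sigma> v \<noteq> 0)"
      have "local_solution (star v) (stat \<Sigma>) (mult_at \<Sigma> v) (node_roots \<Sigma> v)"
      proof (rule node_roots_solution[OF v])
        show "stat \<Sigma> j = block (matrix_inv \<Sigma>) j j" if "j \<in> star v" for j
          using star_sub[OF v] that by (auto simp: stat_def)
        show "stat \<Sigma> c = cond \<Sigma> c - (cond \<Sigma> c)\<^sup>2 * mult_at \<Sigma> v" if "c \<in> children v" for c
          using cond_equations(2)[OF \<Sigma> _ _ v that] * v childD(1)[OF that] by (simp add: stat_def)
      qed (use * v in blast)
      from solution_root[OF v _ this] * show "poly (p v (\<lambda>j. stat \<Sigma> j)) (mult_at \<Sigma> v) = 0" by simp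
    qed
    show "poly (pderiv (p v (\<lambda>j. stat P j))) (mult_at P v) \<noteq> 0"
      unfolding stat_P by (rule root_simple[OF v crit_root[OF P v]])
  qed
  have cond_resid: "(\<lambda>\<Sigma>. cond \<Sigma> A) \<in> resid" if A: "A \<in> F" for A
  proof (cases "A = UNIV")
    case True
    show ?thesis
      by (rule resid_cong[OF near_all stat_resid[of UNIV]]) (simp add: True cond_def stat_def UNIV_mem)
  next
    case False
    note par = parent_props[OF A False]
    have "A \<in> star (parent A)" "A \<noteq> parent A" using par(2) childD(2) by (auto simp: star_def)
    then have "node_roots P (parent A) A \<noteq> 0"
      using solution_unique[OF par(1) crit_root[OF P par(1)] crit_solution[OF P par(1)] crit_solution[OF P par(1)]]
      by blast
    then have "2 * mult_at P (parent A) * cond P A - 1 \<noteq> 0"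
      using \<open>A \<noteq> parent A\<close> by (simp add: node_roots_def)
    moreover have "near (\<lambda>\<Sigma>. mult_at \<Sigma> (parent A) * (cond \<Sigma> A)\<^sup>2 - cond \<Sigma> A + stat \<Sigma> A = 0)"
      by (rule near_mono[OF node[OF par(1,2)]]) simp
    ultimately show ?thesis
      by (intro resid_quadratic_root[OF mult_resid[OF par(1)] stat_resid cond_R[OF A]])
  qed
  have sum_resid: "(\<lambda>\<Sigma>. cond_sum \<Sigma> v) \<in> resid" for v
    unfolding cond_sum_def by (intro resid_sum cond_resid childD(1))
  have edge_resid: "(\<lambda>\<Sigma>. edge \<Sigma> A) \<in> resid" if A: "A \<in> F" for A
    using A
  proof (cases rule: mem_cases)
    case (singleton i)
    have "near (\<lambda>\<Sigma>. edge \<Sigma> A = 1 / cond \<Sigma> A)"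
      by (rule near_mono[OF regular]) (simp add: singleton cond_equations(4))
    then show ?thesis
      by (rule resid_cong) (intro resid_divide resid_const cond_resid A crit_cond[OF P])
  next
    case inner
    have "near (\<lambda>\<Sigma>. edge \<Sigma> A = 1 / cond \<Sigma> A - 1 / cond_sum \<Sigma> A)"
      by (rule near_mono[OF regular]) (use inner A in \<open>simp add: cond_equations(3)\<close>)
    then show ?thesis
      by (rule resid_cong)
        (intro resid_diff resid_divide resid_const cond_resid A crit_cond[OF P] sum_resid crit_cond_sum[OF P inner])
  qed
  show ?thesis
  proof (rule has_multiplicity_1)
    fix i j
    show "(\<lambda>\<Sigma>. \<Sigma> $ i $ j) \<in> resid"
    proof (rule resid_cong)
      show "near (\<lambda>\<Sigma>. \<Sigma> $ i $ j = (\<Sum>B\<in>{B \<in> F. join i j \<subseteq> B}. edge \<Sigma> B))"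
        by (rule near_all) (simp add: level_join level_sum[OF join_mem])
    qed (intro resid_sum edge_resid, simp)
  qed
qed

end

section \<open>The reciprocal degree of a laminar family\<close>

lemma polyfun_mpolyfun:
  assumes "mpolyfun f" "\<And>j. polyfun (\<sigma> j)"
  shows "polyfun (\<lambda>K. f (\<lambda>j. \<sigma> j K))"
  using assms(1) by induction (simp_all add: assms(2) polyfun.const polyfun.add polyfun.mult)

context laminar
begin

lemma subclades:
  assumes "A \<in> F"
  shows "{B \<in> F. B \<subseteq> A} = insert A (\<Union>c\<in>children A. {B \<in> F. B \<subseteq> c})"
proof (intro equalityI subsetI)
  fix B assume B: "B \<in> {B \<in> F. B \<subseteq> A}"
  show "B \<in> insert A (\<Union>c\<in>children A. {B \<in> F. B \<subseteq> c})"
  proof (cases "B = A")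
    case False
    from assms have "A \<in> inner"
    proof (cases rule: mem_cases)
      case (singleton i)
      with B False mem_nonempty[of B] show ?thesis by auto
    qed
    obtain i where i: "i \<in> B" using B mem_nonempty by blast
    then obtain c where c: "c \<in> children A" "i \<in> c" using child_covering[OF \<open>A \<in> inner\<close>] B by blast
    have "B \<subseteq> c" using above_child[OF assms c(1) _ c(2) i] B False by blast
    with B c show ?thesis by blast
  qed simp
qed (use assms childD in blast)

text \<open>
  A telescoping sum over the tree.
\<close>

lemma sum_subclades:
  fixes \<kappa> :: "'n set \<Rightarrow> complex"
  assumes "A \<in> F"
  shows "(\<Sum>B\<in>{B \<in> F. B \<subseteq> A}. \<kappa> B - (\<Sum>c\<in>children B. \<kappa> c)) = \<kappa> A"
  using assms
proof (induction "card A" arbitrary: A rule: less_induct)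
  case less
  let ?\<delta> = "\<lambda>B. \<kappa> B - (\<Sum>c\<in>children B. \<kappa> c)"
  have disj: "{B \<in> F. B \<subseteq> c} \<inter> {B \<in> F. B \<subseteq> c'} = {}" if "c \<in> children A" "c' \<in> children A" "c \<noteq> c'" for c c'
    using children_disjoint[OF that] mem_nonempty by blast
  have "A \<notin> (\<Union>c\<in>children A. {B \<in> F. B \<subseteq> c})" using childD(2) by blast
  then have "(\<Sum>B\<in>{B \<in> F. B \<subseteq> A}. ?\<delta> B) = ?\<delta> A + (\<Sum>B\<in>(\<Union>c\<in>children A. {B \<in> F. B \<subseteq> c}). ?\<delta> B)"
    unfolding subclades[OF less.prems] by (subst sum.insert) auto
  also have "(\<Sum>B\<in>(\<Union>c\<in>children A. {B \<in> F. B \<subseteq> c}). ?\<delta> B) = (\<Sum>c\<in>children A. \<Sum>B\<in>{B \<in> F. B \<subseteq> c}. ?\<delta> B)"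
    by (rule sum.UNION_disjoint) (use disj in auto)
  also have "\<dots> = (\<Sum>c\<in>children A. \<kappa> c)"
  proof (intro sum.cong refl)
    fix c assume "c \<in> children A"
    then show "(\<Sum>B\<in>{B \<in> F. B \<subseteq> c}. ?\<delta> B) = \<kappa> c"
      using less.hyps[of c] childD psubset_card_mono[of A c] by simp
  qed
  finally show ?case by simp
qed

text \<open>
  The statistics of a symmetric matrix are arbitrary, so that conditions that are generic in them are
  generic in the matrix. The increment of the statistics at a clade is spread evenly over the pairs
  of leaves whose join is that clade.
\<close>

lemma block_surjective:
  "\<exists>K :: complex^'n^'n. transpose K = K \<and> (\<forall>A\<in>F. block K A A = \<kappa> A)"
proof -
  define \<delta> where "\<delta> B = \<kappa> B - (\<Sum>c\<in>children B. \<kappa> c)" for B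
  define pairs where "pairs B = {p. join (fst p) (snd p) = B}" for B
  have pairs: "card (pairs B) \<noteq> 0" if "B \<in> F" for B
    using join_exists[OF that] by (auto simp: pairs_def)
  define K :: "complex^'n^'n" where "K = (\<chi> i j. \<delta> (join i j) / of_nat (card (pairs (join i j))))"
  have "transpose K = K" by (simp add: K_def transpose_def vec_eq_iff) (metis join_sym)
  moreover have "block K A A = \<kappa> A" if A: "A \<in> F" for A
  proof -
    have "block K A A = (\<Sum>p\<in>A \<times> A. \<delta> (join (fst p) (snd p)) / of_nat (card (pairs (join (fst p) (snd p)))))"
      by (simp add: block_def K_def sum.cartesian_product case_prod_beta)
    also have "A \<times> A = (\<Union>B\<in>{B \<in> F. B \<subseteq> A}. pairs B)"
      using join_subset_iff[OF A] join_mem by (auto simp: pairs_def)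
    also have "(\<Sum>p\<in>(\<Union>B\<in>{B \<in> F. B \<subseteq> A}. pairs B). \<delta> (join (fst p) (snd p)) / of_nat (card (pairs (join (fst p) (snd p))))) =
        (\<Sum>B\<in>{B \<in> F. B \<subseteq> A}. \<Sum>p\<in>pairs B. \<delta> (join (fst p) (snd p)) / of_nat (card (pairs (join (fst p) (snd p)))))"
      by (rule sum.UNION_disjoint) (auto simp: pairs_def)
    also have "\<dots> = (\<Sum>B\<in>{B \<in> F. B \<subseteq> A}. \<delta> B)"
    proof (intro sum.cong refl)
      fix B assume "B \<in> {B \<in> F. B \<subseteq> A}"
      then have "B \<in> F" by simp
      have "(\<Sum>p\<in>pairs B. \<delta> (join (fst p) (snd p)) / of_nat (card (pairs (join (fst p) (snd p))))) =
          (\<Sum>p\<in>pairs B. \<delta> B / of_nat (card (pairs B)))"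
        by (intro sum.cong refl) (simp add: pairs_def)
      then show "(\<Sum>p\<in>pairs B. \<delta> (join (fst p) (snd p)) / of_nat (card (pairs (join (fst p) (snd p))))) = \<delta> B"
        using pairs[OF \<open>B \<in> F\<close>] by simp
    qed
    also have "\<dots> = \<kappa> A" unfolding \<delta>_def by (rule sum_subclades[OF A])
    finally show ?thesis .
  qed
  ultimately show ?thesis by blast
qed

text \<open>
  The exceptional polynomial combines the polynomials \<open>H\<close> of the internal vertices with the linear
  conditions that keep the decoupled coordinates finite and nonzero and the value \<open>z\<close> different from 0.
\<close>

theorem has_rmld_lam_space:
  "has_rmld lam_space (\<Prod>v\<in>inner. 2 ^ card (children v) - card (children v) - 1)"
proof -
  have card3: "card (star v) \<ge> 3" if "v \<in> inner" for v
    using card_children[OF that] by (simp add: card_star)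
  have "\<exists>P H. generic_count (star v) P H" if "v \<in> inner" for v
    by (rule local_solution_count[OF finite card3[OF that]])
  then obtain p H where pH: "\<And>v. v \<in> inner \<Longrightarrow> generic_count (star v) (p v) (H v)" by metis
  \<comment> \<open>For \<open>i = v\<close> this vanishes if \<open>z = 0\<close> is a solution at \<open>v\<close>, and for a child \<open>i\<close> if the voltage at
     \<open>v\<close> can be 1.\<close>
  define unb where "unb v i s = s i - (\<Sum>j\<in>star v - {i}. s j)" for v i and s :: "'n set \<Rightarrow> complex"
  define G where "G s = (\<Prod>A\<in>F. s A) * (\<Prod>v\<in>inner. H v s * (\<Prod>i\<in>star v. unb v i s))" for s
  have H: "mpolyfun (H v)" "\<exists>s. H v s \<noteq> 0" if "v \<in> inner" for v
    using pH[OF that] unfolding generic_count_def by blast+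
  have unb_poly: "mpolyfun (unb v i)" for v i
    unfolding unb_def[abs_def] by (intro mpolyfun_diff mpolyfun_sum mpolyfun.coord)
  have unb_nz: "\<exists>s. unb v i s \<noteq> 0" if "v \<in> inner" "i \<in> star v" for v i
  proof -
    have "unb v i (\<lambda>_. 1) = 1 - of_nat (card (star v) - 1)"
      using that(2) by (simp add: unb_def)
    moreover have "card (star v) - 1 \<noteq> 1" using card3[OF that(1)] by simp
    then have "(of_nat (card (star v) - 1) :: complex) \<noteq> 1" by (metis of_nat_eq_1_iff)
    ultimately show ?thesis by (intro exI[of _ "\<lambda>_. 1"]) simp
  qed
  have prod_unb: "\<exists>s. (\<Prod>i\<in>star v. unb v i s) \<noteq> 0" if "v \<in> inner" for v
    by (rule mpolyfun_prod_nonzero[OF finite unb_poly unb_nz[OF that]])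
  have node_poly: "mpolyfun (\<lambda>s. H v s * (\<Prod>i\<in>star v. unb v i s))" if "v \<in> inner" for v
    by (intro mpolyfun.mult mpolyfun_prod H unb_poly that)
  have node_nz: "\<exists>s. H v s * (\<Prod>i\<in>star v. unb v i s) \<noteq> 0" if v: "v \<in> inner" for v
  proof -
    obtain a b where "H v a \<noteq> 0" "(\<Prod>i\<in>star v. unb v i b) \<noteq> 0" using H(2)[OF v] prod_unb[OF v] by blast
    then show ?thesis
      by (intro mpolyfun_mult_nonzero[where a = a and b = b] H(1)[OF v] mpolyfun_prod unb_poly)
  qed
  have G: "mpolyfun G"
    unfolding G_def[abs_def] by (intro mpolyfun.mult mpolyfun_prod mpolyfun.coord H unb_poly)
  have "\<exists>\<kappa>. (\<Prod>A\<in>F. \<kappa> A) * (\<Prod>v\<in>inner. H v \<kappa> * (\<Prod>i\<in>star v. unb v i \<kappa>)) \<noteq> 0"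
  proof -
    have "\<exists>b. (\<Prod>v\<in>inner. H v b * (\<Prod>i\<in>star v. unb v i b)) \<noteq> 0"
      by (rule mpolyfun_prod_nonzero[OF finite node_poly node_nz])
    then obtain b where b: "(\<Prod>v\<in>inner. H v b * (\<Prod>i\<in>star v. unb v i b)) \<noteq> 0" ..
    show ?thesis
      by (rule mpolyfun_mult_nonzero[where a = "\<lambda>_. 1" and b = b])
        (use b in \<open>simp_all add: mpolyfun_prod mpolyfun.coord node_poly\<close>)
  qed
  then obtain \<kappa> where \<kappa>: "G \<kappa> \<noteq> 0" unfolding G_def ..
  define target where "target A K = (if A \<in> F then block K A A else \<kappa> A)" for A and K :: "complex^'n^'n"
  have "polyfun (target A)" for A
  proof (cases "A \<in> F")
    case True
    then show ?thesis unfolding target_def[abs_def] block_def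
      by (simp, intro polyfun_sum polyfun.entry finite)
  qed (simp add: target_def[abs_def] polyfun.const)
  then have g: "polyfun (\<lambda>K. G (\<lambda>A. target A K))" by (rule polyfun_mpolyfun[OF G])
  obtain K1 where K1: "transpose K1 = K1" "\<And>A. A \<in> F \<Longrightarrow> block K1 A A = \<kappa> A"
    using block_surjective[of \<kappa>] by blast
  have "(\<lambda>A. target A K1) = \<kappa>" using K1(2) by (auto simp: target_def)
  then have "G (\<lambda>A. target A K1) \<noteq> 0" using \<kappa> by simp
  then obtain K where K: "transpose K = K" "G (\<lambda>A. target A K) \<noteq> 0" "det K \<noteq> 0"
    using polyfun_common_nonzero[OF g polyfun_det K1(1), of "mat 1"] by (auto simp: transpose_mat)
  obtain h N where h: "polyfun h"
    "\<And>S. invertible S \<Longrightarrow> G (\<lambda>A. target A (matrix_inv S)) * det S ^ N = h S"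
    using polyfun_matrix_inv[OF g] by blast
  have Kinv: "invertible K" using K(3) by (simp add: invertible_det_nz)
  show ?thesis unfolding has_rmld_def
  proof (intro exI[of _ h] conjI allI impI)
    show "polyfun h" by (rule h)
    have "h (matrix_inv K) \<noteq> 0"
      using h(2)[OF invertible_matrix_inv[OF Kinv]] K(2) invertible_matrix_inv[OF Kinv]
      by (auto simp: matrix_inv_matrix_inv[OF Kinv] invertible_det_nz)
    then show "\<exists>S. transpose S = S \<and> h S \<noteq> 0"
      using transpose_matrix_inv[OF Kinv K(1)] by blast
    fix S :: "complex^'n^'n" assume S: "transpose S = S \<and> invertible S \<and> h S \<noteq> 0"
    define s where "s A = target A (matrix_inv S)" for A
    have Gs: "G s \<noteq> 0" using h(2)[of S] S by (auto simp: s_def[abs_def])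
    have Hs: "H v s \<noteq> 0" if "v \<in> inner" for v using Gs that by (simp add: G_def)
    note countD = pH[unfolded generic_count_def]
    interpret generic_target F \<kappa> s p "\<lambda>v. 2 ^ (card (star v) - 1) - card (star v)"
    proof
      fix v assume v: "v \<in> inner"
      note g = countD[OF v] and Hv = Hs[OF v]
      show "poly_family (p v)" using g by (elim conjE)
      show "degree (p v t) \<le> 2 ^ (card (star v) - 1) - card (star v)" for t
        using g by (elim conjE) (erule spec)
      show "poly (p v t) z = 0" if "z \<noteq> 0" "local_solution (star v) t z r" for z t r
        using conjunct1[OF conjunct2[OF conjunct2[OF conjunct2[OF conjunct2[OF g]]]]] that by blast
      note roots = conjunct2[OF conjunct2[OF conjunct2[OF conjunct2[OF conjunct2[OF g]]]], rule_format, OF Hv]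
      show "finite {z. poly (p v s) z = 0}" using roots by (elim conjE)
      show "card {z. poly (p v s) z = 0} = 2 ^ card (children v) - card (children v) - 1"
        using conjunct1[OF conjunct2[OF roots]] by (simp add: card_star)
      note root = conjunct2[OF conjunct2[OF roots], rule_format]
      show "z \<noteq> 0" "poly (pderiv (p v s)) z \<noteq> 0" "\<exists>r. local_solution (star v) s z r"
        if "poly (p v s) z = 0" for z using root[OF that] by simp_all
      show "r j \<noteq> 0 \<and> r' j = r j" if "poly (p v s) z = 0" "local_solution (star v) s z r"
        "local_solution (star v) s z r'" "j \<in> star v" for z r r'  j
        using conjunct2[OF conjunct2[OF conjunct2[OF root[OF that(1)]]]] that by blast
      show "s i \<noteq> (\<Sum>j\<in>star v - {i}. s j)" if "i \<in> star v" for i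
        using Gs v that by (auto simp: G_def unb_def)
    next
      show "s A \<noteq> 0" if "A \<in> F" for A using Gs that by (simp add: G_def)
      show "s A = \<kappa> A" if "A \<notin> F" for A using that by (simp add: s_def target_def)
    qed
    have sF: "block (matrix_inv S) A A = s A" if "A \<in> F" for A using that by (simp add: s_def target_def)
    have crit_eq: "critical_points lam_space S = crit"
      unfolding critical_points_def crit_def critical_iff using sF by auto
    show "finite (critical_points lam_space S)" unfolding crit_eq by (rule crit_card)
    show "\<exists>\<mu>. (\<forall>P\<in>critical_points lam_space S. has_multiplicity X (critical_equations lam_space S) P (\<mu> P)) \<and>
        (\<Sum>P\<in>critical_points lam_space S. \<mu> P) =
        (\<Prod>v\<in>inner. 2 ^ card (children v) - card (children v) - 1)"
      unfolding crit_eq using crit_multiplicity[OF _ sF] crit_card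
      by (intro exI[of _ "\<lambda>_. 1"]) simp
  qed
qed

end

section \<open>Rooted trees\<close>

context rooted_tree
begin

text \<open>
  A walk from the root to \<open>u\<close> can be put in front of both.
\<close>

lemma awalk_unique:
  assumes "awalk u p v" "awalk u q v" shows "p = q"
proof -
  have "u \<in> verts T" "v \<in> verts T" using assms(1) by auto
  then obtain p0 where "awalk root p0 u" using unique_awalk[of u] by blast
  then have "awalk root (p0 @ p) v" "awalk root (p0 @ q) v" using assms awalk_appendI by blast+
  then have "p0 @ p = p0 @ q" using unique_awalk[OF \<open>v \<in> verts T\<close>] by blast
  then show ?thesis by simp
qed

lemma reachable_from_root: "v \<in> verts T \<Longrightarrow> root \<rightarrow>\<^sup>* v"
  using unique_awalk reachable_awalk by blast

lemma reachable_antisym: assumes "u \<rightarrow>\<^sup>* v" "v \<rightarrow>\<^sup>* u" shows "u = v"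
proof -
  obtain p q where p: "awalk u p v" "awalk v q u" using assms reachable_awalk by blast
  then have "awalk u (p @ q) u" using awalk_appendI by blast
  moreover have "awalk u [] u" using p by (auto simp: awalk_Nil_iff)
  ultimately have "p @ q = []" using awalk_unique by blast
  then show ?thesis using p by (auto simp: awalk_Nil_iff)
qed

text \<open>
  Continuing to \<open>v\<close>, the walks from the root to \<open>a\<close> and to \<open>b\<close> are both prefixes of the unique walk
  to \<open>v\<close>.
\<close>

lemma ancestors_chain:
  assumes "a \<rightarrow>\<^sup>* v" "b \<rightarrow>\<^sup>* v" shows "a \<rightarrow>\<^sup>* b \<or> b \<rightarrow>\<^sup>* a"
proof -
  obtain p2 q2 where 2: "awalk a p2 v" "awalk b q2 v" using assms reachable_awalk by blast
  then have "a \<in> verts T" "b \<in> verts T" by auto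
  then obtain p1 q1 where 1: "awalk root p1 a" "awalk root q1 b"
    using unique_awalk by meson
  have "awalk root (p1 @ p2) v" "awalk root (q1 @ q2) v" using 1 2 awalk_appendI by blast+
  then have "p1 @ p2 = q1 @ q2" by (rule awalk_unique)
  then consider us where "p1 = q1 @ us" | us where "q1 = p1 @ us"
    by (auto simp: append_eq_append_conv2)
  then show ?thesis
  proof cases
    case 1
    from \<open>awalk root q1 b\<close> have "awlast root q1 = b" by auto
    with 1 \<open>awalk root p1 a\<close> have "awalk b us a" by simp
    then show ?thesis using reachable_awalkI by blast
  next
    case 2
    from \<open>awalk root p1 a\<close> have "awlast root p1 = a" by auto
    with 2 \<open>awalk root q1 b\<close> have "awalk a us b" by simp
    then show ?thesis using reachable_awalkI by blast
  qed
qed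

lemma arc_reachable: "e \<in> arcs T \<Longrightarrow> tail T e \<rightarrow>\<^sup>* head T e"
  using arc_implies_awalk reachable_awalkI by blast

lemma first_arc:
  assumes "u \<rightarrow>\<^sup>* v" "u \<noteq> v"
  shows "\<exists>e\<in>arcs T. tail T e = u \<and> head T e \<rightarrow>\<^sup>* v"
proof -
  obtain p where p: "awalk u p v" using assms(1) reachable_awalk by blast
  then have "p \<noteq> []" using assms(2) by (auto simp: awalk_Nil_iff)
  then obtain e es where "p = e # es" by (cases p) auto
  then show ?thesis using p reachable_awalkI by (auto simp: awalk_Cons_iff)
qed

lemma arc_nearest:
  assumes "e \<in> arcs T" "tail T e \<rightarrow>\<^sup>* x" "x \<rightarrow>\<^sup>* head T e"
  shows "x = tail T e \<or> x = head T e"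
proof -
  obtain p q where "awalk (tail T e) p x" "awalk x q (head T e)" using assms reachable_awalk by blast
  moreover from this have "p @ q = [e]"
    using awalk_unique[OF awalk_appendI arc_implies_awalk[OF assms(1)]] by blast
  ultimately show ?thesis
    by (cases p) (auto simp: awalk_Nil_iff awalk_Cons_iff)
qed

lemma in_degree_root: "in_degree T root = 0"
proof -
  have "in_arcs T root = {}"
  proof (rule ccontr)
    assume "in_arcs T root \<noteq> {}"
    then obtain e where "e \<in> in_arcs T root" by blast
    then have e: "e \<in> arcs T" "head T e = root" by simp_all
    then have "root = tail T e"
      using reachable_antisym[OF arc_reachable[OF e(1)]] reachable_from_root[OF tail_in_verts[OF e(1)]] by simp
    then show False using no_loops[OF e(1)] e(2) by simp
  qed
  then show ?thesis by (simp add: in_degree_def)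
qed

lemma in_degree_nonroot: assumes "v \<in> verts T" "v \<noteq> root" shows "in_degree T v = 1"
proof -
  obtain p where p: "awalk root p v" using unique_awalk[OF assms(1)] by blast
  then have "p \<noteq> []" using assms(2) by (auto simp: awalk_Nil_iff)
  then obtain q e where q: "p = q @ [e]" by (cases p rule: rev_cases) auto
  then have e: "e \<in> arcs T" "head T e = v" using p by (auto simp: awalk_simps)
  have uniq: "e' = e" if e': "e' \<in> arcs T" "head T e' = v" for e'
  proof -
    obtain q' where "awalk root q' (tail T e')" using unique_awalk[OF tail_in_verts[OF e'(1)]] by blast
    then have "awalk root (q' @ [e']) v"
      using awalk_appendI[OF _ arc_implies_awalk[OF e'(1)]] e'(2) by simp
    then have "q' @ [e'] = q @ [e]" using p unfolding q by (rule awalk_unique)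
    then show ?thesis by simp
  qed
  have "in_arcs T v = {e}"
  proof (intro equalityI subsetI)
    fix x assume "x \<in> in_arcs T v"
    then show "x \<in> {e}" using uniq[of x] by simp
  qed (use e in simp)
  then show ?thesis by (simp add: in_degree_def)
qed

end

locale phylogenetic_tree = rooted_tree T root for T :: "('v, 'e) pre_digraph" (structure) and root +
  fixes lf :: "'n::finite \<Rightarrow> 'v"
  assumes root_leaf: "root \<in> leaves T"
    and lf_bij: "bij_betw lf UNIV (leaves T - {root})"
    and no_degree_2: "v \<in> verts T \<Longrightarrow> vdegree T v \<noteq> 2"
begin

definition nonroot :: "'v set" where "nonroot = verts T - {root}"

definition leafset :: "'v \<Rightarrow> 'n set" where "leafset v = {i. v \<rightarrow>\<^sup>* lf i}"

definition clades :: "'n set set" where "clades = leafset ` nonroot"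

lemma lf_leaf: "lf i \<in> leaves T" "lf i \<in> nonroot" "lf i \<in> verts T"
  using lf_bij by (auto simp: bij_betw_def nonroot_def leaves_def)

lemma lf_inj: "lf i = lf j \<longleftrightarrow> i = j"
  using lf_bij by (auto simp: bij_betw_def inj_on_def)

lemma leaf_iff: "v \<in> nonroot \<Longrightarrow> v \<in> leaves T \<longleftrightarrow> out_degree T v = 0"
  by (auto simp: nonroot_def leaves_def vdegree_def in_degree_nonroot)

lemma leaf_lf: "v \<in> nonroot \<Longrightarrow> v \<in> leaves T \<Longrightarrow> \<exists>i. v = lf i"
  using lf_bij by (auto simp: bij_betw_def nonroot_def)

lemma internal_nonroot: "v \<in> internal T \<Longrightarrow> v \<in> nonroot"
  using root_leaf by (auto simp: internal_def nonroot_def)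

lemma internal_iff: "v \<in> nonroot \<Longrightarrow> v \<in> internal T \<longleftrightarrow> v \<notin> leaves T"
  by (auto simp: internal_def nonroot_def)

lemma out_degree_ge_2: assumes "v \<in> nonroot" "v \<notin> leaves T" shows "out_degree T v \<ge> 2"
proof -
  have "out_degree T v \<noteq> 0" using leaf_iff assms by blast
  moreover have "out_degree T v \<noteq> 1"
    using no_degree_2[of v] assms(1) in_degree_nonroot[of v] by (auto simp: nonroot_def vdegree_def)
  ultimately show ?thesis by simp
qed

lemma head_nonroot: "e \<in> arcs T \<Longrightarrow> head T e \<in> nonroot"
proof -
  assume e: "e \<in> arcs T"
  have "head T e \<noteq> root"
  proof
    assume "head T e = root"
    then have "e \<in> in_arcs T root" using e by simp
    moreover have "in_arcs T root = {}" using in_degree_root by (simp add: in_degree_def card_0_eq[OF finite_in_arcs])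
    ultimately show False by simp
  qed
  then show ?thesis using e by (simp add: nonroot_def)
qed

lemma arc_child_neq: "e \<in> arcs T \<Longrightarrow> \<not> head T e \<rightarrow>\<^sup>* tail T e"
  using reachable_antisym arc_reachable no_loops by metis

lemma leafset_mono: "u \<rightarrow>\<^sup>* v \<Longrightarrow> leafset v \<subseteq> leafset u"
  unfolding leafset_def using reachable_trans by blast

lemma leafset_nonempty: assumes "v \<in> nonroot" shows "leafset v \<noteq> {}"
  using assms
proof (induction "card {x. v \<rightarrow>\<^sup>* x}" arbitrary: v rule: less_induct)
  case less
  show ?case
  proof (cases "v \<in> leaves T")
    case True
    then obtain i where "v = lf i" using leaf_lf less.prems by blast
    then have "i \<in> leafset v" using lf_leaf(3)[of i] by (simp add: leafset_def)
    then show ?thesis by blast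
  next
    case False
    then have "out_arcs T v \<noteq> {}" using out_degree_ge_2[OF less.prems False] by (auto simp: out_degree_def)
    then obtain e where "e \<in> out_arcs T v" by blast
    then have e: "e \<in> arcs T" "tail T e = v" by simp_all
    have "{x. head T e \<rightarrow>\<^sup>* x} \<subset> {x. v \<rightarrow>\<^sup>* x}"
    proof
      show "{x. head T e \<rightarrow>\<^sup>* x} \<subseteq> {x. v \<rightarrow>\<^sup>* x}"
        using arc_reachable[OF e(1)] e(2) reachable_trans by blast
      have "v \<in> {x. v \<rightarrow>\<^sup>* x}" using less.prems by (simp add: nonroot_def)
      moreover have "v \<notin> {x. head T e \<rightarrow>\<^sup>* x}" using arc_child_neq[OF e(1)] e(2) by simp
      ultimately show "{x. head T e \<rightarrow>\<^sup>* x} \<noteq> {x. v \<rightarrow>\<^sup>* x}" by blast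
    qed
    moreover have "finite {x. v \<rightarrow>\<^sup>* x}"
      by (rule finite_subset[OF _ finite_verts]) (auto elim: reachable_in_vertsE)
    ultimately have "leafset (head T e) \<noteq> {}" by (intro less.hyps head_nonroot[OF e(1)] psubset_card_mono)
    then show ?thesis using leafset_mono[OF arc_reachable[OF e(1)]] e(2) by blast
  qed
qed

lemma leafset_meet: "i \<in> leafset u \<Longrightarrow> i \<in> leafset v \<Longrightarrow> u \<rightarrow>\<^sup>* v \<or> v \<rightarrow>\<^sup>* u"
  unfolding leafset_def using ancestors_chain by blast

text \<open>
  Without vertices of degree two, \<open>u\<close> has a second child, and the leaves below that child are not below
  \<open>v\<close>. This makes vertices recoverable from their clades.
\<close>

lemma leafset_strict: assumes "u \<in> nonroot" "u \<rightarrow>\<^sup>* v" "u \<noteq> v" shows "leafset v \<subset> leafset u"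
proof -
  obtain e where e: "e \<in> arcs T" "tail T e = u" "head T e \<rightarrow>\<^sup>* v"
    using first_arc[OF assms(2,3)] by blast
  have "u \<notin> leaves T"
  proof
    assume "u \<in> leaves T"
    then have "out_arcs T u = {}" using leaf_iff[OF assms(1)]
      by (simp add: out_degree_def card_0_eq[OF finite_out_arcs])
    then show False using e by auto
  qed
  then have "card (out_arcs T u) \<ge> 2" using out_degree_ge_2 assms(1) by (simp add: out_degree_def)
  then have "\<not> out_arcs T u \<subseteq> {e}" using card_mono[of "{e}" "out_arcs T u"] by auto
  then obtain e' where "e' \<in> out_arcs T u" "e' \<noteq> e" by blast
  then have e': "e' \<in> arcs T" "tail T e' = u" "e' \<noteq> e" by simp_all
  obtain i where i: "i \<in> leafset (head T e')" using leafset_nonempty[OF head_nonroot[OF e'(1)]] by blast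
  have hd: "head T e' \<noteq> head T e"
    using no_multi_arcs[OF e'(1) e(1)] e' e by (auto simp: arc_to_ends_def)
  have "i \<notin> leafset v"
  proof
    assume "i \<in> leafset v"
    then have "i \<in> leafset (head T e)" using leafset_mono[OF e(3)] by blast
    then consider "head T e \<rightarrow>\<^sup>* head T e'" | "head T e' \<rightarrow>\<^sup>* head T e"
      using leafset_meet i by blast
    then show False
    proof cases
      case 1
      then show False
        using arc_nearest[OF e'(1), of "head T e"] arc_reachable[OF e(1)] e(2) e'(2) hd no_loops[OF e(1)] by auto
    next
      case 2
      then show False
        using arc_nearest[OF e(1), of "head T e'"] arc_reachable[OF e'(1)] e(2) e'(2) hd no_loops[OF e'(1)] by auto
    qed
  qed
  moreover have "i \<in> leafset u" using i leafset_mono[OF arc_reachable[OF e'(1)]] e'(2) by blast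
  ultimately show ?thesis using leafset_mono[OF assms(2)] by blast
qed

lemma leafset_subset_iff: assumes "u \<in> nonroot" "v \<in> nonroot" shows "leafset v \<subseteq> leafset u \<longleftrightarrow> u \<rightarrow>\<^sup>* v"
proof
  assume sub: "leafset v \<subseteq> leafset u"
  obtain i where i: "i \<in> leafset v" using leafset_nonempty[OF assms(2)] by blast
  then consider "u \<rightarrow>\<^sup>* v" | "v \<rightarrow>\<^sup>* u" "u \<noteq> v" "\<not> u \<rightarrow>\<^sup>* v"
    using leafset_meet sub assms by (metis reachable_refl nonroot_def DiffD1 subsetD)
  then show "u \<rightarrow>\<^sup>* v"
  proof cases
    case 2
    then show ?thesis using leafset_strict[OF assms(2), of u] sub by auto
  qed
qed (rule leafset_mono)

lemma leafset_inj: "inj_on leafset nonroot"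
  by (rule inj_onI) (metis leafset_subset_iff order_refl reachable_antisym)

lemma leafset_lf: "leafset (lf i) = {i}"
proof -
  have "j = i" if ij: "lf i \<rightarrow>\<^sup>* lf j" for j
  proof (rule ccontr)
    assume "j \<noteq> i"
    then have "lf i \<noteq> lf j" by (simp add: lf_inj)
    then obtain e where "e \<in> out_arcs T (lf i)" using first_arc[OF ij] by auto
    moreover have "out_arcs T (lf i) = {}"
      using leaf_iff[OF lf_leaf(2), of i] lf_leaf(1)
      by (simp add: out_degree_def card_0_eq[OF finite_out_arcs])
    ultimately show False by simp
  qed
  then show ?thesis using lf_leaf(3)[of i] by (auto simp: leafset_def)
qed

lemma leafset_UNIV: "\<exists>v\<in>nonroot. leafset v = UNIV"
proof -
  have "card (out_arcs T root) = 1"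
    using root_leaf in_degree_root by (simp add: leaves_def vdegree_def out_degree_def)
  then obtain e where e: "out_arcs T root = {e}" by (auto simp: card_1_singleton_iff)
  then have "e \<in> arcs T" by auto
  have "head T e \<rightarrow>\<^sup>* lf i" for i
  proof -
    have "root \<noteq> lf i" using lf_leaf(2)[of i] by (auto simp: nonroot_def)
    then obtain e' where e': "e' \<in> arcs T" "tail T e' = root" "head T e' \<rightarrow>\<^sup>* lf i"
      using first_arc[OF reachable_from_root[OF lf_leaf(3)]] by blast
    then have "e' \<in> out_arcs T root" by simp
    with e e'(3) show ?thesis by simp
  qed
  then show ?thesis using head_nonroot[OF \<open>e \<in> arcs T\<close>] by (auto simp: leafset_def)
qed

lemma laminar_clades: "laminar clades"
proof
  show "UNIV \<in> clades" using leafset_UNIV by (auto simp: clades_def)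
  show "{i} \<in> clades" for i using leafset_lf lf_leaf(2) by (auto simp: clades_def)
  show "{} \<notin> clades" using leafset_nonempty by (auto simp: clades_def)
  fix A B assume "A \<in> clades" "B \<in> clades"
  then obtain u v where "u \<in> nonroot" "v \<in> nonroot" "A = leafset u" "B = leafset v" by (auto simp: clades_def)
  then show "A \<inter> B = {} \<or> A \<subseteq> B \<or> B \<subseteq> A" using leafset_meet[of _ u v] leafset_mono by blast
qed

sublocale laminar clades by (rule laminar_clades)

lemma inner_clades: "inner = leafset ` internal T"
proof (intro equalityI subsetI)
  fix A assume A: "A \<in> inner"
  obtain v where v: "v \<in> nonroot" "A = leafset v" using innerD[OF A] by (auto simp: clades_def)
  have "v \<notin> leaves T"
  proof
    assume "v \<in> leaves T"
    then obtain i where "v = lf i" using leaf_lf v(1) by blast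
    then show False using A v(2) leafset_lf by (auto simp: inner_def)
  qed
  with v show "A \<in> leafset ` internal T" using internal_iff by blast
next
  fix A assume "A \<in> leafset ` internal T"
  then obtain v where v: "v \<in> internal T" "A = leafset v" by blast
  have "leafset v \<noteq> {i}" for i
  proof
    assume "leafset v = {i}"
    then have "v = lf i" using inj_onD[OF leafset_inj, of v "lf i"] internal_nonroot[OF v(1)] lf_leaf(2) leafset_lf by auto
    then show False using v(1) lf_leaf(1) by (auto simp: internal_def)
  qed
  moreover have "leafset v \<in> clades" using internal_nonroot[OF v(1)] by (simp add: clades_def)
  ultimately show "A \<in> inner" by (simp add: inner_def v(2))
qed

lemma children_clades: assumes "v \<in> nonroot" shows "children (leafset v) = (\<lambda>e. leafset (head T e)) ` out_arcs T v"
proof (intro equalityI subsetI)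
  fix A assume A: "A \<in> children (leafset v)"
  then obtain w where w: "w \<in> nonroot" "A = leafset w" using childD(1) by (auto simp: clades_def)
  have "leafset w \<subset> leafset v" using childD(2)[OF A] w by simp
  then have "v \<rightarrow>\<^sup>* w" "v \<noteq> w" using leafset_subset_iff[OF assms w(1)] by auto
  then obtain e where e: "e \<in> arcs T" "tail T e = v" "head T e \<rightarrow>\<^sup>* w" using first_arc by blast
  have "head T e = w"
  proof (rule ccontr)
    assume "head T e \<noteq> w"
    then have "leafset w \<subset> leafset (head T e)" by (rule leafset_strict[OF head_nonroot[OF e(1)] e(3)])
    moreover have "leafset (head T e) \<subset> leafset v"
      using leafset_strict[OF assms, of "head T e"] arc_reachable[OF e(1)] no_loops[OF e(1)] e(2) by auto
    moreover have "leafset (head T e) \<in> clades" using head_nonroot[OF e(1)] by (simp add: clades_def)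
    ultimately show False using A w(2) by (auto simp: children_def)
  qed
  then show "A \<in> (\<lambda>e. leafset (head T e)) ` out_arcs T v" using e w(2) by auto
next
  fix A assume "A \<in> (\<lambda>e. leafset (head T e)) ` out_arcs T v"
  then obtain e where e: "e \<in> arcs T" "tail T e = v" "A = leafset (head T e)" by auto
  have sub: "leafset (head T e) \<subset> leafset v"
    using leafset_strict[OF assms, of "head T e"] arc_reachable[OF e(1)] no_loops[OF e(1)] e(2) by auto
  have between: "\<not> B \<subset> leafset v" if B: "B \<in> clades" "leafset (head T e) \<subset> B" for B
  proof
    assume "B \<subset> leafset v"
    obtain x where x: "x \<in> nonroot" "B = leafset x" using B(1) by (auto simp: clades_def)
    have "v \<rightarrow>\<^sup>* x" "x \<rightarrow>\<^sup>* head T e"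
      using leafset_subset_iff assms x head_nonroot[OF e(1)] \<open>B \<subset> leafset v\<close> B(2) by auto
    then have "x = v \<or> x = head T e" using arc_nearest[OF e(1)] e(2) by simp
    then show False using \<open>B \<subset> leafset v\<close> B(2) x(2) by auto
  qed
  have "leafset (head T e) \<in> clades" using head_nonroot[OF e(1)] by (simp add: clades_def)
  with sub between show "A \<in> children (leafset v)"
    unfolding children_def e(3) mem_Collect_eq by (intro conjI ballI impI)
qed

lemma card_children_clades: assumes "v \<in> nonroot" shows "card (children (leafset v)) = out_degree T v"
proof -
  have "inj_on (\<lambda>e. leafset (head T e)) (out_arcs T v)"
  proof (rule inj_onI)
    fix e e' assume e: "e \<in> out_arcs T v" "e' \<in> out_arcs T v" "leafset (head T e) = leafset (head T e')"
    then have "head T e = head T e'" using inj_onD[OF leafset_inj e(3)] head_nonroot by simp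
    with e show "e = e'" using no_multi_arcs[of e e'] by (auto simp: arc_to_ends_def)
  qed
  then show ?thesis unfolding children_clades[OF assms] out_degree_def by (rule card_image)
qed

lemma lca_join: "lca T (lf i) (lf j) \<in> nonroot \<and> leafset (lca T (lf i) (lf j)) = join i j"
proof -
  obtain a where a: "a \<in> nonroot" "leafset a = join i j" using join_mem[of i j] by (auto simp: clades_def)
  have ij: "i \<in> leafset a" "j \<in> leafset a"
    using join_subset_iff[of "leafset a" i j] a by (auto simp: clades_def)
  have "lca T (lf i) (lf j) = a" unfolding lca_def
  proof (rule the_equality)
    have "b \<rightarrow>\<^sup>* a" if b: "common_ancestor T (lf i) (lf j) b" for b
    proof (cases "b = root")
      case True
      then show ?thesis using reachable_from_root a(1) by (simp add: nonroot_def)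
    next
      case False
      have "b \<in> verts T" using b unfolding common_ancestor_def by (elim conjE reachable_in_vertsE)
      then have bV: "b \<in> nonroot" using False by (simp add: nonroot_def)
      have "join i j \<subseteq> leafset b"
        using b bV join_subset_iff[of "leafset b" i j] by (auto simp: common_ancestor_def leafset_def clades_def)
      then show ?thesis using leafset_subset_iff[OF bV a(1)] a(2) by simp
    qed
    then show *: "common_ancestor T (lf i) (lf j) a \<and> (\<forall>b. common_ancestor T (lf i) (lf j) b \<longrightarrow> b \<rightarrow>\<^sup>* a)"
      using ij by (auto simp: common_ancestor_def leafset_def)
    show "b = a" if "common_ancestor T (lf i) (lf j) b \<and> (\<forall>c. common_ancestor T (lf i) (lf j) c \<longrightarrow> c \<rightarrow>\<^sup>* b)" for b
      using that * reachable_antisym by blast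
  qed
  with a show ?thesis by simp
qed

lemma lca_eq_iff: "lca T (lf i) (lf j) = lca T (lf k) (lf l) \<longleftrightarrow> join i j = join k l"
proof
  assume "lca T (lf i) (lf j) = lca T (lf k) (lf l)"
  then show "join i j = join k l" using lca_join[of i j] lca_join[of k l] by simp
next
  assume "join i j = join k l"
  then show "lca T (lf i) (lf j) = lca T (lf k) (lf l)"
    using lca_join[of i j] lca_join[of k l] inj_onD[OF leafset_inj] by simp
qed

lemma bmt_space_eq: "bmt_space T lf = lam_space"
proof -
  have "transpose \<Sigma> = \<Sigma>" if "\<Sigma> \<in> lam_space" for \<Sigma>
  proof -
    have "\<Sigma> $ j $ i = \<Sigma> $ i $ j" for i j
      using that[unfolded lam_space_def mem_Collect_eq, rule_format, OF join_sym] .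
    then show ?thesis by (simp add: transpose_def vec_eq_iff)
  qed
  then show ?thesis unfolding bmt_space_def lca_eq_iff unfolding lam_space_def by blast
qed

lemma has_rmld_bmt_space:
  "has_rmld (bmt_space T lf) (\<Prod>v\<in>internal T. 2 ^ out_degree T v - out_degree T v - 1)"
proof -
  have "inj_on leafset (internal T)" using inj_on_subset[OF leafset_inj] internal_nonroot by blast
  then have "(\<Prod>A\<in>inner. 2 ^ card (children A) - card (children A) - 1) =
      (\<Prod>v\<in>internal T. 2 ^ card (children (leafset v)) - card (children (leafset v)) - 1 :: nat)"
    unfolding inner_clades by (simp add: prod.reindex)
  also have "\<dots> = (\<Prod>v\<in>internal T. 2 ^ out_degree T v - out_degree T v - 1)"
    using internal_nonroot by (intro prod.cong refl) (simp add: card_children_clades)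
  finally show ?thesis using has_rmld_lam_space by (simp add: bmt_space_eq)
qed

end

theorem theorem1p3:
  fixes T :: "('v, 'e) pre_digraph"
    and r :: 'v
    and lf :: "'n::finite \<Rightarrow> 'v"
  assumes "rooted_tree T r"
    and "r \<in> leaves T"
    and "bij_betw lf UNIV (leaves T - {r})"
    and "\<And>v. v \<in> verts T \<Longrightarrow> vdegree T v \<noteq> 2"
  shows "has_rmld (bmt_space T lf)
           (\<Prod>v\<in>internal T. 2 ^ out_degree T v - out_degree T v - 1)"
proof -
  interpret rooted_tree T r by (rule assms(1))
  interpret phylogenetic_tree T r lf by unfold_locales (use assms in auto)
  show ?thesis by (rule has_rmld_bmt_space)
qed

end
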